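(* Let $k$ be a field, let $\sigma\subseteq\mathbb R^d$ be a $d$-dimensional pointed rational cone, and let $A=k[\mathbb Z^d\cap\sigma]_{\mathfrak m_A}$. Let $I\subset A$ be a monomial ideal (an ideal generated by monomials $x^q$, $q\in\mathbb Z^d\cap\sigma$). Then $$j(I)=d!\,\operatorname{vol}(\operatorname{pyr}(I)).$$
   Context: A rational cone $\sigma\subseteq\mathbb R^d$ is a convex polyhedral cone with finitely many extremal rays, each containing a nonzero lattice point of $\mathbb Z^d$; it is pointed if it contains no nontrivial linear subspace of $\mathbb R^d$. The semigroup ring $k[\mathbb Z^d\cap\sigma]$ has $k$-basis $\{x^q\mid q\in\mathbb Z^d\cap\sigma\}$ with multiplication $x^{q_1}x^{q_2}=x^{q_1+q_2}$, and $\mathfrak m_A$ is its maximal homogeneous ideal (generated by the $x^q$ with $q\neq 0$); $A$ is the localization there, a local ring of dimension $d$. For a Noetherian local ring $(A,\mathfrak m)$ of dimension $d$ and an ideal $I\subset A$, the $j$-multiplicity is $$j(I)=\lim_{n\to\infty}\frac{(d-1)!}{n^{d-1}}\,\lambda_A\big(\operatorname{H}^0_{\mathfrak m}(I^n/I^{n+1})\big),$$ where $\lambda_A$ is length and $\operatorname{H}^0_{\mathfrak m}(M)=(0:_M\mathfrak m^\infty)$ is the set of elements of $M$ annihilated by some power of $\mathfrak m$. If $I$ is minimally generated by monomials $x^{v_1},\dots,x^{v_n}$, put $\operatorname{conv}(I)=\operatorname{conv}(v_1,\dots,v_n)+\sigma$ (Minkowski sum), a polyhedron in $\mathbb R^d$.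 A facet is a $(d-1)$-dimensional face. For a polytope $\mathcal P\subset\mathbb R^d$, $\operatorname{pyr}(\mathcal P)=\operatorname{conv}(\mathcal P,\boldsymbol 0)$ is the convex hull of $\mathcal P$ and the origin, and $\operatorname{pyr}(I)=\bigcup_{\mathcal F}\operatorname{pyr}(\mathcal F)$, the union over all bounded facets $\mathcal F$ of $\operatorname{conv}(I)$ (empty if there are none). $\operatorname{vol}$ is $d$-dimensional Lebesgue measure on $\mathbb R^d$. *)

theory Defs
  imports
    "HOL-Analysis.Analysis"
    "HOL-Algebra.Module"
    "HOL-Algebra.Ideal_Product"
    "HOL-Library.Poly_Mapping"
    "HOL-Library.Extended_Nat"
    "HOL-Library.Extended_Real"
begin

section \<open>Rational cones\<close>

definition lattice_points :: "(real ^ 'd) set \<Rightarrow> (real ^ 'd) set" where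
  "lattice_points \<sigma> = {q \<in> \<sigma>. \<forall>i. q $ i \<in> \<int>}"

definition extremal_ray :: "'a::real_vector set \<Rightarrow> 'a set \<Rightarrow> bool" where
  "extremal_ray \<sigma> r \<longleftrightarrow> r face_of \<sigma> \<and> (\<exists>v. v \<noteq> 0 \<and> r = {t *\<^sub>R v | t. 0 \<le> t})"

definition rational_cone :: "(real ^ 'd) set \<Rightarrow> bool" where
  "rational_cone \<sigma> \<longleftrightarrow> convex_cone \<sigma> \<and> polyhedron \<sigma> \<and> finite {r. extremal_ray \<sigma> r} \<and>
     (\<forall>r. extremal_ray \<sigma> r \<longrightarrow> (\<exists>q \<in> lattice_points r. q \<noteq> 0))"

definition pointed :: "'a::real_vector set \<Rightarrow> bool" where
  "pointed \<sigma> \<longleftrightarrow> (\<forall>L. subspace L \<and> L \<subseteq> \<sigma> \<longrightarrow> L = {0})"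


section \<open>Localization of a commutative ring\<close>

definition loc_rel :: "('a, 'm) ring_scheme \<Rightarrow> 'a set \<Rightarrow> (('a \<times> 'a) \<times> ('a \<times> 'a)) set" where
  "loc_rel R S = {((a, s), (b, t)). a \<in> carrier R \<and> s \<in> S \<and> b \<in> carrier R \<and> t \<in> S \<and>
     (\<exists>u \<in> S. u \<otimes>\<^bsub>R\<^esub> (a \<otimes>\<^bsub>R\<^esub> t \<ominus>\<^bsub>R\<^esub> b \<otimes>\<^bsub>R\<^esub> s) = \<zero>\<^bsub>R\<^esub>)}"

definition loc_frac :: "('a, 'm) ring_scheme \<Rightarrow> 'a set \<Rightarrow> 'a \<Rightarrow> 'a \<Rightarrow> ('a \<times> 'a) set" where
  "loc_frac R S a s = loc_rel R S `` {(a, s)}"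

definition localization :: "('a, 'm) ring_scheme \<Rightarrow> 'a set \<Rightarrow> ('a \<times> 'a) set ring" where
  "localization R S =
    \<lparr> carrier = (carrier R \<times> S) // loc_rel R S,
      mult = (\<lambda>X Y. \<Union>(a, s) \<in> X. \<Union>(b, t) \<in> Y. loc_frac R S (a \<otimes>\<^bsub>R\<^esub> b) (s \<otimes>\<^bsub>R\<^esub> t)),
      one = loc_frac R S \<one>\<^bsub>R\<^esub> \<one>\<^bsub>R\<^esub>,
      zero = loc_frac R S \<zero>\<^bsub>R\<^esub> \<one>\<^bsub>R\<^esub>,
      add = (\<lambda>X Y. \<Union>(a, s) \<in> X. \<Union>(b, t) \<in> Y.
               loc_frac R S (a \<otimes>\<^bsub>R\<^esub> t \<oplus>\<^bsub>R\<^esub> b \<otimes>\<^bsub>R\<^esub> s) (s \<otimes>\<^bsub>R\<^esub> t)) \<rparr>"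

definition localization_at :: "('a, 'm) ring_scheme \<Rightarrow> 'a set \<Rightarrow> ('a \<times> 'a) set ring" where
  "localization_at R P = localization R (carrier R - P)"


section \<open>Dimension, length, local cohomology in degree 0\<close>

definition krull_dim :: "('a, 'm) ring_scheme \<Rightarrow> enat" where
  "krull_dim R = Sup {enat n | n. \<exists>P :: nat \<Rightarrow> 'a set.
     (\<forall>i\<le>n. primeideal (P i) R) \<and> (\<forall>i<n. P i \<subset> P (Suc i))}"

definition local_max_ideal :: "('a, 'm) ring_scheme \<Rightarrow> 'a set" where
  "local_max_ideal R = (THE M. maximalideal M R)"

definition module_length :: "('a, 'm) ring_scheme \<Rightarrow> ('a, 'b, 'c) module_scheme \<Rightarrow> enat" where
  "module_length R M = Sup {enat n | n. \<exists>N :: nat \<Rightarrow> 'b set.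
     (\<forall>i\<le>n. submodule (N i) R M) \<and> (\<forall>i<n. N i \<subset> N (Suc i))}"

text \<open>The record type of modules extends that of rings; the fields \<open>mult\<close> and \<open>one\<close> play no
  role in a module and are filled arbitrarily in the next two definitions.\<close>

definition ideal_module :: "('a, 'm) ring_scheme \<Rightarrow> 'a set \<Rightarrow> ('a, 'a) module" where
  "ideal_module R I =
    \<lparr> carrier = I, mult = mult R, one = one R, zero = zero R, add = add R, smult = mult R \<rparr>"

definition quotient_module ::
    "('a, 'b, 'c) module_scheme \<Rightarrow> 'b set \<Rightarrow> ('a, 'b set) module" where
  "quotient_module M N =
    \<lparr> carrier = a_rcosets\<^bsub>M\<^esub> N, mult = undefined, one = undefined,
      zero = N, add = set_add M, smult = (\<lambda>a X. \<Union>x \<in> X. N +>\<^bsub>M\<^esub> (a \<odot>\<^bsub>M\<^esub> x)) \<rparr>"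

text \<open>\<open>ideals_set R\<close> has \<open>ideal_prod R\<close> as multiplication and \<open>carrier R\<close> as unit.\<close>

abbreviation ideal_power :: "('a, 'm) ring_scheme \<Rightarrow> 'a set \<Rightarrow> nat \<Rightarrow> 'a set" where
  "ideal_power R I n \<equiv> I [^]\<^bsub>ideals_set R\<^esub> n"

definition H0 ::
    "('a, 'm) ring_scheme \<Rightarrow> 'a set \<Rightarrow> ('a, 'b, 'c) module_scheme \<Rightarrow> ('a, 'b, 'c) module_scheme" where
  "H0 R I M = M \<lparr> carrier := {x \<in> carrier M. \<exists>t. \<forall>a \<in> ideal_power R I t. a \<odot>\<^bsub>M\<^esub> x = \<zero>\<^bsub>M\<^esub>} \<rparr>"


section \<open>The j-multiplicity of an ideal of a local ring\<close>

definition j_sequence :: "('a, 'm) ring_scheme \<Rightarrow> 'a set \<Rightarrow> nat \<Rightarrow> ereal" where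
  "j_sequence R I n =
    (let d = the_enat (krull_dim R) in
      ereal (fact (d - 1) / real n ^ (d - 1)) *
      ereal_of_enat (module_length R
        (H0 R (local_max_ideal R)
          (quotient_module (ideal_module R (ideal_power R I n)) (ideal_power R I (Suc n))))))"

definition j_multiplicity :: "('a, 'm) ring_scheme \<Rightarrow> 'a set \<Rightarrow> ereal" where
  "j_multiplicity R I = lim (j_sequence R I)"


section \<open>Normal affine semigroup rings and their monomial ideals\<close>

text \<open>\<open>'v \<Rightarrow>\<^sub>0 'k\<close> carries the convolution product, i.e. it is the monoid algebra of the additive
  monoid \<open>'v\<close>; the semigroup ring is its subring of elements supported on lattice points of the cone.\<close>

definition semigroup_ring :: "(real ^ 'd) set \<Rightarrow> ((real ^ 'd) \<Rightarrow>\<^sub>0 'k::field) ring" where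
  "semigroup_ring \<sigma> =
    \<lparr> carrier = {f. Poly_Mapping.keys f \<subseteq> lattice_points \<sigma>},
      mult = (*), one = 1, zero = 0, add = (+) \<rparr>"

abbreviation monom :: "'v \<Rightarrow> ('v \<Rightarrow>\<^sub>0 'k::field)" where
  "monom q \<equiv> Poly_Mapping.single q 1"

definition homogeneous_max_ideal :: "(real ^ 'd) set \<Rightarrow> ((real ^ 'd) \<Rightarrow>\<^sub>0 'k::field) set" where
  "homogeneous_max_ideal \<sigma> = Idl\<^bsub>semigroup_ring \<sigma>\<^esub> (monom ` (lattice_points \<sigma> - {0}))"

definition local_semigroup_ring ::
    "(real ^ 'd) set \<Rightarrow> (((real ^ 'd) \<Rightarrow>\<^sub>0 'k::field) \<times> ((real ^ 'd) \<Rightarrow>\<^sub>0 'k)) set ring" where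
  "local_semigroup_ring \<sigma> = localization_at (semigroup_ring \<sigma>) (homogeneous_max_ideal \<sigma>)"

definition loc_monom ::
    "(real ^ 'd) set \<Rightarrow> real ^ 'd \<Rightarrow> (((real ^ 'd) \<Rightarrow>\<^sub>0 'k::field) \<times> ((real ^ 'd) \<Rightarrow>\<^sub>0 'k)) set" where
  "loc_monom \<sigma> q =
    loc_frac (semigroup_ring \<sigma>) (carrier (semigroup_ring \<sigma>) - homogeneous_max_ideal \<sigma>) (monom q) 1"

definition monomials_ideal ::
    "(real ^ 'd) set \<Rightarrow> (real ^ 'd) set \<Rightarrow> (((real ^ 'd) \<Rightarrow>\<^sub>0 'k::field) \<times> ((real ^ 'd) \<Rightarrow>\<^sub>0 'k)) set set" where
  "monomials_ideal \<sigma> V = Idl\<^bsub>local_semigroup_ring \<sigma>\<^esub> (loc_monom \<sigma> ` V)"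

definition monomial_ideal ::
    "(real ^ 'd) set \<Rightarrow> (((real ^ 'd) \<Rightarrow>\<^sub>0 'k::field) \<times> ((real ^ 'd) \<Rightarrow>\<^sub>0 'k)) set set \<Rightarrow> bool" where
  "monomial_ideal \<sigma> I \<longleftrightarrow> (\<exists>V \<subseteq> lattice_points \<sigma>. I = monomials_ideal \<sigma> V)"

text \<open>For a pointed rational cone, every monomial ideal has exactly one minimal set of
  monomial generators.\<close>

definition min_gen_exponents ::
    "(real ^ 'd) set \<Rightarrow> (((real ^ 'd) \<Rightarrow>\<^sub>0 'k::field) \<times> ((real ^ 'd) \<Rightarrow>\<^sub>0 'k)) set set \<Rightarrow> (real ^ 'd) set" where
  "min_gen_exponents \<sigma> I = (THE V. V \<subseteq> lattice_points \<sigma> \<and> I = monomials_ideal \<sigma> V \<and>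
     (\<forall>W. W \<subset> V \<longrightarrow> monomials_ideal \<sigma> W \<noteq> I))"


section \<open>The pyramid of a monomial ideal\<close>

definition newton_polyhedron ::
    "(real ^ 'd) set \<Rightarrow> (((real ^ 'd) \<Rightarrow>\<^sub>0 'k::field) \<times> ((real ^ 'd) \<Rightarrow>\<^sub>0 'k)) set set \<Rightarrow> (real ^ 'd) set" where
  "newton_polyhedron \<sigma> I = {x + y | x y. x \<in> convex hull (min_gen_exponents \<sigma> I) \<and> y \<in> \<sigma>}"

definition pyr :: "'a::real_vector set \<Rightarrow> 'a set" where
  "pyr P = convex hull (insert 0 P)"

definition ideal_pyr ::
    "(real ^ 'd) set \<Rightarrow> (((real ^ 'd) \<Rightarrow>\<^sub>0 'k::field) \<times> ((real ^ 'd) \<Rightarrow>\<^sub>0 'k)) set set \<Rightarrow> (real ^ 'd) set" where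
  "ideal_pyr \<sigma> I = \<Union> {pyr F | F. F facet_of (newton_polyhedron \<sigma> I) \<and> bounded F}"

end

theory Submission
  imports Defs
begin

text \<open>
  Write \<open>S = \<int>\<^sup>d \<inter> \<sigma>\<close> and let \<open>E \<subseteq> S\<close> be the set of exponents of \<open>I\<close>. The module
  \<open>H\<^sup>0(I\<^sup>n / I\<^sup>n\<^sup>+\<^sup>1)\<close> is spanned by monomials, so its length is the number \<open>L(n)\<close> of \<open>q \<in> nE\<close>, \<open>q \<notin> (n + 1)E\<close>
  with \<open>q + s \<in> (n + 1)E\<close> for all \<open>s\<close> in a power of the maximal ideal. These \<open>q\<close> are the degrees of a
  difference of monomial ideals in a polynomial ring, hence \<open>L\<close> is eventually nondecreasing, and it
  suffices to show that \<open>L(0) + \<dots> + L(n - 1)\<close> is asymptotic to \<open>n\<^sup>d vol(pyr I)\<close>.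

  Let \<open>l\<close> range over the functionals with \<open>l = 1\<close> on a facet of the Newton polyhedron. Up to a bounded error
  \<open>q \<in> nE\<close> means \<open>l \<bullet> q \<ge> n\<close> for all \<open>l\<close>. If the minimum of \<open>l \<bullet> q\<close> is attained at a bounded facet only,
  then moving \<open>q\<close> far into the cone increases all \<open>l \<bullet> q\<close>, so \<open>q\<close> is torsion; these points fill the dilated
  pyramids. If it is attained at an unbounded facet, \<open>l\<close> is constant in a direction of the cone along
  which torsion points are rare, so that there are only \<open>o(n\<^sup>d)\<close> of them.
\<close>

section \<open>Upward closed sets of exponents and monotone counting functions\<close>

text \<open>A single \<open>L(n)\<close> cannot be counted directly by inequalities: its points form
  a layer of bounded thickness in the dilated polyhedron, and the error between \<open>nE\<close>
  and the inequalities is of the same size. Summation over \<open>n\<close> removes this obstacle. A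
  lattice point lies in at most one difference of consecutive powers, so the sum counts points of
  one dilated body, and an error of bounded width at its boundary is of lower order. The price is
  the return from partial sums to terms, which fails for general sequences and needs monotonicity.
  Monotonicity comes from the Rees algebra, a quotient of the polynomial ring with one variable for
  each generator of the monoid \<open>S\<close> and one for each generator of the ideal. The torsion
  of all graded pieces together is killed by one fixed power of the maximal ideal, so it involves
  only finitely many monomials in the first kind of variables. Over the second kind it is a finite
  sum of differences of monomial ideals, whose counting functions are nondecreasing from some point
  on.\<close>

text \<open>The exponents of a monomial ideal in \<open>k\<close> variables; lists permit induction
  on \<open>k\<close> by splitting off the first exponent.\<close>

definition upset :: "nat \<Rightarrow> nat list set \<Rightarrow> bool" where
  "upset k U \<longleftrightarrow> U \<subseteq> {u. length u = k} \<and> (\<forall>u\<in>U. \<forall>v. list_all2 (\<le>) u v \<longrightarrow> v \<in> U)"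

definition slice :: "nat \<Rightarrow> nat list set \<Rightarrow> nat list set" where
  "slice i U = {u. i # u \<in> U}"

lemma upset_slice: "upset (Suc k) U \<Longrightarrow> upset k (slice i U)"
  unfolding upset_def slice_def by force

lemma slice_mono:
  assumes "upset (Suc k) U" "i \<le> j"
  shows "slice i U \<subseteq> slice j U"
proof
  fix u assume "u \<in> slice i U"
  then have "i # u \<in> U" by (simp add: slice_def)
  moreover have "list_all2 (\<le>) (i # u) (j # u)" using assms(2) by (simp add: list_all2_refl)
  ultimately show "u \<in> slice j U" using assms(1) unfolding upset_def slice_def by blast
qed

text \<open>Dickson's lemma as an ascending chain condition, by induction on the number of
  variables: the chain of diagonal slices stabilizes, and so does each of the finitely many slices
  of smaller index.\<close>

lemma upset_chain_stabilizes:
  fixes U :: "nat \<Rightarrow> nat list set"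
  assumes "\<And>n. upset k (U n)" and "\<And>m n. m \<le> n \<Longrightarrow> U m \<subseteq> U n"
  shows "\<exists>N. \<forall>n\<ge>N. U n = U N"
  using assms
proof (induction k arbitrary: U)
  case 0
  then have sub: "U n \<subseteq> {[]}" for n unfolding upset_def by force
  show ?case
  proof (cases "\<exists>N. U N = {[]}")
    case True
    then show ?thesis using sub 0(2) by (metis subset_antisym)
  next
    case False
    then have "U n = {}" for n using sub by blast
    then show ?thesis by simp
  qed
next
  case (Suc k)
  note slm = slice_mono[OF Suc.prems(1)]
  have slU: "slice i (U m) \<subseteq> slice i (U n)" if "m \<le> n" for i m n
    using Suc.prems(2)[OF that] unfolding slice_def by blast
  have up: "upset k (slice i (U n))" for i n using upset_slice[OF Suc.prems(1)] .
  \<comment> \<open>The diagonal slices increase as well; their stable value controls all slices of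
    index at least \<open>N0\<close>.\<close>
  have "\<exists>N. \<forall>n\<ge>N. slice n (U n) = slice N (U N)"
    by (rule Suc.IH) (use up slm slU in blast)+
  then obtain N0 where N0: "\<And>n. n \<ge> N0 \<Longrightarrow> slice n (U n) = slice N0 (U N0)" by blast
  have "\<exists>N. \<forall>n\<ge>N. slice i (U n) = slice i (U N)" for i
    by (rule Suc.IH) (use up slU in blast)+
  then obtain f where f: "\<And>i n. n \<ge> f i \<Longrightarrow> slice i (U n) = slice i (U (f i))" by metis
  define N where "N = Max (insert N0 (f ` {..<N0}))"
  have NN: "N0 \<le> N" "\<And>i. i < N0 \<Longrightarrow> f i \<le> N" unfolding N_def by auto
  have "U n = U N" if n: "n \<ge> N" for n
  proof
    show "U N \<subseteq> U n" using Suc.prems(2) n .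
    show "U n \<subseteq> U N"
    proof
      fix v assume v: "v \<in> U n"
      then obtain i u where iu: "v = i # u"
        using Suc.prems(1) unfolding upset_def by (cases v) force+
      have u: "u \<in> slice i (U n)" using v iu by (simp add: slice_def)
      have "u \<in> slice i (U N)"
      proof (cases "i < N0")
        case True
        then show ?thesis using u f[of i n] f[of i N] NN(2)[of i] n by auto
      next
        case False
        have "u \<in> slice (max n i) (U (max n i))"
          using u slm[of i "max n i" n] slU[of n "max n i" "max n i"] by auto
        then have "u \<in> slice N0 (U N0)" using N0 False by (metis max.coboundedI2 not_less)
        then show ?thesis using slm[of N0 i N0] slU[of N0 N i] False NN by auto
      qed
      then show "v \<in> U N" using iu by (simp add: slice_def)
    qed
  qed
  then show ?case by blast
qed

text \<open>The elements lying above members of \<open>Z\<close> of degree at most \<open>M\<close>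
  form upward closed sets that increase with \<open>M\<close>, so they stabilize; every member of
  \<open>Z\<close> is caught for some \<open>M\<close>.\<close>

lemma upset_bounded_basis:
  assumes "upset k Z"
  shows "\<exists>M. \<forall>u\<in>Z. \<exists>b\<in>Z. list_all2 (\<le>) b u \<and> sum_list b \<le> M"
proof -
  define U where "U M = {u \<in> Z. \<exists>b\<in>Z. list_all2 (\<le>) b u \<and> sum_list b \<le> M}" for M
  have tr: "list_all2 (\<le>) a (c :: nat list)" if "list_all2 (\<le>) a b" "list_all2 (\<le>) b c" for a b c
    using list_all2_trans[OF _ that] by fastforce
  have "\<exists>N. \<forall>n\<ge>N. U n = U N"
  proof (rule upset_chain_stabilizes)
    show "upset k (U n)" for n
      unfolding upset_def
    proof (intro conjI ballI allI impI)
      show "U n \<subseteq> {u. length u = k}" using assms unfolding U_def upset_def by blast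
      fix u v assume u: "u \<in> U n" and uv: "list_all2 (\<le>) u v"
      have "v \<in> Z" using assms u uv unfolding U_def upset_def by blast
      moreover obtain b where "b \<in> Z" "list_all2 (\<le>) b u" "sum_list b \<le> n"
        using u unfolding U_def by blast
      ultimately show "v \<in> U n" using tr[OF _ uv] unfolding U_def by blast
    qed
    show "U m \<subseteq> U n" if "m \<le> n" for m n
      using that unfolding U_def by fastforce
  qed
  then obtain N where N: "\<And>n. n \<ge> N \<Longrightarrow> U n = U N" by blast
  have "u \<in> U N" if "u \<in> Z" for u
  proof -
    have "u \<in> U (max N (sum_list u))"
      unfolding U_def using that list_all2_refl[of "(\<le>)" u]
      by (intro CollectI conjI bexI[of _ u]) simp_all
    then show ?thesis using N[of "max N (sum_list u)"] by simp
  qed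
  then show ?thesis unfolding U_def by blast
qed

text \<open>A weak consequence of the eventual polynomiality of Hilbert functions, stable under sums
  and shifts; it suffices for passing from partial sums to terms.\<close>

definition ev_mono :: "(nat \<Rightarrow> nat) \<Rightarrow> bool" where
  "ev_mono a \<longleftrightarrow> (\<exists>N. \<forall>n\<ge>N. a n \<le> a (Suc n))"

lemma ev_mono_cong:
  assumes "ev_mono a" "\<And>n. n \<ge> N \<Longrightarrow> a n = b n"
  shows "ev_mono b"
proof -
  obtain M where "\<And>n. n \<ge> M \<Longrightarrow> a n \<le> a (Suc n)" using assms(1) ev_mono_def by auto
  then have "\<forall>n\<ge>max M N. b n \<le> b (Suc n)" using assms(2) by (metis le_Suc_eq max.bounded_iff)
  then show ?thesis unfolding ev_mono_def by blast
qed

lemma ev_mono_add: "ev_mono a \<Longrightarrow> ev_mono b \<Longrightarrow> ev_mono (\<lambda>n. a n + b n)"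
  unfolding ev_mono_def by (meson add_mono max.bounded_iff)

lemma ev_mono_sum: "(\<And>i. i \<in> A \<Longrightarrow> ev_mono (a i)) \<Longrightarrow> ev_mono (\<lambda>n. \<Sum>i\<in>A. a i n)"
  by (induction A rule: infinite_finite_induct) (auto intro: ev_mono_add, auto simp: ev_mono_def)

lemma ev_mono_shift: "ev_mono a \<Longrightarrow> ev_mono (\<lambda>n. a (n - i))"
  unfolding ev_mono_def by (metis Suc_diff_le add_leD1 le_add_diff_inverse le_diff_conv2 add.commute)

lemma finite_lists_sum: "finite {u :: nat list. length u = k \<and> sum_list u = n}"
proof (rule finite_subset)
  show "{u :: nat list. length u = k \<and> sum_list u = n} \<subseteq> {u. set u \<subseteq> {..n} \<and> length u = k}"
    using member_le_sum_list by fastforce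
  show "finite {u. set u \<subseteq> {..n} \<and> length u = k}"
    by (rule finite_lists_length_eq) simp
qed

text \<open>Split by the first exponent \<open>i\<close>. From some \<open>N\<close> on the slices
  no longer depend on \<open>i\<close>, so these \<open>i\<close> contribute a partial sum of the
  fixed sequence \<open>c N\<close>, which grows with \<open>n\<close>; the finitely many smaller
  \<open>i\<close> contribute shifted counts covered by induction.\<close>

lemma ev_mono_card_upset_diff:
  assumes "upset k Z" "upset k U"
  shows "ev_mono (\<lambda>n. card {u \<in> Z - U. sum_list u = n})"
  using assms
proof (induction k arbitrary: Z U)
  case 0
  then have "Z \<subseteq> {[]}" by (force simp: upset_def)
  then have "card {u \<in> Z - U. sum_list u = n} = 0" if "n \<ge> 1" for n
    using that by (intro card_eq_0_iff[THEN iffD2]) fastforce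
  then show ?case unfolding ev_mono_def by (intro exI[of _ 1] allI impI) (metis le0)
next
  case (Suc k)
  define c where "c i n = card {u \<in> slice i Z - slice i U. sum_list u = n}" for i n
  have c: "ev_mono (c i)" for i
    unfolding c_def by (rule Suc.IH) (use Suc.prems upset_slice in blast)+
  have split: "card {u \<in> Z - U. sum_list u = n} = (\<Sum>i\<le>n. c i (n - i))" for n
  proof -
    have eq: "{u \<in> Z - U. sum_list u = n} =
        (\<Union>i\<in>{..n}. (#) i ` {u \<in> slice i Z - slice i U. sum_list u = n - i})" (is "?L = ?R")
    proof
      show "?L \<subseteq> ?R"
      proof
        fix u assume u: "u \<in> ?L"
        then have "length u = Suc k" using Suc.prems unfolding upset_def by auto
        then obtain i v where iv: "u = i # v" by (cases u) auto
        then have "i \<le> n" "v \<in> {u \<in> slice i Z - slice i U. sum_list u = n - i}"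
          using u by (auto simp: slice_def)
        then show "u \<in> ?R" using iv by blast
      qed
      show "?R \<subseteq> ?L" by (auto simp: slice_def)
    qed
    have fin: "finite {u \<in> slice i Z - slice i U. sum_list u = m}" for i m
    proof (rule finite_subset[OF _ finite_lists_sum])
      show "{u \<in> slice i Z - slice i U. sum_list u = m} \<subseteq> {u. length u = k \<and> sum_list u = m}"
        using upset_slice[OF Suc.prems(1)] unfolding upset_def by auto
    qed
    show ?thesis unfolding eq
      using fin by (subst card_UN_disjoint) (auto simp: c_def card_image intro!: finite_imageI)
  qed
  have "\<exists>N. \<forall>n\<ge>N. slice n Z = slice N Z"
    by (rule upset_chain_stabilizes[where k=k]) (use Suc.prems upset_slice slice_mono in blast)+
  moreover have "\<exists>N. \<forall>n\<ge>N. slice n U = slice N U"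
    by (rule upset_chain_stabilizes[where k=k]) (use Suc.prems upset_slice slice_mono in blast)+
  ultimately obtain N1 N2 where N1: "\<forall>n\<ge>N1. slice n Z = slice N1 Z"
    and N2: "\<forall>n\<ge>N2. slice n U = slice N2 U" by blast
  define N where "N = max N1 N2"
  have N: "c n = c N" if "n \<ge> N" for n
  proof -
    have "slice n Z = slice N Z" "slice n U = slice N U"
      using N1[rule_format, of n] N1[rule_format, of N] N2[rule_format, of n] N2[rule_format, of N] that
      unfolding N_def by auto
    then show ?thesis unfolding c_def by simp
  qed
  have eq: "(\<Sum>i<N. c i (n - i)) + (\<Sum>j\<le>n-N. c N j) = card {u \<in> Z - U. sum_list u = n}"
    if "n \<ge> N" for n
  proof -
    have "{..n} = {..<N} \<union> {N..n}" using that by auto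
    then have "(\<Sum>i\<le>n. c i (n - i)) = (\<Sum>i<N. c i (n - i)) + (\<Sum>i\<in>{N..n}. c i (n - i))"
      by (simp add: sum.union_disjoint ivl_disj_int)
    also have "(\<Sum>i\<in>{N..n}. c i (n - i)) = (\<Sum>i\<in>{N..n}. c N (n - i))"
    proof (rule sum.cong[OF refl])
      fix i assume "i \<in> {N..n}"
      then have "c i = c N" by (intro N) simp
      then show "c i (n - i) = c N (n - i)" by simp
    qed
    also have "\<dots> = (\<Sum>j\<le>n-N. c N j)"
      by (rule sum.reindex_bij_witness[where i="\<lambda>j. n - j" and j="\<lambda>i. n - i"]) (use that in auto)
    finally show ?thesis using split by simp
  qed
  have "ev_mono (\<lambda>n. (\<Sum>i<N. c i (n - i)) + (\<Sum>j\<le>n-N. c N j))"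
  proof (rule ev_mono_add)
    show "ev_mono (\<lambda>n. \<Sum>i<N. c i (n - i))" by (intro ev_mono_sum ev_mono_shift c)
    show "ev_mono (\<lambda>n. \<Sum>j\<le>n-N. c N j)"
      unfolding ev_mono_def by (auto intro!: sum_mono2)
  qed
  then show ?case using eq by (rule ev_mono_cong)
qed

section \<open>Terms of a monotone sequence from its partial sums\<close>

lemma diff_quot_power_tendsto:
  "((\<lambda>h. ((1 + h) ^ d - 1) / h) \<longlongrightarrow> real d) (at (0::real))"
proof -
  have "DERIV (\<lambda>x. x ^ d) (1::real) :> real d"
    using DERIV_pow[of d "1::real" UNIV] by simp
  then show ?thesis unfolding DERIV_def by simp
qed

text \<open>Averaging the increments over a window of length \<open>h = \<delta> n\<close> on either side of \<open>n\<close>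
  bounds the monotone sequence by difference quotients of \<open>x \<mapsto> x\<^sup>d\<close> at \<open>1\<close>.\<close>

lemma increments_tendsto_of_partial_sums:
  fixes a :: "nat \<Rightarrow> nat"
  assumes mono: "ev_mono a"
    and lim: "(\<lambda>n. real (\<Sum>m<n. a m) / real n ^ Suc e) \<longlonglongrightarrow> C"
  shows "(\<lambda>n. real (a n) / real n ^ e) \<longlonglongrightarrow> real (Suc e) * C"
proof -
  obtain N where N: "\<And>n. n \<ge> N \<Longrightarrow> a n \<le> a (Suc n)" using mono ev_mono_def by blast
  have mon: "a m \<le> a n" if "N \<le> m" "m \<le> n" for m n
    using that(2) by (induction rule: dec_induct) (use that N le_trans in \<open>auto intro: le_trans\<close>)
  define s where "s n = real (\<Sum>m<n. a m)" for n
  have sdiff: "s q - s p = real (\<Sum>m\<in>{p..<q}. a m)" if "p \<le> q" for p q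
  proof -
    have "(\<Sum>m<q. a m) = (\<Sum>m<p. a m) + (\<Sum>m\<in>{p..<q}. a m)"
      by (simp add: lessThan_atLeast0 sum.atLeastLessThan_concat that)
    then show ?thesis by (simp add: s_def)
  qed
  \<comment> \<open>The hypothesis is used at \<open>k n\<close> instead of \<open>n\<close>;
    replacing the denominator by a power of \<open>n\<close> costs the factor
    \<open>c ^ Suc e\<close>.\<close>
  have scaled: "(\<lambda>n. s (k n) / real n ^ Suc e) \<longlonglongrightarrow> C * c ^ Suc e"
    if k: "(\<lambda>n. real (k n) / real n) \<longlonglongrightarrow> c" "c > 0" for k c
  proof -
    have "filterlim (\<lambda>n. real (k n) / real n * real n) at_top sequentially"
      by (rule filterlim_tendsto_pos_mult_at_top[OF k filterlim_real_sequentially])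
    moreover have "\<forall>\<^sub>F n in sequentially. real (k n) / real n * real n = real (k n)"
      using eventually_gt_at_top[of 0] by eventually_elim simp
    ultimately have "filterlim (\<lambda>n. real (k n)) at_top sequentially"
      by (simp add: filterlim_cong)
    then have kt: "filterlim k at_top sequentially"
      using filterlim_sequentially_iff_filterlim_real by blast
    have "(\<lambda>n. s (k n) / real (k n) ^ Suc e) \<longlonglongrightarrow> C"
      using filterlim_compose[OF lim kt] unfolding s_def .
    then have "(\<lambda>n. s (k n) / real (k n) ^ Suc e * (real (k n) / real n) ^ Suc e) \<longlonglongrightarrow> C * c ^ Suc e"
      by (intro tendsto_mult tendsto_power k)
    moreover have "\<forall>\<^sub>F n in sequentially. s (k n) / real (k n) ^ Suc e * (real (k n) / real n) ^ Suc e
        = s (k n) / real n ^ Suc e"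
      using filterlim_at_top[THEN iffD1, OF kt, rule_format, of 1]
      by eventually_elim (simp add: power_divide)
    ultimately show ?thesis by (rule Lim_transform_eventually)
  qed
  have fl: "(\<lambda>n. real (nat \<lfloor>\<delta> * real n\<rfloor>) / real n) \<longlonglongrightarrow> \<delta>" if "\<delta> > 0" for \<delta> :: real
  proof (rule tendsto_sandwich)
    show "\<forall>\<^sub>F n in sequentially. \<delta> - 1 / real n \<le> real (nat \<lfloor>\<delta> * real n\<rfloor>) / real n"
      using eventually_gt_at_top[of 0]
    proof eventually_elim
      case (elim n)
      have "\<delta> * real n - 1 \<le> real (nat \<lfloor>\<delta> * real n\<rfloor>)" using that by linarith
      then have "(\<delta> * real n - 1) / real n \<le> real (nat \<lfloor>\<delta> * real n\<rfloor>) / real n"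
        using elim by (intro divide_right_mono) auto
      then show ?case using elim by (simp add: diff_divide_distrib)
    qed
    show "\<forall>\<^sub>F n in sequentially. real (nat \<lfloor>\<delta> * real n\<rfloor>) / real n \<le> \<delta>"
      using eventually_gt_at_top[of 0]
    proof eventually_elim
      case (elim n)
      have "real (nat \<lfloor>\<delta> * real n\<rfloor>) \<le> \<delta> * real n" using that by simp
      then show ?case using elim by (simp add: pos_divide_le_eq)
    qed
    show "(\<lambda>n. \<delta> - 1 / real n) \<longlonglongrightarrow> \<delta>"
      by (rule tendsto_eq_intros lim_1_over_n | simp)+
  qed simp
  have ratio: "(\<lambda>n. (s (k n) - s (l n)) / (real (nat \<lfloor>\<delta> * real n\<rfloor>) * real n ^ e))
      \<longlonglongrightarrow> C * (c ^ Suc e - b ^ Suc e) / \<delta>"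
    if "\<delta> > 0" "(\<lambda>n. real (k n) / real n) \<longlonglongrightarrow> c" "c > 0"
      "(\<lambda>n. real (l n) / real n) \<longlonglongrightarrow> b" "b > 0" for k l \<delta> c b
  proof -
    have "(\<lambda>n. (s (k n) / real n ^ Suc e - s (l n) / real n ^ Suc e) / (real (nat \<lfloor>\<delta> * real n\<rfloor>) / real n))
        \<longlonglongrightarrow> (C * c ^ Suc e - C * b ^ Suc e) / \<delta>"
      by (intro tendsto_divide tendsto_diff scaled fl that) (use that in auto)
    moreover have "\<forall>\<^sub>F n in sequentially. (s (k n) / real n ^ Suc e - s (l n) / real n ^ Suc e)
         / (real (nat \<lfloor>\<delta> * real n\<rfloor>) / real n) = (s (k n) - s (l n)) / (real (nat \<lfloor>\<delta> * real n\<rfloor>) * real n ^ e)"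
      using eventually_gt_at_top[of 0]
      by eventually_elim (simp add: diff_divide_distrib[symmetric] del: of_nat_Suc)
    ultimately have "(\<lambda>n. (s (k n) - s (l n)) / (real (nat \<lfloor>\<delta> * real n\<rfloor>) * real n ^ e))
        \<longlonglongrightarrow> (C * c ^ Suc e - C * b ^ Suc e) / \<delta>"
      by (rule Lim_transform_eventually)
    then show ?thesis by (simp only: right_diff_distrib)
  qed
  have one: "(\<lambda>n. real n / real n) \<longlonglongrightarrow> 1"
    by (rule tendsto_eventually) (use eventually_gt_at_top[of 0] in eventually_elim, simp)
  have hpos: "\<forall>\<^sub>F n in sequentially. nat \<lfloor>\<delta> * real n\<rfloor> > 0" if "\<delta> > 0" for \<delta> :: real
  proof -
    have "\<forall>\<^sub>F n in sequentially. real n > 1 / \<delta>"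
      using filterlim_real_sequentially by (simp add: filterlim_at_top_dense)
    then show ?thesis
    proof eventually_elim
      case (elim n)
      then have "\<delta> * real n \<ge> 1" using that by (simp add: field_simps)
      then show ?case by linarith
    qed
  qed
  show ?thesis
  proof (rule order_tendstoI)
    fix y assume y: "real (Suc e) * C < y"
    have "((\<lambda>h. C * (((1 + h) ^ Suc e - 1) / h)) \<longlongrightarrow> C * real (Suc e)) (at 0)"
      by (intro tendsto_mult tendsto_const diff_quot_power_tendsto)
    then have "\<forall>\<^sub>F h in at 0. C * (((1 + h) ^ Suc e - 1) / h) < y"
      using y by (intro order_tendstoD(2)) (auto simp: mult.commute)
    then obtain r where r: "r > 0"
      "\<And>h. h \<noteq> 0 \<Longrightarrow> dist h 0 < r \<Longrightarrow> C * (((1 + h) ^ Suc e - 1) / h) < y"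
      unfolding eventually_at by blast
    \<comment> \<open>At this relative window width the difference quotient, whose limit at
      \<open>0\<close> is \<open>(e + 1) * C\<close>, is still below \<open>y\<close>.\<close>
    define \<delta> where "\<delta> = r / 2"
    have d: "\<delta> > 0" "C * (((1 + \<delta>) ^ Suc e - 1) / \<delta>) < y"
      using r(1) r(2)[of \<delta>] by (simp_all add: \<delta>_def dist_real_def)
    let ?h = "\<lambda>n. nat \<lfloor>\<delta> * real n\<rfloor>"
    have "(\<lambda>n. real n / real n + real (?h n) / real n) \<longlonglongrightarrow> 1 + \<delta>"
      by (intro tendsto_add one fl d)
    then have k: "(\<lambda>n. real (n + ?h n) / real n) \<longlonglongrightarrow> 1 + \<delta>"
      by (simp add: add_divide_distrib)
    have "(\<lambda>n. (s (n + ?h n) - s n) / (real (?h n) * real n ^ e))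
      \<longlonglongrightarrow> C * ((1 + \<delta>) ^ Suc e - 1 ^ Suc e) / \<delta>"
      by (rule ratio[OF d(1) k _ one]) (use d in auto)
    then have "\<forall>\<^sub>F n in sequentially. (s (n + ?h n) - s n) / (real (?h n) * real n ^ e) < y"
      using d by (intro order_tendstoD(2)) auto
    then show "\<forall>\<^sub>F n in sequentially. real (a n) / real n ^ e < y"
      using eventually_ge_at_top[of N] eventually_gt_at_top[of 0] hpos[OF d(1)]
    proof eventually_elim
      case (elim n)
      have "s (n + ?h n) - s n = real (\<Sum>m\<in>{n..<n + ?h n}. a m)"
        by (rule sdiff) simp
      moreover have "(\<Sum>m\<in>{n..<n + ?h n}. a m) \<ge> (\<Sum>m\<in>{n..<n + ?h n}. a n)"
        by (intro sum_mono mon) (use elim in auto)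
      ultimately have "real (?h n) * real (a n) \<le> s (n + ?h n) - s n"
        by (simp del: of_nat_sum flip: of_nat_mult)
      then have "real (?h n) * real (a n) / (real (?h n) * real n ^ e)
          \<le> (s (n + ?h n) - s n) / (real (?h n) * real n ^ e)"
        by (intro divide_right_mono) auto
      then show ?case using elim by simp
    qed
  next
    fix y assume y: "y < real (Suc e) * C"
    have "((\<lambda>h. C * (((1 + h) ^ Suc e - 1) / h)) \<longlongrightarrow> C * real (Suc e)) (at 0)"
      by (intro tendsto_mult tendsto_const diff_quot_power_tendsto)
    then have "\<forall>\<^sub>F h in at 0. y < C * (((1 + h) ^ Suc e - 1) / h)"
      using y by (intro order_tendstoD(1)) (auto simp: mult.commute)
    then obtain r where r: "r > 0"
      "\<And>h. h \<noteq> 0 \<Longrightarrow> dist h 0 < r \<Longrightarrow> y < C * (((1 + h) ^ Suc e - 1) / h)"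
      unfolding eventually_at by blast
    \<comment> \<open>The cap \<open>1 / 2\<close> keeps the window to the left of \<open>n\<close>
      above \<open>N\<close> as soon as \<open>n\<close> is at least \<open>2 * N\<close>.\<close>
    define \<delta> where "\<delta> = min (r / 2) (1 / 2)"
    have d: "\<delta> > 0" "\<delta> \<le> 1/2" "y < C * (((1 + - \<delta>) ^ Suc e - 1) / - \<delta>)"
      using r(1) r(2)[of "- \<delta>"] by (simp_all add: \<delta>_def dist_real_def)
    let ?h = "\<lambda>n. nat \<lfloor>\<delta> * real n\<rfloor>"
    have hle: "real (?h n) \<le> real n / 2" for n
    proof -
      have "real (?h n) \<le> \<delta> * real n" using d by simp
      also have "\<dots> \<le> 1 / 2 * real n" using d by (intro mult_right_mono) auto
      finally show ?thesis by simp
    qed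
    have hle': "?h n \<le> n" for n using hle[of n] by linarith
    have "(\<lambda>n. real n / real n - real (?h n) / real n) \<longlonglongrightarrow> 1 - \<delta>"
      by (intro tendsto_diff one fl d)
    then have k: "(\<lambda>n. real (n - ?h n) / real n) \<longlonglongrightarrow> 1 - \<delta>"
      using hle' by (simp add: diff_divide_distrib of_nat_diff)
    have "(\<lambda>n. (s n - s (n - ?h n)) / (real (?h n) * real n ^ e))
      \<longlonglongrightarrow> C * (1 ^ Suc e - (1 - \<delta>) ^ Suc e) / \<delta>"
      by (rule ratio[OF d(1) one _ k]) (use d in auto)
    moreover have "C * (((1 + - \<delta>) ^ Suc e - 1) / - \<delta>) = C * (1 ^ Suc e - (1 - \<delta>) ^ Suc e) / \<delta>"
      using d(1) by (simp add: field_simps)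
    ultimately have "\<forall>\<^sub>F n in sequentially. y < (s n - s (n - ?h n)) / (real (?h n) * real n ^ e)"
      using d by (intro order_tendstoD(1)) auto
    then show "\<forall>\<^sub>F n in sequentially. y < real (a n) / real n ^ e"
      using eventually_ge_at_top[of "2 * N"] eventually_gt_at_top[of 0] hpos[OF d(1)]
    proof eventually_elim
      case (elim n)
      have "s n - s (n - ?h n) = real (\<Sum>m\<in>{n - ?h n..<n}. a m)"
        by (rule sdiff) simp
      moreover have "(\<Sum>m\<in>{n - ?h n..<n}. a m) \<le> (\<Sum>m\<in>{n - ?h n..<n}. a n)"
        by (intro sum_mono mon) (use elim hle[of n] in auto)
      ultimately have "s n - s (n - ?h n) \<le> real (?h n) * real (a n)"
        using hle'[of n] by (simp del: of_nat_sum flip: of_nat_mult)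
      then have "(s n - s (n - ?h n)) / (real (?h n) * real n ^ e)
          \<le> real (?h n) * real (a n) / (real (?h n) * real n ^ e)"
        by (intro divide_right_mono) auto
      then show ?case using elim by simp
    qed
  qed
qed

section \<open>Rational cones and their lattice points\<close>

lemma card_integral_points_le:
  "card {x :: real ^ 'n. \<forall>i. x $ i \<in> \<int> \<and> \<bar>x $ i\<bar> \<le> real M} \<le> (2 * M + 1) ^ CARD('n)"
  and finite_integral_points: "finite {x :: real ^ 'n. \<forall>i. x $ i \<in> \<int> \<and> \<bar>x $ i\<bar> \<le> real M}"
proof -
  let ?J = "{- int M..int M}"
  let ?X = "{x :: real ^ 'n. \<forall>i. x $ i \<in> \<int> \<and> \<bar>x $ i\<bar> \<le> real M}"
  let ?h = "\<lambda>f :: 'n \<Rightarrow> int. (\<chi> i. real_of_int (f i)) :: real ^ 'n"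
  have fin: "finite (UNIV \<rightarrow>\<^sub>E ?J :: ('n \<Rightarrow> int) set)" by (intro finite_PiE) auto
  have sub: "?X \<subseteq> ?h ` (UNIV \<rightarrow>\<^sub>E ?J)"
  proof
    fix x :: "real ^ 'n" assume x: "x \<in> ?X"
    then have "\<exists>k. x $ i = real_of_int k" for i by (auto elim: Ints_cases)
    then obtain f where f: "\<And>i. x $ i = real_of_int (f i)" by metis
    have "f i \<in> ?J" for i
    proof -
      have "\<bar>x $ i\<bar> \<le> real M" using x by auto
      then have "\<bar>f i\<bar> \<le> int M" using f[of i] by linarith
      then show ?thesis by auto
    qed
    then have "f \<in> UNIV \<rightarrow>\<^sub>E ?J" by auto
    moreover have "x = ?h f" by (simp add: vec_eq_iff f)
    ultimately show "x \<in> ?h ` (UNIV \<rightarrow>\<^sub>E ?J)" by blast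
  qed
  show "finite ?X" using finite_subset[OF sub] fin by blast
  have "card ?X \<le> card (?h ` (UNIV \<rightarrow>\<^sub>E ?J))" using sub fin by (intro card_mono) auto
  also have "\<dots> \<le> card (UNIV \<rightarrow>\<^sub>E ?J :: ('n \<Rightarrow> int) set)" by (rule card_image_le[OF fin])
  also have "\<dots> = (2 * M + 1) ^ CARD('n)"
  proof -
    have "card ?J = 2 * M + 1" by simp
    then show ?thesis by (simp add: card_PiE)
  qed
  finally show "card ?X \<le> (2 * M + 1) ^ CARD('n)" .
qed

lemma finite_integral_points_bounded:
  "finite {x :: real ^ 'n. (\<forall>i. x $ i \<in> \<int>) \<and> norm x \<le> B}"
proof (rule finite_subset[OF _ finite_integral_points[of "nat \<lceil>\<bar>B\<bar>\<rceil>"]])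
  have "\<bar>x $ i\<bar> \<le> real (nat \<lceil>\<bar>B\<bar>\<rceil>)" if "norm x \<le> B" for x :: "real ^ 'n" and i
    using component_le_norm_cart[of x i] that by linarith
  then show "{x :: real ^ 'n. (\<forall>i. x $ i \<in> \<int>) \<and> norm x \<le> B}
      \<subseteq> {x. \<forall>i. x $ i \<in> \<int> \<and> \<bar>x $ i\<bar> \<le> real (nat \<lceil>\<bar>B\<bar>\<rceil>)}" by blast
qed

lemma convex_cone_hull_finite:
  assumes "finite W"
  shows "convex_cone hull W = {\<Sum>w\<in>W. c w *\<^sub>R w | c. \<forall>w\<in>W. 0 \<le> (c w :: real)}" (is "_ = ?R")
proof
  show "convex_cone hull W \<subseteq> ?R"
  proof (rule hull_minimal)
    show "W \<subseteq> ?R"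
    proof
      fix v assume "v \<in> W"
      then have "v = (\<Sum>w\<in>W. (if w = v then 1 else 0) *\<^sub>R w)"
        using assms by (simp add: if_distrib[of "\<lambda>c. c *\<^sub>R _"] sum.delta cong: if_cong)
      then show "v \<in> ?R" by (intro CollectI exI[of _ "\<lambda>w. if w = v then 1 else 0"]) auto
    qed
    show "convex_cone ?R"
      unfolding convex_cone_iff
    proof (intro conjI ballI allI impI)
      show "0 \<in> ?R" by (intro CollectI exI[of _ "\<lambda>w. 0"]) auto
      fix x assume "x \<in> ?R"
      then obtain c where c: "x = (\<Sum>w\<in>W. c w *\<^sub>R w)" "\<forall>w\<in>W. 0 \<le> c w" by blast
      show "t *\<^sub>R x \<in> ?R" if "t \<ge> 0" for t
        using c that by (intro CollectI exI[of _ "\<lambda>w. t * c w"]) (auto simp: scaleR_sum_right)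
      fix y assume "y \<in> ?R"
      then obtain c' where c': "y = (\<Sum>w\<in>W. c' w *\<^sub>R w)" "\<forall>w\<in>W. 0 \<le> c' w" by blast
      show "x + y \<in> ?R"
        using c c' by (intro CollectI exI[of _ "\<lambda>w. c w + c' w"])
          (auto simp: scaleR_left_distrib sum.distrib)
    qed
  qed
  show "?R \<subseteq> convex_cone hull W"
  proof clarify
    fix c assume c: "\<forall>w\<in>W. 0 \<le> (c w :: real)"
    have "(\<Sum>w\<in>V. c w *\<^sub>R w) \<in> convex_cone hull W" if "V \<subseteq> W" for V
      using finite_subset[OF that assms] that
    proof (induction V rule: finite_induct)
      case empty
      then show ?case by (simp add: convex_cone_hull_contains_0)
    next
      case (insert v V)
      then show ?case using c
        by (simp add: convex_cone_hull_add convex_cone_hull_mul hull_inc)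
    qed
    then show "(\<Sum>w\<in>W. c w *\<^sub>R w) \<in> convex_cone hull W" by blast
  qed
qed

definition comb :: "nat list \<Rightarrow> 'a::real_vector list \<Rightarrow> 'a" where
  "comb a gs = (\<Sum>i<length gs. real (a ! i) *\<^sub>R gs ! i)"

lemma comb_add:
  "length a = length gs \<Longrightarrow> length b = length gs \<Longrightarrow> comb (map2 (+) a b) gs = comb a gs + comb b gs"
  unfolding comb_def by (simp add: scaleR_left_distrib flip: sum.distrib)

lemma list_le_add_diff:
  assumes "list_all2 (\<le>) a (b :: nat list)"
  shows "b = map2 (+) a (map2 (-) b a)"
  using assms by (induction rule: list_all2_induct) auto

locale pointed_cone =
  fixes \<sigma> :: "(real ^ 'd) set"
  assumes rat: "rational_cone \<sigma>" and pnt: "pointed \<sigma>" and full: "aff_dim \<sigma> = int CARD('d)"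
begin

abbreviation S where "S \<equiv> lattice_points \<sigma>"

lemma convex_cone_sigma: "convex_cone \<sigma>" and polyhedron_sigma: "polyhedron \<sigma>"
  using rat unfolding rational_cone_def by auto

lemma sigma_closed: "closed \<sigma>" and sigma_convex: "convex \<sigma>"
  using polyhedron_sigma by (auto simp: polyhedron_imp_closed polyhedron_imp_convex)

lemma sigma_zero [simp]: "0 \<in> \<sigma>"
  and sigma_add: "x \<in> \<sigma> \<Longrightarrow> y \<in> \<sigma> \<Longrightarrow> x + y \<in> \<sigma>"
  and sigma_scale: "x \<in> \<sigma> \<Longrightarrow> 0 \<le> c \<Longrightarrow> c *\<^sub>R x \<in> \<sigma>"
  using convex_cone_sigma unfolding convex_cone_iff by auto

lemma S_zero [simp]: "0 \<in> S"
  and S_add: "x \<in> S \<Longrightarrow> y \<in> S \<Longrightarrow> x + y \<in> S"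
  and S_sigma: "x \<in> S \<Longrightarrow> x \<in> \<sigma>"
  unfolding lattice_points_def by (auto intro: sigma_add)

lemma S_scale: "x \<in> S \<Longrightarrow> real n *\<^sub>R x \<in> S"
  unfolding lattice_points_def by (auto intro: sigma_scale)

lemma S_sum: "(\<And>i. i \<in> A \<Longrightarrow> f i \<in> S) \<Longrightarrow> sum f A \<in> S"
  by (induction A rule: infinite_finite_induct) (auto intro: S_add)

lemma sigma_no_line:
  assumes "x \<in> \<sigma>" "- x \<in> \<sigma>"
  shows "x = 0"
proof -
  have "c *\<^sub>R x \<in> \<sigma>" for c
    using sigma_scale[OF assms(1), of c] sigma_scale[OF assms(2), of "- c"] by (cases "c \<ge> 0") auto
  then have "span {x} \<subseteq> \<sigma>" by (auto simp: span_singleton)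
  then have "span {x} = {0}" using pnt unfolding pointed_def by auto
  then show ?thesis using span_base[of x "{x}"] by auto
qed

text \<open>The unit vectors of the closed cone form a compact set, on which a positive functional
  has a positive minimum; scaling does the rest.\<close>

lemma sigma_coercive:
  assumes "\<And>x. x \<in> \<sigma> \<Longrightarrow> x \<noteq> 0 \<Longrightarrow> a \<bullet> x > 0"
  shows "\<exists>c>0. \<forall>x\<in>\<sigma>. c * norm x \<le> a \<bullet> x"
proof -
  let ?B = "\<sigma> \<inter> sphere 0 1"
  have comp: "compact ?B" using sigma_closed by (simp add: closed_Int_compact)
  show ?thesis
  proof (cases "?B = {}")
    case True
    have z: "x = 0" if "x \<in> \<sigma>" for x
    proof (rule ccontr)
      assume "x \<noteq> 0"
      then have "(1 / norm x) *\<^sub>R x \<in> ?B" using that by (auto intro: sigma_scale)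
      then show False using True by blast
    qed
    show ?thesis by (intro exI[of _ 1]) (auto dest: z)
  next
    case False
    obtain z where z: "z \<in> ?B" "\<And>x. x \<in> ?B \<Longrightarrow> a \<bullet> z \<le> a \<bullet> x"
      using continuous_attains_inf[OF comp False, of "\<lambda>x. a \<bullet> x"]
      by (force intro: continuous_intros)
    have "(a \<bullet> z) * norm x \<le> a \<bullet> x" if "x \<in> \<sigma>" for x
    proof (cases "x = 0")
      case False
      then have "(1 / norm x) *\<^sub>R x \<in> ?B" using that by (auto intro: sigma_scale)
      then have "a \<bullet> z \<le> a \<bullet> ((1 / norm x) *\<^sub>R x)" using z by blast
      then show ?thesis using False by (simp add: field_simps)
    qed simp
    moreover have "a \<bullet> z > 0" using z assms by force
    ultimately show ?thesis by blast
  qed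
qed

text \<open>Pointedness makes the cone without its apex convex, so the compact hull of the unit
  vectors misses \<open>0\<close> and can be separated from it.\<close>

lemma weight_exists: "\<exists>w. \<forall>x\<in>\<sigma>. x \<noteq> 0 \<longrightarrow> w \<bullet> x > 0"
proof -
  let ?B = "\<sigma> \<inter> sphere 0 1"
  let ?C = "convex hull ?B"
  have comp: "compact ?C" using sigma_closed by (simp add: closed_Int_compact compact_convex_hull)
  have "convex (\<sigma> - {0})"
    unfolding convex_alt
  proof (intro ballI allI impI)
    fix x y and u :: real
    assume x: "x \<in> \<sigma> - {0}" and y: "y \<in> \<sigma> - {0}" and u: "0 \<le> u \<and> u \<le> 1"
    have "(1 - u) *\<^sub>R x + u *\<^sub>R y \<noteq> 0"
    proof
      assume 0: "(1 - u) *\<^sub>R x + u *\<^sub>R y = 0"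
      then have "u *\<^sub>R y = - ((1 - u) *\<^sub>R x)" by (metis eq_neg_iff_add_eq_0 add.commute)
      moreover have "u *\<^sub>R y \<in> \<sigma>" "(1 - u) *\<^sub>R x \<in> \<sigma>" using x y u by (auto intro: sigma_scale)
      ultimately have "(1 - u) *\<^sub>R x = 0" using sigma_no_line by metis
      then show False using 0 x y by (cases "u = 1") auto
    qed
    moreover have "(1 - u) *\<^sub>R x + u *\<^sub>R y \<in> \<sigma>"
      using x y u by (intro sigma_add sigma_scale) auto
    ultimately show "(1 - u) *\<^sub>R x + u *\<^sub>R y \<in> \<sigma> - {0}" by blast
  qed
  then have "?C \<subseteq> \<sigma> - {0}" by (intro hull_minimal) auto
  then have "0 \<notin> ?C" by blast
  then obtain w b where wb: "0 < b" "\<And>x. x \<in> ?C \<Longrightarrow> inner w x > b"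
    using separating_hyperplane_closed_0[of ?C] comp by (auto simp: compact_imp_closed)
  have "w \<bullet> x > 0" if "x \<in> \<sigma>" "x \<noteq> 0" for x
  proof -
    have "(1 / norm x) *\<^sub>R x \<in> ?B" using that by (auto intro: sigma_scale)
    then have "w \<bullet> ((1 / norm x) *\<^sub>R x) > b" using wb hull_inc[of _ ?B convex] by blast
    then have "w \<bullet> ((1 / norm x) *\<^sub>R x) > 0" using wb(1) by linarith
    then show ?thesis using that by (simp add: zero_less_divide_iff)
  qed
  then show ?thesis by blast
qed

text \<open>Plays the part of a degree: its sublevel sets in \<open>S\<close> are finite, so
  nonempty sets of exponents have lightest elements.\<close>

definition weight :: "real ^ 'd" where
  "weight = (SOME w. \<forall>x\<in>\<sigma>. x \<noteq> 0 \<longrightarrow> w \<bullet> x > 0)"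

lemma weight_pos: "x \<in> \<sigma> \<Longrightarrow> x \<noteq> 0 \<Longrightarrow> weight \<bullet> x > 0"
  using someI_ex[OF weight_exists] unfolding weight_def by blast

lemma finite_S_bounded:
  assumes "\<And>x. x \<in> \<sigma> \<Longrightarrow> x \<noteq> 0 \<Longrightarrow> a \<bullet> x > 0"
  shows "finite {q \<in> S. a \<bullet> q \<le> c}"
proof -
  obtain b where b: "b > 0" "\<And>x. x \<in> \<sigma> \<Longrightarrow> b * norm x \<le> a \<bullet> x" using sigma_coercive[OF assms] by blast
  have "norm q \<le> c / b" if "q \<in> S" "a \<bullet> q \<le> c" for q
  proof -
    have "b * norm q \<le> c" using b(2)[OF S_sigma[OF that(1)]] that(2) by linarith
    then show ?thesis using b(1) by (simp add: field_simps)
  qed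
  then show ?thesis
    by (intro finite_subset[OF _ finite_integral_points_bounded[of "c / b"]])
      (auto simp: lattice_points_def)
qed

lemma weight_min:
  assumes "E \<subseteq> S" "E \<noteq> {}"
  obtains e where "e \<in> E" "\<And>e'. e' \<in> E \<Longrightarrow> weight \<bullet> e \<le> weight \<bullet> e'"
proof -
  obtain e0 where e0: "e0 \<in> E" using assms by blast
  let ?F = "{e \<in> E. weight \<bullet> e \<le> weight \<bullet> e0}"
  have "?F \<subseteq> {q \<in> S. weight \<bullet> q \<le> weight \<bullet> e0}" using assms by auto
  then have "finite ?F" using finite_S_bounded[OF weight_pos] finite_subset by blast
  then obtain e where e: "e \<in> ?F" "\<And>e'. e' \<in> ?F \<Longrightarrow> weight \<bullet> e \<le> weight \<bullet> e'"
    using e0 ex_min_if_finite[of "(\<lambda>e. weight \<bullet> e) ` ?F"] by (force simp: not_less)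
  have "weight \<bullet> e \<le> weight \<bullet> e'" if "e' \<in> E" for e'
  proof (cases "weight \<bullet> e' \<le> weight \<bullet> e0")
    case True
    then show ?thesis using e(2) that by blast
  next
    case False
    then show ?thesis using e(1) by auto
  qed
  then show ?thesis using that e by blast
qed

text \<open>The slice \<open>K\<close> at weight one is compact and convex, hence the hull of its
  extreme points. An extreme point of the slice spans an extremal ray of the cone, and rationality
  puts a nonzero lattice point on that ray.\<close>

lemma cone_generators: "\<exists>W. finite W \<and> W \<subseteq> S \<and> \<sigma> = convex_cone hull W"
proof -
  define K where "K = \<sigma> \<inter> {x. weight \<bullet> x = 1}"
  obtain c where c: "c > 0" "\<And>x. x \<in> \<sigma> \<Longrightarrow> c * norm x \<le> weight \<bullet> x"
    using sigma_coercive[OF weight_pos] by blast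
  have "bounded K"
    unfolding bounded_iff
  proof (intro exI ballI)
    fix x assume "x \<in> K"
    then have "c * norm x \<le> 1" using c(2)[of x] by (auto simp: K_def)
    then show "norm x \<le> 1 / c" using c(1) by (simp add: field_simps)
  qed
  moreover have "closed K" unfolding K_def using sigma_closed closed_hyperplane by blast
  ultimately have "compact K" by (simp add: compact_eq_bounded_closed)
  moreover have "convex K" unfolding K_def using sigma_convex convex_hyperplane by (intro convex_Int) auto
  ultimately have KM: "K = convex hull {x. x extreme_point_of K}" by (rule Krein_Milman_Minkowski)
  define f where "f r = (SOME q. q \<in> lattice_points r \<and> q \<noteq> 0)" for r :: "(real ^ 'd) set"
  define W where "W = f ` {r. extremal_ray \<sigma> r}"
  have fr: "f r \<in> lattice_points r \<and> f r \<noteq> 0" if "extremal_ray \<sigma> r" for r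
    unfolding f_def by (rule someI_ex) (use rat that in \<open>auto simp: rational_cone_def\<close>)
  have finW: "finite W" using rat by (simp add: W_def rational_cone_def)
  have WS: "W \<subseteq> S"
  proof
    fix q assume "q \<in> W"
    then obtain r where r: "extremal_ray \<sigma> r" "q = f r" unfolding W_def by blast
    moreover have "r \<subseteq> \<sigma>" using r by (auto simp: extremal_ray_def face_of_def)
    ultimately show "q \<in> S" using fr unfolding lattice_points_def by blast
  qed
  have ext: "v \<in> convex_cone hull W" if v: "v extreme_point_of K" for v
  proof -
    have vK: "v \<in> \<sigma>" "weight \<bullet> v = 1" using v by (auto simp: extreme_point_of_def K_def)
    then have v0: "v \<noteq> 0" by auto
    define r where "r = {t *\<^sub>R v | t. 0 \<le> t}"
    have "r face_of \<sigma>"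
      unfolding face_of_def
    proof (intro conjI ballI impI)
      show "r \<subseteq> \<sigma>" using vK by (auto simp: r_def intro: sigma_scale)
      have "r = (\<lambda>t. t *\<^sub>R v) ` {0..}" by (auto simp: r_def)
      then show "convex r" by (simp add: convex_linear_image bounded_linear.linear[OF bounded_linear_scaleR_left])
      \<comment> \<open>The face condition for arbitrary positive coefficients, which treats both
        endpoints of a segment alike.\<close>
      have key: "x \<in> r" if xy: "x \<in> \<sigma>" "y \<in> \<sigma>" and ab: "a > 0" "b > 0" "a *\<^sub>R x + b *\<^sub>R y \<in> r" for x y a b
      proof -
        obtain t where t: "t \<ge> 0" "a *\<^sub>R x + b *\<^sub>R y = t *\<^sub>R v" using ab(3) by (auto simp: r_def)
        show ?thesis
        proof (cases "x = 0")
          case True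
          then show ?thesis by (auto simp: r_def intro!: exI[of _ 0])
        next
          case False
          have wx: "weight \<bullet> x > 0" using weight_pos xy False by blast
          have wy: "weight \<bullet> y \<ge> 0" using weight_pos[of y] xy by (cases "y = 0") auto
          have wt: "a * (weight \<bullet> x) + b * (weight \<bullet> y) = t"
            using arg_cong[OF t(2), of "inner weight"] vK by (simp add: inner_add_right)
          have tpos: "t > 0" using wt wx wy ab by (smt (verit) mult_pos_pos mult_nonneg_nonneg)
          have xK: "(1 / (weight \<bullet> x)) *\<^sub>R x \<in> K" using wx xy by (auto simp: K_def intro: sigma_scale)
          have veq: "v = (a / t) *\<^sub>R x + (b / t) *\<^sub>R y"
            using arg_cong[OF t(2), of "\<lambda>z. (1 / t) *\<^sub>R z"] tpos by (simp add: scaleR_add_right)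
          have "(1 / (weight \<bullet> x)) *\<^sub>R x = v"
          proof (cases "y = 0")
            case True
            then show ?thesis using veq wt wx ab by (auto simp: field_simps)
          next
            case y0: False
            then have wy: "weight \<bullet> y > 0" using weight_pos xy by blast
            have yK: "(1 / (weight \<bullet> y)) *\<^sub>R y \<in> K" using wy xy by (auto simp: K_def intro: sigma_scale)
            \<comment> \<open>With both points scaled into \<open>K\<close>, \<open>v\<close> is
              their convex combination with weights \<open>1 - u\<close> and \<open>u\<close>;
              extremality makes the two points coincide.\<close>
            define u where "u = b * (weight \<bullet> y) / t"
            have u: "0 < u" "u < 1" "1 - u = a * (weight \<bullet> x) / t"
              using wt ab wx wy tpos by (auto simp: u_def field_simps)
            have v2: "v = (1 - u) *\<^sub>R ((1 / (weight \<bullet> x)) *\<^sub>R x) + u *\<^sub>R ((1 / (weight \<bullet> y)) *\<^sub>R y)"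
              using veq wx wy tpos u(3) by (simp add: u_def)
            then have "v \<in> open_segment ((1 / (weight \<bullet> x)) *\<^sub>R x) ((1 / (weight \<bullet> y)) *\<^sub>R y)
              \<or> (1 / (weight \<bullet> x)) *\<^sub>R x = (1 / (weight \<bullet> y)) *\<^sub>R y"
              using u unfolding in_segment by blast
            then have "(1 / (weight \<bullet> x)) *\<^sub>R x = (1 / (weight \<bullet> y)) *\<^sub>R y"
              using v xK yK unfolding extreme_point_of_def by blast
            moreover have "(1 - u) *\<^sub>R z + u *\<^sub>R z = z" for z :: "real ^ 'd"
              by (simp flip: scaleR_left_distrib)
            ultimately show ?thesis using v2 by metis
          qed
          then have "x = (weight \<bullet> x) *\<^sub>R v" using wx by auto
          then show ?thesis using wx by (auto simp: r_def intro!: exI[of _ "weight \<bullet> x"])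
        qed
      qed
      fix x y z
      assume xy: "x \<in> \<sigma>" "y \<in> \<sigma>" and z: "z \<in> r" "z \<in> open_segment x y"
      then obtain u where u: "0 < u" "u < 1" "z = (1 - u) *\<^sub>R x + u *\<^sub>R y" by (auto simp: in_segment)
      show "x \<in> r" using key[OF xy, of "1 - u" u] u z by auto
      show "y \<in> r" using key[OF xy(2,1), of u "1 - u"] u z by (auto simp: add.commute)
    qed
    then have er: "extremal_ray \<sigma> r" using v0 unfolding extremal_ray_def r_def by blast
    then have f: "f r \<in> r" "f r \<noteq> 0" using fr by (auto simp: lattice_points_def)
    then obtain t where t: "t \<ge> 0" "f r = t *\<^sub>R v" by (auto simp: r_def)
    then have "v = (1 / t) *\<^sub>R f r" using f by auto
    moreover have "f r \<in> convex_cone hull W" using er by (auto simp: W_def intro: hull_inc)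
    ultimately show ?thesis using convex_cone_hull_mul t by (metis zero_le_divide_1_iff)
  qed
  have "K \<subseteq> convex_cone hull W"
    by (subst KM, rule hull_minimal) (use ext convex_convex_cone_hull in auto)
  have "\<sigma> \<subseteq> convex_cone hull W"
  proof
    fix x assume x: "x \<in> \<sigma>"
    show "x \<in> convex_cone hull W"
    proof (cases "x = 0")
      case True
      then show ?thesis by (simp add: convex_cone_hull_contains_0)
    next
      case False
      then have w: "weight \<bullet> x > 0" using weight_pos x by blast
      then have "(1 / (weight \<bullet> x)) *\<^sub>R x \<in> K" using x by (auto simp: K_def intro: sigma_scale)
      then have "(1 / (weight \<bullet> x)) *\<^sub>R x \<in> convex_cone hull W" using \<open>K \<subseteq> _\<close> by blast
      then have "(weight \<bullet> x) *\<^sub>R ((1 / (weight \<bullet> x)) *\<^sub>R x) \<in> convex_cone hull W"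
        using convex_cone_hull_mul w less_imp_le by metis
      then show ?thesis using w by simp
    qed
  qed
  moreover have "convex_cone hull W \<subseteq> \<sigma>"
    using WS by (intro hull_minimal convex_cone_sigma) (auto simp: lattice_points_def)
  ultimately show ?thesis using finW WS by blast
qed

definition W where "W = (SOME W. finite W \<and> W \<subseteq> S \<and> \<sigma> = convex_cone hull W)"

lemma finite_W: "finite W" and W_S: "W \<subseteq> S" and sigma_W: "\<sigma> = convex_cone hull W"
  using someI_ex[OF cone_generators] unfolding W_def by auto

text \<open>Gordan's lemma: subtracting the integral parts of the coefficients leaves a lattice point
  of a bounded region.\<close>

lemma S_generators: "\<exists>gs. set gs \<subseteq> S \<and> (\<forall>q\<in>S. \<exists>a. length a = length gs \<and> q = comb a gs)"
proof -
  define B where "B = (\<Sum>w\<in>W. norm w)"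
  \<comment> \<open>After removal of the integral parts the remainder has norm at most
    \<open>B\<close>, since fractional parts are below one.\<close>
  define G where "G = {x \<in> S. norm x \<le> B} \<union> W"
  have "finite {x \<in> S. norm x \<le> B}"
    by (rule finite_subset[OF _ finite_integral_points_bounded[of B]]) (auto simp: lattice_points_def)
  then have "finite G" using finite_W by (simp add: G_def)
  then obtain gs where gs: "set gs = G" "distinct gs" using finite_distinct_list by blast
  have comb_sum: "comb (map c gs) gs = (\<Sum>g\<in>G. real (c g) *\<^sub>R g)" for c
  proof -
    have "comb (map c gs) gs = (\<Sum>i<length gs. (\<lambda>g. real (c g) *\<^sub>R g) (gs ! i))"
      by (simp add: comb_def)
    also have "\<dots> = (\<Sum>g\<in>set gs. real (c g) *\<^sub>R g)"
      using bij_betw_nth[OF gs(2) refl refl] by (intro sum.reindex_bij_betw)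
    finally show ?thesis by (simp add: gs)
  qed
  have "\<exists>a. length a = length gs \<and> q = comb a gs" if q: "q \<in> S" for q
  proof -
    have "q \<in> convex_cone hull W" using q S_sigma sigma_W by blast
    then obtain c where c: "\<forall>w\<in>W. 0 \<le> c w" "q = (\<Sum>w\<in>W. c w *\<^sub>R w)"
      unfolding convex_cone_hull_finite[OF finite_W] by blast
    define r where "r = (\<Sum>w\<in>W. frac (c w) *\<^sub>R w)"
    have cw: "c w = real (nat \<lfloor>c w\<rfloor>) + frac (c w)" if "w \<in> W" for w
      using c(1) that by (simp add: frac_def)
    have qr: "q = (\<Sum>w\<in>W. real (nat \<lfloor>c w\<rfloor>) *\<^sub>R w) + r"
    proof -
      have "q = (\<Sum>w\<in>W. real (nat \<lfloor>c w\<rfloor>) *\<^sub>R w + frac (c w) *\<^sub>R w)"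
        unfolding c(2) by (rule sum.cong[OF refl]) (subst cw, auto simp: scaleR_left_distrib)
      then show ?thesis by (simp add: sum.distrib r_def)
    qed
    have "r \<in> convex_cone hull W"
      unfolding convex_cone_hull_finite[OF finite_W] r_def by force
    then have rs: "r \<in> \<sigma>" using sigma_W by simp
    have "(\<Sum>w\<in>W. real (nat \<lfloor>c w\<rfloor>) *\<^sub>R w) \<in> S" using W_S by (intro S_sum S_scale) auto
    moreover have "r = q - (\<Sum>w\<in>W. real (nat \<lfloor>c w\<rfloor>) *\<^sub>R w)" using qr by simp
    ultimately have "\<forall>i. r $ i \<in> \<int>" using q unfolding lattice_points_def by auto
    then have rS: "r \<in> S" using rs by (simp add: lattice_points_def)
    have "norm r \<le> (\<Sum>w\<in>W. norm (frac (c w) *\<^sub>R w))" unfolding r_def by (rule norm_sum)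
    also have "\<dots> \<le> B" unfolding B_def
      by (intro sum_mono) (auto simp: frac_lt_1 less_imp_le intro!: mult_left_le_one_le)
    finally have rG: "r \<in> G" using rS by (simp add: G_def)
    \<comment> \<open>The remainder \<open>r\<close> may itself belong to \<open>W\<close>; then its
      single occurrence is added to the integral part.\<close>
    define e where "e g = (if g \<in> W then nat \<lfloor>c g\<rfloor> else 0) + (if g = r then 1 else 0)" for g
    have "(\<Sum>g\<in>G. real (e g) *\<^sub>R g) = (\<Sum>g\<in>G. (if g \<in> W then real (nat \<lfloor>c g\<rfloor>) *\<^sub>R g else 0)) + (\<Sum>g\<in>G. if g = r then g else 0)"
      unfolding e_def sum.distrib[symmetric] by (intro sum.cong) (auto simp: scaleR_left_distrib)
    also have "(\<Sum>g\<in>G. if g = r then g else 0) = r" using rG \<open>finite G\<close> by (simp add: sum.delta)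
    also have "(\<Sum>g\<in>G. (if g \<in> W then real (nat \<lfloor>c g\<rfloor>) *\<^sub>R g else 0)) = (\<Sum>w\<in>W. real (nat \<lfloor>c w\<rfloor>) *\<^sub>R w)"
      using \<open>finite G\<close> by (intro sum.mono_neutral_cong_right) (auto simp: G_def)
    finally have "q = comb (map e gs) gs" using qr comb_sum by simp
    then show ?thesis by (metis length_map)
  qed
  moreover have "set gs \<subseteq> S" using gs W_S by (auto simp: G_def)
  ultimately show ?thesis by blast
qed

definition gens where
  "gens = (SOME gs. set gs \<subseteq> S \<and> (\<forall>q\<in>S. \<exists>a. length a = length gs \<and> q = comb a gs))"

lemma gens_S: "set gens \<subseteq> S"
  and gens_comb: "q \<in> S \<Longrightarrow> \<exists>a. length a = length gens \<and> q = comb a gens"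
  using someI_ex[OF S_generators] unfolding gens_def by auto

lemma comb_S: "set gs \<subseteq> S \<Longrightarrow> comb a gs \<in> S"
  unfolding comb_def by (intro S_sum S_scale) auto

text \<open>Exponent sets of monomial ideals, and of their powers; the \<open>0\<close>-th power is the unit ideal.\<close>

definition sideal where
  "sideal E \<longleftrightarrow> E \<subseteq> S \<and> (\<forall>e\<in>E. \<forall>s\<in>S. e + s \<in> E)"

lemma sidealD: "sideal E \<Longrightarrow> e \<in> E \<Longrightarrow> s \<in> S \<Longrightarrow> e + s \<in> E"
  and sideal_S: "sideal E \<Longrightarrow> e \<in> E \<Longrightarrow> e \<in> S"
  unfolding sideal_def by auto

primrec pw where
  "pw E 0 = S"
| "pw E (Suc n) = {a + b | a b. a \<in> pw E n \<and> b \<in> E}"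

lemma sideal_pw: "E \<subseteq> S \<Longrightarrow> sideal (pw E n)"
proof (induction n)
  case 0
  then show ?case by (auto simp: sideal_def intro: S_add)
next
  case (Suc n)
  then have IH: "sideal (pw E n)" by simp
  show ?case unfolding sideal_def
  proof (intro conjI subsetI ballI)
    fix x assume "x \<in> pw E (Suc n)"
    then obtain a b where ab: "x = a + b" "a \<in> pw E n" "b \<in> E" by auto
    then show "x \<in> S" using Suc.prems sideal_S[OF IH] by (auto intro: S_add)
    fix s assume "s \<in> S"
    then have "a + s \<in> pw E n" using sidealD[OF IH] ab by blast
    moreover have "x + s = (a + s) + b" using ab by simp
    ultimately show "x + s \<in> pw E (Suc n)" unfolding pw.simps using ab by blast
  qed
qed

section \<open>Minimal monomial generators\<close>

definition span_ideal where "span_ideal V = {v + s | v s. v \<in> V \<and> s \<in> S}"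

definition min_gens where
  "min_gens E = {e \<in> E. \<forall>e'\<in>E. \<forall>s\<in>S. e = e' + s \<longrightarrow> s = 0}"

lemma sideal_span_ideal:
  assumes "V \<subseteq> S"
  shows "sideal (span_ideal V)"
  unfolding sideal_def
proof (intro conjI subsetI ballI)
  fix x assume "x \<in> span_ideal V"
  then obtain v s where vs: "x = v + s" "v \<in> V" "s \<in> S" unfolding span_ideal_def by auto
  then show "x \<in> S" using assms by (auto intro: S_add)
  fix t assume "t \<in> S"
  then have "s + t \<in> S" using vs by (auto intro: S_add)
  moreover have "x + t = v + (s + t)" using vs by simp
  ultimately show "x + t \<in> span_ideal V" using vs unfolding span_ideal_def by blast
qed

lemma span_ideal_superset: "V \<subseteq> span_ideal V"
proof
  fix v assume "v \<in> V"
  moreover have "v = v + 0" by simp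
  ultimately show "v \<in> span_ideal V" unfolding span_ideal_def using S_zero by blast
qed

text \<open>A lightest divisor of \<open>e\<close> in \<open>E\<close> is minimal, because splitting
  off a nonzero element of the cone lowers the weight.\<close>

lemma span_min_gens:
  assumes "sideal E"
  shows "span_ideal (min_gens E) = E"
proof
  show "span_ideal (min_gens E) \<subseteq> E"
    using assms unfolding span_ideal_def min_gens_def sideal_def by auto
  show "E \<subseteq> span_ideal (min_gens E)"
  proof
    fix e assume e: "e \<in> E"
    let ?F = "{e' \<in> E. \<exists>s\<in>S. e = e' + s}"
    have "e \<in> ?F" using e by (auto intro!: bexI[of _ 0])
    moreover have "?F \<subseteq> S" using assms unfolding sideal_def by blast
    ultimately obtain m where m: "m \<in> ?F" "\<And>e'. e' \<in> ?F \<Longrightarrow> weight \<bullet> m \<le> weight \<bullet> e'"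
      using weight_min[of ?F] by blast
    obtain s where s: "s \<in> S" "e = m + s" using m by blast
    have "m \<in> min_gens E"
      unfolding min_gens_def
    proof (intro CollectI conjI ballI impI)
      show "m \<in> E" using m by blast
      fix e' t assume e': "e' \<in> E" and t: "t \<in> S" and eq: "m = e' + t"
      have "e = e' + (t + s)" using eq s by simp
      then have "e' \<in> ?F" using e' S_add[OF t s(1)] by blast
      then have "weight \<bullet> m \<le> weight \<bullet> e'" by (rule m(2))
      then have "weight \<bullet> t \<le> 0" using eq by (simp add: inner_add_right)
      then show "t = 0" using weight_pos[OF S_sigma[OF t]] by force
    qed
    then show "e \<in> span_ideal (min_gens E)" using s unfolding span_ideal_def by blast
  qed
qed

text \<open>A minimal generator has no nontrivial decomposition \<open>v + s\<close>, so it must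
  itself occur in every generating set.\<close>

lemma min_gens_least:
  assumes "V \<subseteq> S" "span_ideal V = E"
  shows "min_gens E \<subseteq> V"
proof
  fix m assume m: "m \<in> min_gens E"
  then obtain v s where vs: "m = v + s" "v \<in> V" "s \<in> S"
    using assms(2) unfolding min_gens_def span_ideal_def by blast
  then have "v \<in> E" using assms span_ideal_superset by blast
  then have "s = 0" using m vs unfolding min_gens_def by blast
  then show "m \<in> V" using vs by simp
qed

lemma upset_comb:
  assumes "sideal E" "set gs \<subseteq> S"
  shows "upset (length gs) {a. length a = length gs \<and> comb a gs \<in> E}"
  unfolding upset_def
proof (intro conjI ballI allI impI)
  fix u v assume u: "u \<in> {a. length a = length gs \<and> comb a gs \<in> E}" and uv: "list_all2 (\<le>) u v"
  have len: "length v = length gs" using u uv by (auto simp: list_all2_lengthD)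
  have "comb v gs = comb u gs + comb (map2 (-) v u) gs"
    using comb_add[of u gs "map2 (-) v u"] list_le_add_diff[OF uv] u len by simp
  then show "v \<in> {a. length a = length gs \<and> comb a gs \<in> E}"
    using len u sidealD[OF assms(1) _ comb_S[OF assms(2)]] by simp
qed auto

text \<open>A list representing a minimal generator lies above a list \<open>b\<close> of bounded
  degree that still represents an element of \<open>E\<close>. By minimality the difference
  represents \<open>0\<close>, so \<open>b\<close> already represents the generator.\<close>

lemma finite_min_gens:
  assumes "sideal E"
  shows "finite (min_gens E)"
proof -
  let ?Z = "{a. length a = length gens \<and> comb a gens \<in> E}"
  obtain M where M: "\<And>u. u \<in> ?Z \<Longrightarrow> \<exists>b\<in>?Z. list_all2 (\<le>) b u \<and> sum_list b \<le> M"
    using upset_bounded_basis[OF upset_comb[OF assms gens_S]] by blast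
  have "min_gens E \<subseteq> (\<lambda>a. comb a gens) ` (\<Union>n\<le>M. {a. length a = length gens \<and> sum_list a = n})"
  proof
    fix m assume m: "m \<in> min_gens E"
    then have mE: "m \<in> E" by (simp add: min_gens_def)
    then obtain a where a: "length a = length gens" "m = comb a gens"
      using gens_comb sideal_S[OF assms] by blast
    then obtain b where b: "b \<in> ?Z" "list_all2 (\<le>) b a" "sum_list b \<le> M" using M mE by blast
    have "m = comb b gens + comb (map2 (-) a b) gens"
      using comb_add[of b gens "map2 (-) a b"] list_le_add_diff[OF b(2)] a b(1) by simp
    then have "comb (map2 (-) a b) gens = 0"
      using m b(1) comb_S[OF gens_S] unfolding min_gens_def by blast
    then show "m \<in> (\<lambda>a. comb a gens) ` (\<Union>n\<le>M. {a. length a = length gens \<and> sum_list a = n})"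
      using \<open>m = _ + _\<close> b by auto
  qed
  then show ?thesis by (rule finite_subset) (intro finite_imageI finite_UN_I finite_lists_sum, simp)
qed

lemma S_add_eq_0: "a \<in> S \<Longrightarrow> b \<in> S \<Longrightarrow> a + b = 0 \<Longrightarrow> a = 0 \<and> b = 0"
proof -
  assume ab: "a \<in> S" "b \<in> S" "a + b = 0"
  then have "- a \<in> \<sigma>" "a \<in> \<sigma>" using S_sigma by (auto simp: add_eq_0_iff)
  then have "a = 0" using sigma_no_line by blast
  then show ?thesis using ab by simp
qed

lemma span_ideal_nonzero: "span_ideal (S - {0}) = S - {0}"
proof
  show "span_ideal (S - {0}) \<subseteq> S - {0}"
    unfolding span_ideal_def using S_add_eq_0 S_add by auto
qed (rule span_ideal_superset)

lemma sideal_nonzero: "sideal (S - {0})"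
  using sideal_span_ideal[of "S - {0}"] span_ideal_nonzero by auto

end

section \<open>The localized semigroup ring\<close>

abbreviation "keys \<equiv> Poly_Mapping.keys"
abbreviation "lookup \<equiv> Poly_Mapping.lookup"

text \<open>Functionals that identify two given points form a hyperplane, and finitely many null
  sets do not cover the space. The order that the functional induces on \<open>K\<close> respects
  addition.\<close>

lemma generic_functional:
  fixes K :: "(real ^ 'n) set"
  assumes "finite K"
  shows "\<exists>a. inj_on (\<lambda>x. a \<bullet> x) K"
proof -
  let ?D = "(\<lambda>(x, y). x - y) ` (K \<times> K) - {0}"
  have "negligible (\<Union>d\<in>?D. {a. d \<bullet> a = 0})"
    using assms by (intro negligible_Union) (auto intro!: negligible_hyperplane)
  then have "(\<Union>d\<in>?D. {a. d \<bullet> a = 0}) \<noteq> UNIV" using non_negligible_UNIV by metis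
  then obtain a where a: "\<And>d. d \<in> ?D \<Longrightarrow> d \<bullet> a \<noteq> 0" by blast
  have "inj_on (\<lambda>x. a \<bullet> x) K"
  proof (rule inj_onI, rule ccontr)
    fix x y assume xy: "x \<in> K" "y \<in> K" "a \<bullet> x = a \<bullet> y" "x \<noteq> y"
    then have d: "x - y \<in> ?D" by force
    have "(x - y) \<bullet> a = 0" using xy(3) by (subst inner_commute) (simp add: inner_diff_right)
    then show False using a[OF d] by contradiction
  qed
  then show ?thesis by blast
qed

lemma poly_mapping_expand:
  fixes f :: "'v \<Rightarrow>\<^sub>0 'k::comm_monoid_add"
  assumes "finite K" "keys f \<subseteq> K"
  shows "f = (\<Sum>l\<in>K. Poly_Mapping.single l (lookup f l))"
proof (rule poly_mapping_eqI)
  fix k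
  have "lookup (\<Sum>l\<in>K. Poly_Mapping.single l (lookup f l)) k = (\<Sum>l\<in>K. if l = k then lookup f l else 0)"
    by (simp add: lookup_sum lookup_single when_def)
  also have "\<dots> = lookup f k"
    using assms by (auto simp: sum.delta in_keys_iff)
  finally show "lookup f k = lookup (\<Sum>l\<in>K. Poly_Mapping.single l (lookup f l)) k" by simp
qed

lemma lookup_mult_sum:
  fixes f g :: "'v::comm_monoid_add \<Rightarrow>\<^sub>0 'k::comm_semiring_1"
  shows "lookup (f * g) k =
    (\<Sum>l\<in>keys f. \<Sum>q\<in>keys g. if l + q = k then lookup f l * lookup g q else 0)"
proof -
  have "f * g = (\<Sum>l\<in>keys f. Poly_Mapping.single l (lookup f l)) *
      (\<Sum>q\<in>keys g. Poly_Mapping.single q (lookup g q))"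
    using poly_mapping_expand[of "keys f" f] poly_mapping_expand[of "keys g" g] by simp
  also have "\<dots> = (\<Sum>l\<in>keys f. \<Sum>q\<in>keys g. Poly_Mapping.single (l + q) (lookup f l * lookup g q))"
    by (simp add: sum_product mult_single)
  finally show ?thesis by (simp add: lookup_sum lookup_single when_def)
qed

text \<open>At most one product of terms contributes to the coefficient at \<open>p + q\<close>. If
  \<open>p\<close> or \<open>q\<close> is no key, both sides are zero.\<close>

lemma lookup_mult_unique:
  fixes f g :: "'v::comm_monoid_add \<Rightarrow>\<^sub>0 'k::comm_semiring_1"
  assumes "\<And>l m. l \<in> keys f \<Longrightarrow> m \<in> keys g \<Longrightarrow> l + m = p + q \<Longrightarrow> l = p \<and> m = q"
  shows "lookup (f * g) (p + q) = lookup f p * lookup g q"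
proof -
  have "lookup (f * g) (p + q) =
      (\<Sum>l\<in>keys f. \<Sum>m\<in>keys g. if l = p \<and> m = q then lookup f l * lookup g m else 0)"
    unfolding lookup_mult_sum
  proof (intro sum.cong refl)
    fix l m assume "l \<in> keys f" "m \<in> keys g"
    then have "l + m = p + q \<longleftrightarrow> l = p \<and> m = q" using assms by blast
    then show "(if l + m = p + q then lookup f l * lookup g m else 0) =
        (if l = p \<and> m = q then lookup f l * lookup g m else 0)" by simp
  qed
  also have "\<dots> = (\<Sum>l\<in>keys f. if l = p then lookup f l * lookup g q else 0)"
  proof (rule sum.cong[OF refl])
    fix l
    show "(\<Sum>m\<in>keys g. if l = p \<and> m = q then lookup f l * lookup g m else 0) =
        (if l = p then lookup f l * lookup g q else 0)"
      by (cases "l = p") (auto simp: sum.delta in_keys_iff)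
  qed
  also have "\<dots> = lookup f p * lookup g q" by (auto simp: sum.delta in_keys_iff)
  finally show ?thesis .
qed

text \<open>Maximise an injective functional on each set; a pair with the same sum has to attain
  both maxima. This takes the place of leading terms for a monomial order.\<close>

lemma extremal_pair:
  fixes K L :: "(real ^ 'n) set"
  assumes "finite K" "K \<noteq> {}" "finite L" "L \<noteq> {}"
  obtains p q where "p \<in> K" "q \<in> L" "\<And>l m. l \<in> K \<Longrightarrow> m \<in> L \<Longrightarrow> l + m = p + q \<Longrightarrow> l = p \<and> m = q"
proof -
  obtain a where a: "inj_on (\<lambda>x. a \<bullet> x) (K \<union> L)"
    using generic_functional[of "K \<union> L"] assms by auto
  have mx: "\<exists>p\<in>K. \<forall>l\<in>K. a \<bullet> l \<le> a \<bullet> p" if "finite K" "K \<noteq> {}" for K :: "(real ^ 'n) set"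
  proof -
    have "Max ((\<lambda>x. a \<bullet> x) ` K) \<in> (\<lambda>x. a \<bullet> x) ` K" using that by (intro Max_in) auto
    then obtain p where "p \<in> K" "a \<bullet> p = Max ((\<lambda>x. a \<bullet> x) ` K)" by auto
    then show ?thesis using that(1) by (intro bexI[of _ p]) auto
  qed
  obtain p where p: "p \<in> K" "\<And>l. l \<in> K \<Longrightarrow> a \<bullet> l \<le> a \<bullet> p" using mx[of K] assms by auto
  obtain q where q: "q \<in> L" "\<And>l. l \<in> L \<Longrightarrow> a \<bullet> l \<le> a \<bullet> q" using mx[of L] assms by auto
  show ?thesis
  proof (rule that[OF p(1) q(1)])
    fix l m assume lm: "l \<in> K" "m \<in> L" "l + m = p + q"
    then have "a \<bullet> l + a \<bullet> m = a \<bullet> p + a \<bullet> q" by (metis inner_add_right)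
    then have "a \<bullet> l = a \<bullet> p" "a \<bullet> m = a \<bullet> q" using p(2)[OF lm(1)] q(2)[OF lm(2)] by linarith+
    then show "l = p \<and> m = q" using a lm p q unfolding inj_on_def by blast
  qed
qed

lemma poly_mapping_mult_eq_0:
  fixes f g :: "(real ^ 'n) \<Rightarrow>\<^sub>0 'k::field"
  assumes "f * g = 0"
  shows "f = 0 \<or> g = 0"
proof (rule ccontr)
  assume "\<not> (f = 0 \<or> g = 0)"
  then have "keys f \<noteq> {}" "keys g \<noteq> {}" by auto
  then obtain p q where pq: "p \<in> keys f" "q \<in> keys g"
    "\<And>l m. l \<in> keys f \<Longrightarrow> m \<in> keys g \<Longrightarrow> l + m = p + q \<Longrightarrow> l = p \<and> m = q"
    using extremal_pair[of "keys f" "keys g"] by auto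
  have "lookup (f * g) (p + q) = lookup f p * lookup g q"
    by (rule lookup_mult_unique) (rule pq(3))
  then show False using pq(1,2) assms by (simp add: in_keys_iff)
qed

lemma poly_mapping_mult_left_cancel:
  fixes f g h :: "(real ^ 'n) \<Rightarrow>\<^sub>0 'k::field"
  assumes "h * f = h * g" "h \<noteq> 0"
  shows "f = g"
proof -
  have "h * (f - g) = 0" using assms(1) by (simp only: right_diff_distrib diff_self)
  then show ?thesis using poly_mapping_mult_eq_0[of h "f - g"] assms(2) by simp
qed

section \<open>Polynomials supported in a given set of exponents\<close>

definition mon :: "'v set \<Rightarrow> ('v \<Rightarrow>\<^sub>0 'k::zero) set" where
  "mon E = {f. keys f \<subseteq> E}"

lemma mon_0 [simp]: "0 \<in> mon E" by (simp add: mon_def)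

lemma mon_add: "f \<in> mon E \<Longrightarrow> g \<in> mon E \<Longrightarrow> f + g \<in> mon E"
  unfolding mon_def using Poly_Mapping.keys_add[of f g] by auto

lemma mon_sum: "(\<And>i. i \<in> I \<Longrightarrow> f i \<in> mon E) \<Longrightarrow> sum f I \<in> mon E"
  by (induction I rule: infinite_finite_induct) (simp_all add: mon_add)

lemma mon_uminus: "f \<in> mon E \<Longrightarrow> - f \<in> mon (E :: 'v set)" for f :: "'v \<Rightarrow>\<^sub>0 'k::ab_group_add"
  by (auto simp: mon_def in_keys_iff)

lemma mon_mult:
  fixes f :: "'v::comm_monoid_add \<Rightarrow>\<^sub>0 'k::comm_semiring_1"
  shows "f \<in> mon E \<Longrightarrow> g \<in> mon F \<Longrightarrow> (\<And>e f. e \<in> E \<Longrightarrow> f \<in> F \<Longrightarrow> e + f \<in> G) \<Longrightarrow> f * g \<in> mon G"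
proof -
  assume fg: "f \<in> mon E" "g \<in> mon F" and G: "\<And>e f. e \<in> E \<Longrightarrow> f \<in> F \<Longrightarrow> e + f \<in> G"
  have "keys (f * g) \<subseteq> G"
  proof
    fix k assume "k \<in> keys (f * g)"
    then obtain a b where "k = a + b" "a \<in> keys f" "b \<in> keys g" using keys_mult[of f g] by blast
    then show "k \<in> G" using fg G unfolding mon_def by blast
  qed
  then show "f * g \<in> mon G" by (simp add: mon_def)
qed

lemma mon_mono: "E \<subseteq> F \<Longrightarrow> mon E \<subseteq> mon F"
  by (auto simp: mon_def)

lemma mon_single: "q \<in> E \<Longrightarrow> Poly_Mapping.single q c \<in> mon E"
  by (simp add: mon_def)

lemma mon_one: "0 \<in> E \<Longrightarrow> 1 \<in> mon E"
  by (simp add: mon_def)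

text \<open>The type argument fixes the coefficient field, which does not occur in the type of
  \<open>\<sigma>\<close>.\<close>

locale cone_ring = pointed_cone \<sigma> for \<sigma> :: "(real ^ 'd) set" +
  fixes field_type :: "'k::field itself"
begin

abbreviation R :: "((real ^ 'd) \<Rightarrow>\<^sub>0 'k) ring" where
  "R \<equiv> semigroup_ring \<sigma>"

lemma R_simps: "carrier R = mon S" "x \<otimes>\<^bsub>R\<^esub> y = x * y" "x \<oplus>\<^bsub>R\<^esub> y = x + y" "\<zero>\<^bsub>R\<^esub> = 0" "\<one>\<^bsub>R\<^esub> = 1"
  by (simp_all add: semigroup_ring_def mon_def)

lemma mon_S_mult: "f \<in> mon E \<Longrightarrow> g \<in> mon S \<Longrightarrow> sideal E \<Longrightarrow> f * g \<in> mon E" for f :: "_ \<Rightarrow>\<^sub>0 'k"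
  using mon_mult[of f E g S E] sidealD[of E] by blast

lemma sideal_all: "sideal S"
  by (auto simp: sideal_def intro: S_add)

sublocale R: cring R
proof (rule cringI)
  show "abelian_group R"
  proof (rule abelian_groupI)
    fix x assume "x \<in> carrier R"
    then have "- x \<in> carrier R" "- x + x = 0" by (auto simp: R_simps mon_uminus)
    then show "\<exists>y\<in>carrier R. y \<oplus>\<^bsub>R\<^esub> x = \<zero>\<^bsub>R\<^esub>" by (intro bexI[of _ "- x"]) (simp_all add: R_simps)
  qed (auto simp: R_simps algebra_simps intro: mon_add)
  show "Group.comm_monoid R"
    by (rule comm_monoidI) (auto simp: R_simps algebra_simps mon_one intro: mon_S_mult sideal_all)
qed (simp add: R_simps algebra_simps)

lemma R_minus: "x \<in> mon S \<Longrightarrow> y \<in> mon S \<Longrightarrow> x \<ominus>\<^bsub>R\<^esub> y = x - y"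
proof -
  assume xy: "x \<in> mon S" "y \<in> mon S"
  have "\<ominus>\<^bsub>R\<^esub> y = - y" using xy by (intro R.minus_equality) (auto simp: R_simps mon_uminus)
  then show ?thesis by (simp add: a_minus_def R_simps)
qed

lemma ideal_mon: "sideal E \<Longrightarrow> ideal (mon E) R"
proof (rule idealI)
  assume E: "sideal E"
  show "subgroup (mon E) (add_monoid R)"
  proof (rule R.add.subgroupI)
    show "mon E \<subseteq> carrier R" using E by (auto simp: R_simps sideal_def dest: mon_mono)
    show "mon E \<noteq> ({} :: (_ \<Rightarrow>\<^sub>0 'k) set)" using mon_0 by blast
    fix x y :: "_ \<Rightarrow>\<^sub>0 'k" assume x: "x \<in> mon E"
    have xS: "x \<in> mon S" using x mon_mono[of E S] E by (auto simp: sideal_def)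
    have "\<ominus>\<^bsub>R\<^esub> x = - x" using xS by (intro R.minus_equality) (auto simp: R_simps mon_uminus)
    then show "\<ominus>\<^bsub>R\<^esub> x \<in> mon E" using x by (simp only: mon_uminus)
    assume "y \<in> mon E"
    then show "x \<oplus>\<^bsub>R\<^esub> y \<in> mon E" using mon_add x by (simp add: R_simps)
  qed
qed (auto simp: R_simps mult.commute R.ring_axioms intro: mon_S_mult)

lemma genideal_monom:
  assumes "V \<subseteq> S"
  shows "Idl\<^bsub>R\<^esub> (monom ` V) = mon (span_ideal V)"
proof
  have VS: "monom ` V \<subseteq> carrier R" using assms by (auto simp: R_simps intro!: mon_single)
  show "Idl\<^bsub>R\<^esub> (monom ` V) \<subseteq> mon (span_ideal V)"
    by (rule R.genideal_minimal[OF ideal_mon[OF sideal_span_ideal[OF assms]]])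
      (use span_ideal_superset in \<open>auto intro!: mon_single\<close>)
  interpret I: ideal "Idl\<^bsub>R\<^esub> (monom ` V)" R by (rule R.genideal_ideal[OF VS])
  show "mon (span_ideal V) \<subseteq> Idl\<^bsub>R\<^esub> (monom ` V)"
  proof
    fix f :: "_ \<Rightarrow>\<^sub>0 'k" assume f: "f \<in> mon (span_ideal V)"
    have single: "Poly_Mapping.single q c \<in> Idl\<^bsub>R\<^esub> (monom ` V)" if "q \<in> span_ideal V" for q and c :: 'k
    proof -
      obtain v s where vs: "q = v + s" "v \<in> V" "s \<in> S" using \<open>q \<in> _\<close> unfolding span_ideal_def by blast
      have "Poly_Mapping.single s c \<otimes>\<^bsub>R\<^esub> monom v \<in> Idl\<^bsub>R\<^esub> (monom ` V)"
        using vs VS R.genideal_self by (intro I.I_l_closed) (auto simp: R_simps intro: mon_single)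
      then show ?thesis using vs by (simp add: R_simps mult_single add.commute)
    qed
    have "(\<Sum>l\<in>K. Poly_Mapping.single l (lookup f l)) \<in> Idl\<^bsub>R\<^esub> (monom ` V)"
      if "finite K" "K \<subseteq> span_ideal V" for K
      using that
    proof (induction K rule: finite_induct)
      case empty
      then show ?case using I.zero_closed by (simp add: R_simps)
    next
      case (insert x F)
      then show ?case using I.a_closed single by (fastforce simp: R_simps)
    qed
    then show "f \<in> Idl\<^bsub>R\<^esub> (monom ` V)"
      using f by (subst poly_mapping_expand[of "keys f" f]) (auto simp: mon_def)
  qed
qed

text \<open>The denominators: a nonzero constant coefficient means lying outside the homogeneous
  maximal ideal.\<close>

definition D :: "((real ^ 'd) \<Rightarrow>\<^sub>0 'k) set" where
  "D = {f \<in> mon S. lookup f 0 \<noteq> 0}"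

lemma carrier_minus_max: "carrier R - homogeneous_max_ideal \<sigma> = D"
proof -
  have "homogeneous_max_ideal \<sigma> = (mon (S - {0}) :: (_ \<Rightarrow>\<^sub>0 'k) set)"
    unfolding homogeneous_max_ideal_def by (subst genideal_monom) (auto simp: span_ideal_nonzero)
  then show ?thesis by (auto simp: R_simps D_def mon_def in_keys_iff)
qed

lemma D_S: "s \<in> D \<Longrightarrow> s \<in> mon S" and D_nonzero: "s \<in> D \<Longrightarrow> s \<noteq> 0"
  by (auto simp: D_def)

lemma D_one [simp]: "1 \<in> D"
  by (simp add: D_def mon_one)

text \<open>Pointedness leaves \<open>0 + 0\<close> as the only decomposition of \<open>0\<close> in
  \<open>S\<close>, so the constant coefficient is multiplicative.\<close>

lemma D_mult: "s \<in> D \<Longrightarrow> t \<in> D \<Longrightarrow> s * t \<in> D"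
proof -
  assume s: "s \<in> D" and t: "t \<in> D"
  have "lookup (s * t) (0 + 0) = lookup s 0 * lookup t 0"
  proof (rule lookup_mult_unique)
    fix l m assume "l \<in> keys s" "m \<in> keys t" "l + m = 0 + 0"
    moreover have "keys s \<subseteq> S" "keys t \<subseteq> S" using s t by (auto simp: D_def mon_def)
    ultimately show "l = 0 \<and> m = 0" using S_add_eq_0 by auto
  qed
  then show ?thesis using s t by (auto simp: D_def intro: mon_S_mult sideal_all)
qed

text \<open>At a lightest exponent of \<open>f\<close> outside \<open>E\<close>, the coefficient of
  \<open>s * f\<close> is that of \<open>f\<close> times the constant coefficient of
  \<open>s\<close>, hence nonzero. So contracting the extension of a monomial ideal to
  \<open>A\<close> gives back the ideal.\<close>

lemma mon_unit_cancel:
  assumes E: "sideal E" and f: "f \<in> mon S" and s: "s \<in> D" and sf: "s * f \<in> mon E"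
  shows "f \<in> mon E"
proof (rule ccontr)
  assume "f \<notin> mon E"
  then have ne: "keys f - E \<noteq> {}" by (auto simp: mon_def)
  have "keys f - E \<subseteq> S" using f by (auto simp: mon_def)
  then obtain q where q: "q \<in> keys f - E" "\<And>e'. e' \<in> keys f - E \<Longrightarrow> weight \<bullet> q \<le> weight \<bullet> e'"
    using weight_min ne by metis
  have "lookup (s * f) (0 + q) = lookup s 0 * lookup f q"
  proof (rule lookup_mult_unique)
    fix l p assume lp: "l \<in> keys s" "p \<in> keys f" "l + p = 0 + q"
    have lS: "l \<in> S" using s lp by (auto simp: D_def mon_def)
    \<comment> \<open>Otherwise \<open>q = p + l\<close> would be in \<open>E\<close>.\<close>
    have "p \<notin> E" using sidealD[OF E _ lS, of p] lp q by (auto simp: add.commute)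
    then have "weight \<bullet> q \<le> weight \<bullet> p" using q(2) lp(2) by blast
    moreover have "weight \<bullet> q = weight \<bullet> l + weight \<bullet> p" using lp(3) by (metis inner_add_right add_0)
    ultimately have "weight \<bullet> l \<le> 0" by simp
    then have "l = 0" using weight_pos[OF S_sigma[OF lS]] by force
    then show "l = 0 \<and> p = q" using lp by simp
  qed
  then have "lookup (s * f) q \<noteq> 0" using s q(1) by (auto simp: D_def in_keys_iff)
  then show False using sf q(1) by (auto simp: mon_def in_keys_iff)
qed

section \<open>Fractions and the ring operations of \<open>A\<close>\<close>

abbreviation A :: "(((real ^ 'd) \<Rightarrow>\<^sub>0 'k) \<times> ((real ^ 'd) \<Rightarrow>\<^sub>0 'k)) set ring" where
  "A \<equiv> local_semigroup_ring \<sigma>"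

definition fr :: "((real ^ 'd) \<Rightarrow>\<^sub>0 'k) \<Rightarrow> ((real ^ 'd) \<Rightarrow>\<^sub>0 'k) \<Rightarrow> (((real ^ 'd) \<Rightarrow>\<^sub>0 'k) \<times> ((real ^ 'd) \<Rightarrow>\<^sub>0 'k)) set" where
  "fr a s = loc_frac R D a s"

lemma A_eq: "A = localization R D"
  unfolding local_semigroup_ring_def localization_at_def carrier_minus_max ..

lemma loc_monom_eq: "loc_monom \<sigma> q = fr (monom q) 1"
  unfolding loc_monom_def carrier_minus_max fr_def ..

text \<open>The semigroup ring is a domain and \<open>D\<close> omits zero, so the factor
  \<open>u\<close> of \<open>loc_rel\<close> cancels.\<close>

lemma loc_rel_iff:
  "((a, s), (b, t)) \<in> loc_rel R D \<longleftrightarrow> a \<in> mon S \<and> s \<in> D \<and> b \<in> mon S \<and> t \<in> D \<and> a * t = b * s"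
proof (cases "a \<in> mon S \<and> s \<in> D \<and> b \<in> mon S \<and> t \<in> D")
  case True
  then have "a * t \<in> mon S" "b * s \<in> mon S" using D_S by (auto intro: mon_S_mult sideal_all)
  then have eq: "a \<otimes>\<^bsub>R\<^esub> t \<ominus>\<^bsub>R\<^esub> b \<otimes>\<^bsub>R\<^esub> s = a * t - b * s" by (simp add: R_simps R_minus)
  have "(\<exists>u\<in>D. u * (a * t - b * s) = 0) \<longleftrightarrow> a * t = b * s"
    using poly_mapping_mult_eq_0 D_nonzero D_one by (metis eq_iff_diff_eq_0 mult_zero_right)
  then have "(\<exists>u\<in>D. u \<otimes>\<^bsub>R\<^esub> (a \<otimes>\<^bsub>R\<^esub> t \<ominus>\<^bsub>R\<^esub> b \<otimes>\<^bsub>R\<^esub> s) = \<zero>\<^bsub>R\<^esub>) \<longleftrightarrow> a * t = b * s"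
    unfolding eq by (simp only: R_simps)
  then show ?thesis using True unfolding loc_rel_def by (simp add: R_simps(1))
next
  case False
  then show ?thesis by (auto simp: loc_rel_def R_simps)
qed

lemma fr_eq: "a \<in> mon S \<Longrightarrow> s \<in> D \<Longrightarrow> fr a s = {(b, t). b \<in> mon S \<and> t \<in> D \<and> a * t = b * s}"
  unfolding fr_def loc_frac_def by (auto simp: Image_def loc_rel_iff)

lemma fr_eq_iff:
  assumes "a \<in> mon S" "s \<in> D" "b \<in> mon S" "t \<in> D"
  shows "fr a s = fr b t \<longleftrightarrow> a * t = b * s"
proof
  assume "fr a s = fr b t"
  then have "(a, s) \<in> fr b t" using assms by (auto simp: fr_eq)
  then show "a * t = b * s" using assms by (auto simp: fr_eq)
next
  assume eq: "a * t = b * s"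
  have "a * r = c * s \<longleftrightarrow> b * r = c * t" for c r
  proof
    assume h: "a * r = c * s"
    have "s * (b * r) = (b * s) * r" by (simp add: mult_ac)
    also have "\<dots> = (a * r) * t" unfolding eq[symmetric] by (simp add: mult_ac)
    also have "\<dots> = s * (c * t)" unfolding h by (simp add: mult_ac)
    finally show "b * r = c * t" using poly_mapping_mult_left_cancel D_nonzero assms by blast
  next
    assume h: "b * r = c * t"
    have "t * (a * r) = (a * t) * r" by (simp add: mult_ac)
    also have "\<dots> = (b * r) * s" unfolding eq by (simp add: mult_ac)
    also have "\<dots> = t * (c * s)" unfolding h by (simp add: mult_ac)
    finally show "a * r = c * s" using poly_mapping_mult_left_cancel D_nonzero assms by blast
  qed
  then show "fr a s = fr b t" using assms by (simp add: fr_eq)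
qed

lemma carrier_A: "carrier A = {fr a s | a s. a \<in> mon S \<and> s \<in> D}"
  unfolding A_eq localization_def fr_def loc_frac_def by (auto simp: quotient_def R_simps)

lemma carrier_AE:
  assumes "x \<in> carrier A"
  obtains a s where "a \<in> mon S" "s \<in> D" "x = fr a s"
  using assms unfolding carrier_A by blast

lemma fr_carrier [intro]: "a \<in> mon S \<Longrightarrow> s \<in> D \<Longrightarrow> fr a s \<in> carrier A"
  unfolding carrier_A by blast

lemma A_one: "\<one>\<^bsub>A\<^esub> = fr 1 1" and A_zero: "\<zero>\<^bsub>A\<^esub> = fr 0 1"
  unfolding A_eq localization_def fr_def by (simp_all add: R_simps)

text \<open>The operations of \<open>localization\<close> are unions over all representatives; once
  the fraction does not depend on them, the union is that fraction.\<close>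

lemma UN_pair_const:
  assumes "\<And>a s b t. (a, s) \<in> X \<Longrightarrow> (b, t) \<in> Y \<Longrightarrow> g a s b t = c" "(a0, s0) \<in> X" "(b0, t0) \<in> Y"
  shows "(\<Union>(a, s) \<in> X. \<Union>(b, t) \<in> Y. g a s b t) = c"
proof
  show "(\<Union>(a, s) \<in> X. \<Union>(b, t) \<in> Y. g a s b t) \<subseteq> c" using assms(1) by blast
  show "c \<subseteq> (\<Union>(a, s) \<in> X. \<Union>(b, t) \<in> Y. g a s b t)"
    using assms(1)[OF assms(2,3)] assms(2,3) by blast
qed

lemma mon_S_mult': "f \<in> mon S \<Longrightarrow> g \<in> mon S \<Longrightarrow> f * g \<in> mon S" for f :: "_ \<Rightarrow>\<^sub>0 'k"
  by (rule mon_S_mult[OF _ _ sideal_all])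

lemma A_mult:
  assumes "a \<in> mon S" "s \<in> D" "b \<in> mon S" "t \<in> D"
  shows "fr a s \<otimes>\<^bsub>A\<^esub> fr b t = fr (a * b) (s * t)"
proof -
  have "fr (a' * b') (s' * t') = fr (a * b) (s * t)"
    if "(a', s') \<in> fr a s" "(b', t') \<in> fr b t" for a' s' b' t'
  proof -
    have h: "a' \<in> mon S" "s' \<in> D" "b' \<in> mon S" "t' \<in> D" "a * s' = a' * s" "b * t' = b' * t"
      using that assms by (auto simp: fr_eq)
    have "(a' * b') * (s * t) = (a' * s) * (b' * t)" by (simp add: algebra_simps)
    also have "\<dots> = (a * b) * (s' * t')" unfolding h(5,6)[symmetric] by (simp add: algebra_simps)
    finally show ?thesis using h assms by (subst fr_eq_iff) (auto intro: D_mult mon_S_mult')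
  qed
  moreover have "(a, s) \<in> fr a s" "(b, t) \<in> fr b t" using assms by (auto simp: fr_eq)
  ultimately have "(\<Union>(a, s) \<in> fr a s. \<Union>(b, t) \<in> fr b t. fr (a * b) (s * t)) = fr (a * b) (s * t)"
    by (intro UN_pair_const)
  then show ?thesis unfolding A_eq localization_def by (simp add: R_simps fr_def)
qed

lemma A_add:
  assumes "a \<in> mon S" "s \<in> D" "b \<in> mon S" "t \<in> D"
  shows "fr a s \<oplus>\<^bsub>A\<^esub> fr b t = fr (a * t + b * s) (s * t)"
proof -
  have "fr (a' * t' + b' * s') (s' * t') = fr (a * t + b * s) (s * t)"
    if "(a', s') \<in> fr a s" "(b', t') \<in> fr b t" for a' s' b' t'
  proof -
    have h: "a' \<in> mon S" "s' \<in> D" "b' \<in> mon S" "t' \<in> D" "a * s' = a' * s" "b * t' = b' * t"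
      using that assms by (auto simp: fr_eq)
    have "(a' * t' + b' * s') * (s * t) = (a' * s) * (t' * t) + (b' * t) * (s' * s)"
      by (simp add: algebra_simps)
    also have "\<dots> = (a * t + b * s) * (s' * t')" unfolding h(5,6)[symmetric] by (simp add: algebra_simps)
    finally show ?thesis using h assms D_S
      by (subst fr_eq_iff) (auto intro!: D_mult mon_S_mult' mon_add)
  qed
  moreover have "(a, s) \<in> fr a s" "(b, t) \<in> fr b t" using assms by (auto simp: fr_eq)
  ultimately have "(\<Union>(a, s) \<in> fr a s. \<Union>(b, t) \<in> fr b t. fr (a * t + b * s) (s * t)) = fr (a * t + b * s) (s * t)"
    by (intro UN_pair_const)
  then show ?thesis unfolding A_eq localization_def by (simp add: R_simps fr_def)
qed

sublocale A: cring A
proof (rule cringI)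
  note closed = D_mult mon_S_mult' mon_add D_S mon_uminus mon_one[OF S_zero]
  note closed' = D_mult mon_S_mult' mon_add mon_uminus mon_one[OF S_zero]
  show "abelian_group A"
  proof (rule abelian_groupI)
    fix x assume "x \<in> carrier A"
    then obtain a s where x: "x = fr a s" "a \<in> mon S" "s \<in> D" by (blast elim: carrier_AE)
    then have "fr (- a) s \<oplus>\<^bsub>A\<^esub> x = \<zero>\<^bsub>A\<^esub>"
      by (simp add: A_add A_zero mon_uminus fr_eq_iff closed)
    then show "\<exists>y\<in>carrier A. y \<oplus>\<^bsub>A\<^esub> x = \<zero>\<^bsub>A\<^esub>" using x mon_uminus by blast
    show "\<zero>\<^bsub>A\<^esub> \<oplus>\<^bsub>A\<^esub> x = x" using x by (simp add: A_add A_zero)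
    fix y assume "y \<in> carrier A"
    then obtain b t where y: "y = fr b t" "b \<in> mon S" "t \<in> D" by (blast elim: carrier_AE)
    show "x \<oplus>\<^bsub>A\<^esub> y \<in> carrier A" using x y D_S[of s] D_S[of t] by (auto simp: A_add intro!: fr_carrier closed')
    show "x \<oplus>\<^bsub>A\<^esub> y = y \<oplus>\<^bsub>A\<^esub> x" using x y by (simp add: A_add algebra_simps)
    fix z assume "z \<in> carrier A"
    then obtain c r where z: "z = fr c r" "c \<in> mon S" "r \<in> D" by (blast elim: carrier_AE)
    show "x \<oplus>\<^bsub>A\<^esub> y \<oplus>\<^bsub>A\<^esub> z = x \<oplus>\<^bsub>A\<^esub> (y \<oplus>\<^bsub>A\<^esub> z)"
      using x y z by (simp add: A_add closed) (simp add: algebra_simps)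
  qed (auto simp: A_zero)
  show "Group.comm_monoid A"
  proof (rule comm_monoidI)
    fix x assume "x \<in> carrier A"
    then obtain a s where x: "x = fr a s" "a \<in> mon S" "s \<in> D" by (blast elim: carrier_AE)
    show "\<one>\<^bsub>A\<^esub> \<otimes>\<^bsub>A\<^esub> x = x" using x by (simp add: A_mult A_one closed)
    fix y assume "y \<in> carrier A"
    then obtain b t where y: "y = fr b t" "b \<in> mon S" "t \<in> D" by (blast elim: carrier_AE)
    show "x \<otimes>\<^bsub>A\<^esub> y \<in> carrier A" using x y by (auto simp: A_mult intro!: fr_carrier closed')
    show "x \<otimes>\<^bsub>A\<^esub> y = y \<otimes>\<^bsub>A\<^esub> x" using x y by (simp add: A_mult mult.commute)
    fix z assume "z \<in> carrier A"
    then obtain c r where z: "z = fr c r" "c \<in> mon S" "r \<in> D" by (blast elim: carrier_AE)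
    show "x \<otimes>\<^bsub>A\<^esub> y \<otimes>\<^bsub>A\<^esub> z = x \<otimes>\<^bsub>A\<^esub> (y \<otimes>\<^bsub>A\<^esub> z)"
      using x y z by (simp add: A_mult closed mult.assoc)
  qed (auto simp: A_one closed)
  fix x y z assume "x \<in> carrier A" "y \<in> carrier A" "z \<in> carrier A"
  then obtain a s b t c r where *: "x = fr a s" "a \<in> mon S" "s \<in> D" "y = fr b t" "b \<in> mon S" "t \<in> D"
    "z = fr c r" "c \<in> mon S" "r \<in> D" by (metis carrier_AE)
  then show "(x \<oplus>\<^bsub>A\<^esub> y) \<otimes>\<^bsub>A\<^esub> z = x \<otimes>\<^bsub>A\<^esub> z \<oplus>\<^bsub>A\<^esub> y \<otimes>\<^bsub>A\<^esub> z"
    by (simp add: A_add A_mult closed fr_eq_iff) (simp add: algebra_simps)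
qed

lemma A_uminus: "a \<in> mon S \<Longrightarrow> s \<in> D \<Longrightarrow> \<ominus>\<^bsub>A\<^esub> fr a s = fr (- a) s"
  by (rule A.minus_equality) (auto simp: A_add A_zero mon_uminus fr_eq_iff D_mult D_S mon_S_mult' mon_add)

lemma fr_zero_iff: "a \<in> mon S \<Longrightarrow> s \<in> D \<Longrightarrow> fr a s = \<zero>\<^bsub>A\<^esub> \<longleftrightarrow> a = 0"
  by (simp add: A_zero fr_eq_iff)

text \<open>For \<open>sideal E\<close>, the ideal of \<open>A\<close> generated by the monomials
  with exponents in \<open>E\<close>.\<close>

definition ext where "ext E = {fr f s | f s. f \<in> mon E \<and> s \<in> D}"

lemma sideal_mon_S: "sideal E \<Longrightarrow> f \<in> mon E \<Longrightarrow> f \<in> mon S"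
  using mon_mono[of E S] by (auto simp: sideal_def)

text \<open>By \<open>mon_unit_cancel\<close> the numerator alone decides membership; this turns
  questions about ideals of \<open>A\<close> into questions about exponents.\<close>

lemma fr_in_ext: 
  assumes "sideal E" "f \<in> mon S" "s \<in> D"
  shows "fr f s \<in> ext E \<longleftrightarrow> f \<in> mon E"
proof
  assume "fr f s \<in> ext E"
  then obtain g t where g: "fr f s = fr g t" "g \<in> mon E" "t \<in> D" unfolding ext_def by blast
  then have "f * t = g * s" using assms sideal_mon_S[OF assms(1) g(2)] g(3) by (simp add: fr_eq_iff)
  then have "t * f \<in> mon E" using g assms D_S by (simp add: mult.commute[of t] mon_S_mult)
  then show "f \<in> mon E" using mon_unit_cancel assms g by blast
qed (use assms in \<open>auto simp: ext_def\<close>)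

lemma ext_carrier: "sideal E \<Longrightarrow> ext E \<subseteq> carrier A"
  unfolding ext_def using sideal_mon_S by auto

lemma ext_all: "ext S = carrier A"
  unfolding ext_def carrier_A ..

lemma ideal_ext: "sideal E \<Longrightarrow> ideal (ext E) A"
proof (rule idealI)
  assume E: "sideal E"
  note closed = D_mult mon_S_mult' D_S mon_uminus
  show "subgroup (ext E) (add_monoid A)"
  proof (rule A.add.subgroupI)
    show "ext E \<subseteq> carrier A" using ext_carrier E .
    show "ext E \<noteq> {}" unfolding ext_def using mon_0 D_one by blast
    fix x y assume "x \<in> ext E"
    then obtain a s where x: "x = fr a s" "a \<in> mon E" "s \<in> D" unfolding ext_def by blast
    have "\<ominus>\<^bsub>A\<^esub> x = fr (- a) s" using x sideal_mon_S[OF E x(2)] by (simp add: A_uminus)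
    then show "\<ominus>\<^bsub>A\<^esub> x \<in> ext E"
      using x mon_uminus unfolding ext_def by blast
    assume "y \<in> ext E"
    then obtain b t where y: "y = fr b t" "b \<in> mon E" "t \<in> D" unfolding ext_def by blast
    have "x \<oplus>\<^bsub>A\<^esub> y = fr (a * t + b * s) (s * t)"
      using x y sideal_mon_S[OF E x(2)] sideal_mon_S[OF E y(2)] by (simp add: A_add)
    moreover have "a * t + b * s \<in> mon E" using x y E D_S by (intro mon_add mon_S_mult)
    ultimately show "x \<oplus>\<^bsub>A\<^esub> y \<in> ext E"
      using x y D_mult unfolding ext_def by blast
  qed
  fix a x assume "a \<in> ext E" and "x \<in> carrier A"
  then obtain f s g t where *: "a = fr f s" "f \<in> mon E" "s \<in> D" "x = fr g t" "g \<in> mon S" "t \<in> D"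
    unfolding ext_def by (blast elim: carrier_AE)
  have fS: "f \<in> mon S" using sideal_mon_S[OF E] * by blast
  have fg: "f * g \<in> mon E" using E * by (intro mon_S_mult)
  show "a \<otimes>\<^bsub>A\<^esub> x \<in> ext E" "x \<otimes>\<^bsub>A\<^esub> a \<in> ext E"
    using * fS fg D_mult by (auto simp: A_mult ext_def mult.commute[of g f])
qed (rule A.ring_axioms)

lemma ext_inj:
  assumes "sideal E" "sideal F" "ext E = ext F"
  shows "E = F"
proof -
  have sub: "E \<subseteq> F" if "sideal E" "sideal F" "ext E = ext F" for E F
  proof
    fix q assume q: "q \<in> E"
    then have "fr (monom q) 1 \<in> ext E" unfolding ext_def using mon_single[of q E] D_one by blast
    then have "fr (monom q) 1 \<in> ext F" using that by simp
    moreover have "monom q \<in> (mon S :: (_ \<Rightarrow>\<^sub>0 'k) set)" using q sideal_S[OF that(1)] by (auto intro!: mon_single)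
    ultimately have "monom q \<in> (mon F :: (_ \<Rightarrow>\<^sub>0 'k) set)" using fr_in_ext[OF that(2)] by simp
    then show "q \<in> F" by (simp add: mon_def)
  qed
  show ?thesis using sub[OF assms] sub[OF assms(2,1) assms(3)[symmetric]] by blast
qed

lemma fr_sum_mem:
  assumes "ideal J A" "s \<in> D" "finite K" "K \<subseteq> S"
    and "\<And>q. q \<in> K \<Longrightarrow> fr (Poly_Mapping.single q (c q)) s \<in> J"
  shows "fr (\<Sum>q\<in>K. Poly_Mapping.single q (c q)) s \<in> J"
  using assms(3-)
proof (induction K rule: finite_induct)
  case empty
  have "fr 0 s = \<zero>\<^bsub>A\<^esub>" using assms by (simp add: fr_zero_iff)
  then show ?case using assms(1) by (simp add: additive_subgroup.zero_closed ideal.axioms(1))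
next
  case (insert x F)
  let ?f = "\<Sum>q\<in>F. Poly_Mapping.single q (c q)"
  have S: "?f \<in> mon S" "Poly_Mapping.single x (c x) \<in> mon S"
    using insert.prems by (auto intro!: mon_sum mon_single)
  have "fr (Poly_Mapping.single x (c x)) s \<oplus>\<^bsub>A\<^esub> fr ?f s \<in> J"
    using insert assms(1) by (intro additive_subgroup.a_closed ideal.axioms(1)) auto
  also have "fr (Poly_Mapping.single x (c x)) s \<oplus>\<^bsub>A\<^esub> fr ?f s = fr (Poly_Mapping.single x (c x) + ?f) s"
    using S assms(2) D_S[OF assms(2)]
    by (simp add: A_add fr_eq_iff D_mult mon_S_mult' mon_add) (simp add: algebra_simps)
  finally show ?case using insert by simp
qed

end

context cone_ring
begin

text \<open>A fraction is the sum of its terms, and each term is a monomial times a fraction with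
  constant numerator.\<close>

lemma ext_subset_ideal:
  assumes "ideal J A" "sideal E" "\<And>q. q \<in> E \<Longrightarrow> fr (monom q) 1 \<in> J"
  shows "ext E \<subseteq> J"
proof
  fix x assume "x \<in> ext E"
  then obtain f s where x: "x = fr f s" "f \<in> mon E" "s \<in> D" unfolding ext_def by blast
  have ES: "E \<subseteq> S" using assms(2) by (simp add: sideal_def)
  have "fr (\<Sum>q\<in>keys f. Poly_Mapping.single q (lookup f q)) s \<in> J"
  proof (rule fr_sum_mem[OF assms(1) x(3)])
    show "keys f \<subseteq> S" using x ES by (auto simp: mon_def)
    fix q assume "q \<in> keys f"
    then have q: "q \<in> E" "q \<in> S" using x ES by (auto simp: mon_def)
    have "fr (Poly_Mapping.single 0 (lookup f q)) s \<otimes>\<^bsub>A\<^esub> fr (monom q) 1 \<in> J"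
      using assms(1,3) q x by (intro ideal.I_l_closed) (auto intro!: fr_carrier mon_single)
    then show "fr (Poly_Mapping.single q (lookup f q)) s \<in> J"
      using q x by (simp add: A_mult mon_single mult_single)
  qed simp
  moreover have "(\<Sum>q\<in>keys f. Poly_Mapping.single q (lookup f q)) = f"
    by (rule poly_mapping_expand[symmetric]) simp_all
  ultimately show "x \<in> J" using x(1) by simp
qed

lemma monomials_ideal_eq:
  assumes "V \<subseteq> S"
  shows "monomials_ideal \<sigma> V = ext (span_ideal V)"
proof
  note sid = sideal_span_ideal[OF assms]
  have VS: "loc_monom \<sigma> ` V \<subseteq> carrier A" using assms
    by (auto simp: loc_monom_eq intro!: fr_carrier mon_single)
  show "monomials_ideal \<sigma> V \<subseteq> ext (span_ideal V)"
    unfolding monomials_ideal_def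
  proof (rule A.genideal_minimal[OF ideal_ext[OF sid]])
    show "loc_monom \<sigma> ` V \<subseteq> ext (span_ideal V)"
    proof clarify
      fix v assume "v \<in> V"
      then have "monom v \<in> mon (span_ideal V)" using span_ideal_superset[of V] by (auto intro!: mon_single)
      then show "loc_monom \<sigma> v \<in> ext (span_ideal V)" unfolding loc_monom_eq ext_def using D_one by blast
    qed
  qed
  have I: "ideal (monomials_ideal \<sigma> V) A"
    unfolding monomials_ideal_def by (rule A.genideal_ideal[OF VS])
  show "ext (span_ideal V) \<subseteq> monomials_ideal \<sigma> V"
  proof (rule ext_subset_ideal[OF I sid])
    fix q assume "q \<in> span_ideal V"
    then obtain v s where vs: "q = v + s" "v \<in> V" "s \<in> S" unfolding span_ideal_def by blast
    have sv: "monom s \<in> (mon S :: (_ \<Rightarrow>\<^sub>0 'k) set)" "monom v \<in> (mon S :: (_ \<Rightarrow>\<^sub>0 'k) set)"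
      using mon_single[of s S] mon_single[of v S] vs(2,3) assms by blast+
    have "fr (monom v) 1 \<in> monomials_ideal \<sigma> V"
      using A.genideal_self[OF VS] vs(2) unfolding monomials_ideal_def loc_monom_eq by blast
    then have "fr (monom s) 1 \<otimes>\<^bsub>A\<^esub> fr (monom v) 1 \<in> monomials_ideal \<sigma> V"
      using fr_carrier[OF sv(1) D_one] by (rule ideal.I_l_closed[OF I])
    moreover have "fr (monom s) 1 \<otimes>\<^bsub>A\<^esub> fr (monom v) 1 = fr (monom q) 1"
      unfolding A_mult[OF sv(1) D_one sv(2) D_one] by (simp add: mult_single vs(1) add.commute)
    ultimately show "fr (monom q) 1 \<in> monomials_ideal \<sigma> V" by simp
  qed
qed

text \<open>By \<open>min_gens_least\<close> every set of monomial generators contains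
  \<open>min_gens\<close>, so this is the only irredundant one and the definite description is
  meaningful.\<close>

lemma min_gen_exponents_eq:
  assumes "V \<subseteq> S"
  shows "min_gen_exponents \<sigma> (monomials_ideal \<sigma> V :: (((real ^ 'd) \<Rightarrow>\<^sub>0 'k) \<times> ((real ^ 'd) \<Rightarrow>\<^sub>0 'k)) set set)
    = min_gens (span_ideal V)"
proof -
  let ?E = "span_ideal V"
  note sid = sideal_span_ideal[OF assms]
  have mS: "min_gens ?E \<subseteq> S" using sideal_S[OF sid] by (auto simp: min_gens_def)
  define mi where "mi U = (monomials_ideal \<sigma> U :: (((real ^ 'd) \<Rightarrow>\<^sub>0 'k) \<times> ((real ^ 'd) \<Rightarrow>\<^sub>0 'k)) set set)" for U
  have iff: "mi U = mi V \<longleftrightarrow> span_ideal U = ?E" if "U \<subseteq> S" for U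
  proof -
    have eq: "mi U = ext (span_ideal U)" "mi V = ext ?E"
      unfolding mi_def using monomials_ideal_eq that assms by blast+
    show ?thesis unfolding eq using ext_inj[OF sideal_span_ideal[OF that] sid] by metis
  qed
  have gen: "mi V = mi (min_gens ?E)"
    using iff[OF mS] span_min_gens[OF sid] by simp
  have "(THE V'. V' \<subseteq> S \<and> mi V = mi V' \<and> (\<forall>U. U \<subset> V' \<longrightarrow> mi U \<noteq> mi V)) = min_gens ?E"
  proof (rule the_equality, intro conjI allI impI)
    show "min_gens ?E \<subseteq> S" by (rule mS)
    show "mi V = mi (min_gens ?E)" by (rule gen)
    fix U assume U: "U \<subset> min_gens ?E"
    then have US: "U \<subseteq> S" using mS by blast
    show "mi U \<noteq> mi V"
    proof
      assume "mi U = mi V"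
      then have "span_ideal U = ?E" using iff[OF US] by simp
      then have "min_gens ?E \<subseteq> U" by (rule min_gens_least[OF US])
      then show False using U by blast
    qed
  next
    fix U assume U: "U \<subseteq> S \<and> mi V = mi U \<and> (\<forall>X. X \<subset> U \<longrightarrow> mi X \<noteq> mi V)"
    note U1 = U[THEN conjunct1] and U2 = U[THEN conjunct2, THEN conjunct1, symmetric]
      and U3 = U[THEN conjunct2, THEN conjunct2, rule_format]
    have "span_ideal U = ?E" using iff[OF U1] U2 by (rule iffD1)
    then have "min_gens ?E \<subseteq> U" by (rule min_gens_least[OF U1])
    moreover have "\<not> min_gens ?E \<subset> U" using U3 gen by metis
    ultimately show "U = min_gens ?E" by blast
  qed
  then show ?thesis unfolding min_gen_exponents_def mi_def .
qed

lemma ideal_prod_ext: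
  assumes "sideal E" "sideal F"
  shows "ideal_prod A (ext E) (ext F) = ext {a + b | a b. a \<in> E \<and> b \<in> F}" (is "?L = ext ?G")
proof
  have G: "sideal ?G"
    unfolding sideal_def
  proof (intro conjI subsetI ballI)
    fix x assume "x \<in> ?G"
    then obtain a b where ab: "x = a + b" "a \<in> E" "b \<in> F" by blast
    then show "x \<in> S" using assms by (auto simp: sideal_def intro: S_add)
    fix s assume "s \<in> S"
    then have "b + s \<in> F" using ab sidealD[OF assms(2)] by blast
    moreover have "x + s = a + (b + s)" using ab by simp
    ultimately show "x + s \<in> ?G" using ab by blast
  qed
  show "?L \<subseteq> ext ?G"
  proof
    fix x assume "x \<in> ?L"
    then show "x \<in> ext ?G"
    proof (induction rule: ideal_prod.induct)
      case (prod i j)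
      then obtain f s g t where *: "i = fr f s" "f \<in> mon E" "s \<in> D" "j = fr g t" "g \<in> mon F" "t \<in> D"
        unfolding ext_def by blast
      have "f * g \<in> mon ?G" using * by (intro mon_mult) auto
      moreover have "i \<otimes>\<^bsub>A\<^esub> j = fr (f * g) (s * t)"
        using * sideal_mon_S[OF assms(1) *(2)] sideal_mon_S[OF assms(2) *(5)] by (simp add: A_mult)
      ultimately show ?case using D_mult[OF *(3,6)] unfolding ext_def by blast
    next
      case (sum s1 s2)
      then show ?case using ideal_ext[OF G] by (meson additive_subgroup.a_closed ideal.axioms(1))
    qed
  qed
  show "ext ?G \<subseteq> ?L"
  proof (rule ext_subset_ideal[OF A.ideal_prod_is_ideal[OF ideal_ext[OF assms(1)] ideal_ext[OF assms(2)]] G])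
    fix q assume "q \<in> ?G"
    then obtain a b where ab: "q = a + b" "a \<in> E" "b \<in> F" by blast
    then have "fr (monom a) 1 \<in> ext E" "fr (monom b) 1 \<in> ext F"
      unfolding ext_def using mon_single[of a E] mon_single[of b F] D_one by blast+
    then have "fr (monom a) 1 \<otimes>\<^bsub>A\<^esub> fr (monom b) 1 \<in> ?L" by (rule ideal_prod.prod)
    moreover have "a \<in> S" "b \<in> S" using ab assms sideal_S by blast+
    ultimately show "fr (monom q) 1 \<in> ?L" using ab by (simp add: A_mult mon_single mult_single)
  qed
qed

lemma ideal_power_ext:
  assumes "sideal E"
  shows "ideal_power A (ext E) n = ext (pw E n)"
proof (induction n)
  case 0
  then show ?case by (simp add: nat_pow_def ideals_set_def ext_all)
next
  case (Suc n)
  have ES: "E \<subseteq> S" using assms by (simp add: sideal_def)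
  have "ideal_power A (ext E) (Suc n) = ideal_prod A (ideal_power A (ext E) n) (ext E)"
    by (simp add: nat_pow_def ideals_set_def)
  then show ?case using Suc ideal_prod_ext[OF sideal_pw[OF ES] assms] by simp
qed

text \<open>A fraction outside \<open>ext (S - {0})\<close> has its numerator in \<open>D\<close>
  and is therefore invertible. In particular the description in \<open>local_max_ideal\<close> has a
  unique solution.\<close>

lemma maximal_iff: "maximalideal M A \<longleftrightarrow> M = ext (S - {0})"
proof -
  let ?M = "ext (S - {0})"
  have idM: "ideal ?M A" by (rule ideal_ext[OF sideal_nonzero])
  have full: "J = carrier A" if J: "ideal J A" and x: "x \<in> J" "x \<in> carrier A" "x \<notin> ?M" for J x
  proof -
    obtain a s where as: "x = fr a s" "a \<in> mon S" "s \<in> D" using x by (blast elim: carrier_AE)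
    then have "a \<notin> mon (S - {0})" using x fr_in_ext[OF sideal_nonzero] by auto
    then have aD: "a \<in> D" using as by (auto simp: D_def mon_def in_keys_iff)
    have "fr s a \<otimes>\<^bsub>A\<^esub> x \<in> J" using J x as aD D_S by (intro ideal.I_l_closed) auto
    moreover have "fr s a \<otimes>\<^bsub>A\<^esub> x = \<one>\<^bsub>A\<^esub>"
      using as aD D_S by (simp add: A_mult A_one fr_eq_iff D_mult mon_S_mult' mult.commute mon_one)
    ultimately show ?thesis using ideal.one_imp_carrier[OF J] by simp
  qed
  have one: "\<one>\<^bsub>A\<^esub> \<notin> ?M"
    using fr_in_ext[OF sideal_nonzero, of 1 1] by (auto simp: A_one mon_one) (auto simp: mon_def)
  show ?thesis
  proof
    assume "M = ?M"
    moreover have "maximalideal ?M A"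
    proof (rule maximalidealI[OF idM])
      show "carrier A \<noteq> ?M" using one A.one_closed by metis
      fix J assume "ideal J A" "?M \<subseteq> J" "J \<subseteq> carrier A"
      then show "J = ?M \<or> J = carrier A" using full by blast
    qed
    ultimately show "maximalideal M A" by simp
  next
    assume M: "maximalideal M A"
    then interpret M: maximalideal M A .
    have "M \<subseteq> ?M"
      using full[OF M.is_ideal] M.I_notcarr M.a_subset by blast
    then show "M = ?M"
      using M.I_maximal[OF idM _ ext_carrier[OF sideal_nonzero]] one A.one_closed by metis
  qed
qed

lemma local_max_ideal_eq: "local_max_ideal A = ext (S - {0})"
  unfolding local_max_ideal_def by (simp add: maximal_iff)

end

section \<open>Krull dimension\<close>

text \<open>Gaussian elimination: one coordinate \<open>k\<close> is removed with a pivot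
  \<open>u0\<close>, and a relation among the reduced elements is lifted. Scalars are written as
  constant polynomials.\<close>

lemma linear_dependence:
  fixes f :: "'u \<Rightarrow> ('v::comm_monoid_add \<Rightarrow>\<^sub>0 'k::field)"
  assumes "finite K" "finite U" "card K < card U" "\<And>u. u \<in> U \<Longrightarrow> keys (f u) \<subseteq> K"
  shows "\<exists>c. (\<exists>u\<in>U. c u \<noteq> 0) \<and> (\<Sum>u\<in>U. Poly_Mapping.single 0 (c u) * f u) = 0"
  using assms
proof (induction K arbitrary: U f rule: finite_induct)
  case empty
  then have "f u = 0" if "u \<in> U" for u using that keys_eq_empty by blast
  moreover obtain u where "u \<in> U" using empty by fastforce
  ultimately show ?case by (intro exI[of _ "\<lambda>u. 1"]) auto
next
  case (insert k K)
  show ?case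
  proof (cases "\<exists>u\<in>U. lookup (f u) k \<noteq> 0")
    case False
    then have "keys (f u) \<subseteq> K" if "u \<in> U" for u
      using insert.prems(3)[OF that] that by (auto simp: in_keys_iff)
    moreover have "card K < card U" using insert by simp
    ultimately show ?thesis using insert.IH[of U f] insert.prems by blast
  next
    case True
    then obtain u0 where u0: "u0 \<in> U" "lookup (f u0) k \<noteq> 0" by blast
    define r where "r u = lookup (f u) k / lookup (f u0) k" for u
    define g where "g u = f u - Poly_Mapping.single 0 (r u) * f u0" for u
    let ?U = "U - {u0}"
    have lk: "lookup (Poly_Mapping.single 0 c * h) l = c * lookup h l" for c and h :: "'v \<Rightarrow>\<^sub>0 'k" and l
      using lookup_mult_unique[of "Poly_Mapping.single 0 c" h 0 l]
      by (cases "c = 0") auto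
    have "keys (g u) \<subseteq> K" if "u \<in> ?U" for u
    proof
      fix l assume l: "l \<in> keys (g u)"
      have gl: "lookup (g u) l = lookup (f u) l - r u * lookup (f u0) l"
        by (simp add: g_def lookup_minus lk)
      have "l \<noteq> k" using l gl u0 by (auto simp: in_keys_iff r_def)
      moreover have "l \<in> keys (f u) \<union> keys (f u0)" using l gl by (auto simp: in_keys_iff)
      moreover have "keys (f u) \<subseteq> insert k K" "keys (f u0) \<subseteq> insert k K"
        using insert.prems(3) that u0(1) by blast+
      ultimately show "l \<in> K" by blast
    qed
    moreover have "finite ?U" "card K < card ?U" using insert u0 by auto
    ultimately obtain c where c: "\<exists>u\<in>?U. c u \<noteq> 0"
      "(\<Sum>u\<in>?U. Poly_Mapping.single 0 (c u) * g u) = 0"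
      using insert.IH[of ?U g] by blast
    \<comment> \<open>The coefficient of the pivot collects everything that the reduction
      subtracted.\<close>
    define c' where "c' = c(u0 := - (\<Sum>u\<in>?U. c u * r u))"
    have "(\<Sum>u\<in>?U. Poly_Mapping.single 0 (c u) * g u) =
       (\<Sum>u\<in>?U. Poly_Mapping.single 0 (c u) * f u - Poly_Mapping.single 0 (c u * r u) * f u0)"
      by (intro sum.cong refl) (simp add: g_def right_diff_distrib mult.assoc[symmetric] mult_single)
    also have "\<dots> = (\<Sum>u\<in>?U. Poly_Mapping.single 0 (c u) * f u)
        - (\<Sum>u\<in>?U. Poly_Mapping.single 0 (c u * r u)) * f u0"
      by (simp add: sum_subtractf sum_distrib_right)
    also have "(\<Sum>u\<in>T. Poly_Mapping.single (0::'v) (h u)) = Poly_Mapping.single 0 (\<Sum>u\<in>T. h u)"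
      for T and h :: "'u \<Rightarrow> 'k"
      by (induction T rule: infinite_finite_induct) (simp_all add: single_add)
    finally have eq: "(\<Sum>u\<in>?U. Poly_Mapping.single 0 (c u) * f u)
        = Poly_Mapping.single 0 (\<Sum>u\<in>?U. c u * r u) * f u0"
      using c(2) by simp
    have "(\<Sum>u\<in>U. Poly_Mapping.single 0 (c' u) * f u)
        = Poly_Mapping.single 0 (c' u0) * f u0 + (\<Sum>u\<in>?U. Poly_Mapping.single 0 (c' u) * f u)"
      using insert.prems(1) u0(1) by (rule sum.remove)
    also have "(\<Sum>u\<in>?U. Poly_Mapping.single 0 (c' u) * f u) = (\<Sum>u\<in>?U. Poly_Mapping.single 0 (c u) * f u)"
      by (intro sum.cong refl) (simp add: c'_def)
    also have "\<dots> = Poly_Mapping.single 0 (\<Sum>u\<in>?U. c u * r u) * f u0" by (rule eq)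
    also have "Poly_Mapping.single 0 (c' u0) * f u0 + \<dots> = 0"
      by (simp add: c'_def single_uminus)
    finally have "(\<Sum>u\<in>U. Poly_Mapping.single 0 (c' u) * f u) = 0" .
    moreover have "\<exists>u\<in>U. c' u \<noteq> 0" using c(1) by (auto simp: c'_def)
    ultimately show ?thesis by blast
  qed
qed

fun mpow :: "'a::comm_monoid_mult list \<Rightarrow> nat list \<Rightarrow> 'a" where
  "mpow (x # xs) (i # u) = x ^ i * mpow xs u"
| "mpow _ _ = 1"

text \<open>Along a strict chain of primes, elements \<open>x\<^sub>i\<close> of the successive differences are
  algebraically independent: divide a relation by the highest power of \<open>x\<^sub>0\<close> dividing it and
  reduce modulo the next prime, which contains \<open>x\<^sub>0\<close>.\<close>

lemma prime_chain_independent: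
  fixes p :: "nat \<Rightarrow> ('v::comm_monoid_add \<Rightarrow>\<^sub>0 'k::field) set"
  assumes add: "\<And>i f g. f \<in> p i \<Longrightarrow> g \<in> p i \<Longrightarrow> f + g \<in> p i"
    and mul: "\<And>i f g. f \<in> p i \<Longrightarrow> g \<in> C \<Longrightarrow> g * f \<in> p i"
    and prime: "\<And>i f g. f \<in> C \<Longrightarrow> g \<in> C \<Longrightarrow> f * g \<in> p i \<Longrightarrow> f \<in> p i \<or> g \<in> p i"
    and unit: "\<And>i c. c \<noteq> 0 \<Longrightarrow> Poly_Mapping.single 0 c \<notin> p i"
    and sub: "\<And>i. p i \<subseteq> p (Suc i)" "\<And>i. p i \<subseteq> C" "\<And>i. 0 \<in> p i"
    and C: "\<And>f g. f \<in> C \<Longrightarrow> g \<in> C \<Longrightarrow> f + g \<in> C" "\<And>f g. f \<in> C \<Longrightarrow> g \<in> C \<Longrightarrow> f * g \<in> C"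
      "\<And>c. Poly_Mapping.single 0 c \<in> C"
  shows "finite U \<Longrightarrow> (\<And>u. u \<in> U \<Longrightarrow> length u = length xs) \<Longrightarrow>
      (\<And>i. i < length xs \<Longrightarrow> xs ! i \<in> p (j + i + 1) - p (j + i)) \<Longrightarrow>
      (\<Sum>u\<in>U. Poly_Mapping.single 0 (c u) * mpow xs u) \<in> p j \<Longrightarrow> u \<in> U \<Longrightarrow> c u = 0"
proof (induction xs arbitrary: U c j u)
  case Nil
  then have "U = {[]}" by auto
  then show ?case using Nil unit by auto
next
  case (Cons x xs)
  note C1 = C(3)[of 1, simplified]
  have neg: "- f \<in> p i" if "f \<in> p i" for f i
    using mul[OF that C(3), of "- 1"] by (simp add: single_uminus)
  have Cpow: "f ^ n \<in> C" if "f \<in> C" for f n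
    by (induction n) (use that C1 C(2) in auto)
  have Csum: "sum h T \<in> C" if "\<And>t. t \<in> T \<Longrightarrow> h t \<in> C" for h :: "nat list \<Rightarrow> 'v \<Rightarrow>\<^sub>0 'k" and T
    using that C(3)[of 0] C(1) by (induction T rule: infinite_finite_induct) auto
  have xC: "x \<in> p (Suc j)" "x \<notin> p j" "x \<in> C" using Cons.prems(3)[of 0] sub by auto
  have xsC: "y \<in> C" if "y \<in> set xs" for y
  proof -
    obtain i where "i < length xs" "y = xs ! i" using \<open>y \<in> set xs\<close> by (metis in_set_conv_nth)
    then show ?thesis using Cons.prems(3)[of "Suc i"] sub(2) by auto
  qed
  have Cm: "mpow ys v \<in> C" if "set ys \<subseteq> C" for ys v
    using that by (induction ys v rule: mpow.induct) (auto intro: C Cpow C1)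
  show ?case
  proof (rule ccontr)
    assume cu: "c u \<noteq> 0"
    define U' where "U' = {u \<in> U. c u \<noteq> 0}"
    have U': "finite U'" "u \<in> U'" using Cons.prems cu by (auto simp: U'_def)
    \<comment> \<open>The least exponent of \<open>x\<close> among the terms with nonzero
      coefficient; the terms attaining it form \<open>g\<close>, and the others keep a further
      factor \<open>x\<close>.\<close>
    define a where "a = Min (hd ` U')"
    have "a \<in> hd ` U'" unfolding a_def using U' by (intro Min_in) auto
    then obtain w where w: "w \<in> U'" "hd w = a" by blast
    have amin: "a \<le> hd v" if "v \<in> U'" for v unfolding a_def using U' that by auto
    have lenU: "v = hd v # tl v" "length (tl v) = length xs" if "v \<in> U'" for v
    proof -
      have "length v = Suc (length xs)" using that Cons.prems(2)[of v] by (simp add: U'_def)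
      then show "v = hd v # tl v" "length (tl v) = length xs" by (cases v; simp)+
    qed
    let ?s = "\<lambda>v. Poly_Mapping.single (0::'v) (c v)"
    define U1 where "U1 = {v \<in> U'. hd v = a}"
    define U2 where "U2 = {v \<in> U'. hd v \<noteq> a}"
    define g where "g = (\<Sum>v\<in>U1. ?s v * mpow xs (tl v))"
    define h where "h = (\<Sum>v\<in>U2. ?s v * (x ^ (hd v - Suc a) * mpow xs (tl v)))"
    have gC: "g \<in> C" and hC: "h \<in> C"
      unfolding g_def h_def using xsC xC by (auto intro!: Csum C(2) C(3) Cm Cpow)
    have "(\<Sum>v\<in>U. ?s v * mpow (x # xs) v) = (\<Sum>v\<in>U'. ?s v * mpow (x # xs) v)"
      unfolding U'_def using Cons.prems(1) by (intro sum.mono_neutral_right) auto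
    also have "\<dots> = (\<Sum>v\<in>U'. ?s v * (x ^ hd v * mpow xs (tl v)))"
    proof (rule sum.cong[OF refl])
      fix v assume "v \<in> U'"
      then obtain i t where "v = i # t" using lenU by metis
      then show "?s v * mpow (x # xs) v = ?s v * (x ^ hd v * mpow xs (tl v))" by simp
    qed
    also have "\<dots> = (\<Sum>v\<in>U1. ?s v * (x ^ hd v * mpow xs (tl v))) + (\<Sum>v\<in>U2. ?s v * (x ^ hd v * mpow xs (tl v)))"
    proof -
      have "U' = U1 \<union> U2" "U1 \<inter> U2 = {}" "finite U1" "finite U2" using U' by (auto simp: U1_def U2_def)
      then show ?thesis by (simp add: sum.union_disjoint)
    qed
    also have "(\<Sum>v\<in>U1. ?s v * (x ^ hd v * mpow xs (tl v))) = x ^ a * g"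
      unfolding g_def sum_distrib_left by (intro sum.cong) (auto simp: U1_def mult_ac)
    also have "(\<Sum>v\<in>U2. ?s v * (x ^ hd v * mpow xs (tl v))) = x ^ a * (x * h)"
      unfolding h_def sum_distrib_left
    proof (rule sum.cong[OF refl])
      fix v assume v: "v \<in> U2"
      then have "hd v = a + Suc (hd v - Suc a)" using amin[of v] by (auto simp: U2_def)
      then have "x ^ hd v = x ^ a * (x * x ^ (hd v - Suc a))" by (metis power_add power_Suc)
      then show "?s v * (x ^ hd v * mpow xs (tl v)) = x ^ a * (x * (?s v * (x ^ (hd v - Suc a) * mpow xs (tl v))))"
        by (simp add: mult_ac)
    qed
    finally have "x ^ a * (g + x * h) \<in> p j" using Cons.prems(4) by (simp add: distrib_left)
    \<comment> \<open>Powers of \<open>x\<close> cancel because \<open>x\<close> lies outside the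
      prime \<open>p j\<close>.\<close>
    moreover have "g + x * h \<in> p j" if "x ^ n * (g + x * h) \<in> p j" for n
      using that
    proof (induction n)
      case (Suc n)
      have "x * (x ^ n * (g + x * h)) \<in> p j" using Suc.prems by (simp add: mult.assoc)
      then have "x ^ n * (g + x * h) \<in> p j"
        using prime[of x "x ^ n * (g + x * h)" j] xC gC hC C Cpow by blast
      then show ?case by (rule Suc.IH)
    qed simp
    ultimately have "g + x * h \<in> p (Suc j)" using sub by blast
    moreover have "- (h * x) \<in> p (Suc j)" using mul neg hC xC by blast
    ultimately have "(g + x * h) + - (h * x) \<in> p (Suc j)" by (rule add)
    then have gp: "g \<in> p (Suc j)" by (simp add: mult.commute)
    have inj: "inj_on tl U1"
    proof (rule inj_onI)
      fix v v' assume vv: "v \<in> U1" "v' \<in> U1" "tl v = tl v'"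
      then have "v \<in> U'" "v' \<in> U'" "hd v = hd v'" by (auto simp: U1_def)
      then show "v = v'" using lenU(1)[of v] lenU(1)[of v'] vv(3) by simp
    qed
    have "g = (\<Sum>v\<in>tl ` U1. Poly_Mapping.single 0 (c (a # v)) * mpow xs v)"
      unfolding g_def sum.reindex[OF inj] o_def
    proof (rule sum.cong[OF refl])
      fix v assume "v \<in> U1"
      then have "v \<in> U'" "hd v = a" by (auto simp: U1_def)
      then have "v = a # tl v" using lenU(1) by metis
      then show "?s v * mpow xs (tl v) = Poly_Mapping.single 0 (c (a # tl v)) * mpow xs (tl v)" by simp
    qed
    with gp have gp': "(\<Sum>v\<in>tl ` U1. Poly_Mapping.single 0 (c (a # v)) * mpow xs v) \<in> p (Suc j)" by simp
    have "c (a # tl w) = 0"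
    proof (rule Cons.IH[of "tl ` U1" "Suc j" "\<lambda>v. c (a # v)"])
      show "finite (tl ` U1)" using U' by (simp add: U1_def)
      show "length v = length xs" if "v \<in> tl ` U1" for v using that lenU(2) by (auto simp: U1_def)
      show "xs ! i \<in> p (Suc j + i + 1) - p (Suc j + i)" if "i < length xs" for i
        using Cons.prems(3)[of "Suc i"] that by simp
      show "tl w \<in> tl ` U1" using w by (auto simp: U1_def)
    qed (rule gp')
    moreover have "a # tl w = w" using lenU(1) w by metis
    ultimately show False using w by (simp add: U'_def)
  qed
qed

text \<open>The box containing the exponents has a side linear in \<open>N\<close>; the count in
  \<open>algebraic_dependence\<close> rests on this.\<close>

lemma keys_mpow:
  fixes xs :: "((real ^ 'n) \<Rightarrow>\<^sub>0 'k::field) list"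
  assumes "length u = length xs" "\<And>i. i \<in> set u \<Longrightarrow> i \<le> N"
    "\<And>f k. f \<in> set xs \<Longrightarrow> k \<in> keys f \<Longrightarrow> \<forall>i. k $ i \<in> \<int> \<and> \<bar>k $ i\<bar> \<le> real B"
    "k \<in> keys (mpow xs u)"
  shows "\<forall>i. k $ i \<in> \<int> \<and> \<bar>k $ i\<bar> \<le> real (B * N * length xs)"
  using assms
proof (induction xs u arbitrary: k rule: mpow.induct)
  case (1 x xs n u)
  have pow: "\<forall>i. l $ i \<in> \<int> \<and> \<bar>l $ i\<bar> \<le> real (B * m)" if "l \<in> keys (x ^ m)" for l m
    using that
  proof (induction m arbitrary: l)
    case (Suc m)
    then obtain a b where ab: "l = a + b" "a \<in> keys x" "b \<in> keys (x ^ m)"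
      using keys_mult[of x "x ^ m"] by auto
    have a: "a $ i \<in> \<int>" "\<bar>a $ i\<bar> \<le> real B" and b: "b $ i \<in> \<int>" "\<bar>b $ i\<bar> \<le> real (B * m)" for i
      using 1(4)[of x a] Suc.IH[OF ab(3)] ab(2) by auto
    show ?case
    proof
      fix i
      have "\<bar>l $ i\<bar> \<le> \<bar>a $ i\<bar> + \<bar>b $ i\<bar>" using ab(1) by (simp add: abs_triangle_ineq)
      also have "\<dots> \<le> real B + real (B * m)" using a b by (intro add_mono)
      finally have "\<bar>l $ i\<bar> \<le> real (B * Suc m)" by simp
      moreover have "l $ i \<in> \<int>" unfolding ab(1) vector_add_component using a(1) b(1) by (rule Ints_add)
      ultimately show "l $ i \<in> \<int> \<and> \<bar>l $ i\<bar> \<le> real (B * Suc m)" by blast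
    qed
  qed (simp add: zero_vec_def)
  obtain a b where ab: "k = a + b" "a \<in> keys (x ^ n)" "b \<in> keys (mpow xs u)"
    using 1(5) keys_mult[of "x ^ n" "mpow xs u"] by auto
  have IH: "b $ i \<in> \<int>" "\<bar>b $ i\<bar> \<le> real (B * N * length xs)" for i
    using 1(1)[OF _ _ _ ab(3)] 1(2-4) by auto
  have "a $ i \<in> \<int>" "\<bar>a $ i\<bar> \<le> real (B * n)" for i using pow[OF ab(2)] by auto
  moreover have "real (B * n) \<le> real (B * N)" using 1(3)[of n] by (intro of_nat_mono) simp
  ultimately have a: "a $ i \<in> \<int>" "\<bar>a $ i\<bar> \<le> real (B * N)" for i
    by (blast, blast intro: order_trans)
  show ?case
  proof
    fix i
    have "\<bar>k $ i\<bar> \<le> \<bar>a $ i\<bar> + \<bar>b $ i\<bar>" using ab(1) by (simp add: abs_triangle_ineq)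
    also have "\<dots> \<le> real (B * N) + real (B * N * length xs)" using a IH by (intro add_mono)
    finally have "\<bar>k $ i\<bar> \<le> real (B * N * length (x # xs))" by (simp add: algebra_simps)
    moreover have "k $ i \<in> \<int>" unfolding ab(1) vector_add_component using a(1) IH(1) by (rule Ints_add)
    ultimately show "k $ i \<in> \<int> \<and> \<bar>k $ i\<bar> \<le> real (B * N * length (x # xs))" by blast
  qed
qed (auto simp: zero_vec_def)

text \<open>There are \<open>N ^ (CARD('n) + 1)\<close> monomials with exponents below
  \<open>N\<close> in these elements, but they are supported in a lattice box with only
  \<open>O(N ^ CARD('n))\<close> points. For large \<open>N\<close> they are linearly
  dependent.\<close>

lemma algebraic_dependence:
  fixes xs :: "((real ^ 'n) \<Rightarrow>\<^sub>0 'k::field) list"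
  assumes len: "length xs = Suc CARD('n)"
    and int: "\<And>f k i. f \<in> set xs \<Longrightarrow> k \<in> keys f \<Longrightarrow> k $ i \<in> \<int>"
  shows "\<exists>U c. finite U \<and> (\<forall>u\<in>U. length u = length xs) \<and> (\<exists>u\<in>U. c u \<noteq> 0) \<and>
    (\<Sum>u\<in>U. Poly_Mapping.single 0 (c u) * mpow xs u) = 0"
proof -
  let ?K = "\<Union>f\<in>set xs. keys f"
  obtain B0 where B0: "\<And>k. k \<in> ?K \<Longrightarrow> norm k \<le> B0"
    using finite_imp_bounded[of ?K] unfolding bounded_iff by auto
  define B where "B = nat \<lceil>\<bar>B0\<bar>\<rceil>"
  have B: "\<forall>i. k $ i \<in> \<int> \<and> \<bar>k $ i\<bar> \<le> real B" if "f \<in> set xs" "k \<in> keys f" for f k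
  proof
    fix i
    have "\<bar>k $ i\<bar> \<le> norm k" by (rule component_le_norm_cart)
    also have "\<dots> \<le> B0" using B0 that by blast
    also have "\<dots> \<le> real B" unfolding B_def by linarith
    finally show "k $ i \<in> \<int> \<and> \<bar>k $ i\<bar> \<le> real B" using int that by blast
  qed
  let ?d = "CARD('n)"
  \<comment> \<open>Chosen so that \<open>N * Q\<close> bounds the number of integers along a side
    of the box, for every positive \<open>N\<close>.\<close>
  define Q where "Q = 2 * B * Suc ?d + 1"
  \<comment> \<open>Larger than \<open>Q ^ ?d\<close>, whence
    \<open>(N * Q) ^ ?d < N ^ Suc ?d\<close>.\<close>
  define N where "N = Suc (Q ^ ?d)"
  define U where "U = {u. set u \<subseteq> {..<N} \<and> length u = Suc ?d}"
  define X where "X = {x :: real ^ 'n. \<forall>i. x $ i \<in> \<int> \<and> \<bar>x $ i\<bar> \<le> real (B * N * Suc ?d)}"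
  have finU: "finite U" unfolding U_def by (intro finite_lists_length_eq) simp
  have cardU: "card U = N ^ Suc ?d" unfolding U_def by (subst card_lists_length_eq) auto
  have "card X \<le> (2 * (B * N * Suc ?d) + 1) ^ ?d" unfolding X_def by (rule card_integral_points_le)
  also have "\<dots> \<le> (N * Q) ^ ?d"
    by (intro power_mono) (simp_all add: Q_def N_def algebra_simps)
  also have "\<dots> = N ^ ?d * Q ^ ?d" by (simp add: power_mult_distrib)
  also have "\<dots> < N ^ ?d * N" by (intro mult_strict_left_mono) (simp_all add: N_def)
  also have "\<dots> = card U" using cardU by simp
  finally have "card X < card U" .
  moreover have "keys (mpow xs u) \<subseteq> X" if "u \<in> U" for u
  proof
    fix k assume "k \<in> keys (mpow xs u)"
    then have "\<forall>i. k $ i \<in> \<int> \<and> \<bar>k $ i\<bar> \<le> real (B * N * length xs)"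
      using keys_mpow[of u xs N B k] B that len by (force simp: U_def)
    then show "k \<in> X" by (simp add: X_def len)
  qed
  moreover have "finite X" unfolding X_def by (rule finite_integral_points)
  ultimately obtain c where "\<exists>u\<in>U. c u \<noteq> 0" "(\<Sum>u\<in>U. Poly_Mapping.single 0 (c u) * mpow xs u) = 0"
    using linear_dependence[of X U "mpow xs"] finU by blast
  then show ?thesis using finU len by (intro exI[of _ U] exI[of _ c]) (auto simp: U_def)
qed

section \<open>Faces of the cone\<close>

context pointed_cone
begin

text \<open>The face property is applied to segments: \<open>x\<close> is interior to the segment
  from \<open>0\<close> to a larger multiple of \<open>x\<close>, and half of \<open>x + y\<close>
  is the midpoint of \<open>x\<close> and \<open>y\<close>.\<close>

lemma face_cone:
  assumes F: "F face_of \<sigma>" "0 \<in> F"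
  shows "x \<in> F \<Longrightarrow> 0 \<le> c \<Longrightarrow> c *\<^sub>R x \<in> F"
    and "x \<in> F \<Longrightarrow> y \<in> F \<Longrightarrow> x + y \<in> F"
    and "x \<in> \<sigma> \<Longrightarrow> y \<in> \<sigma> \<Longrightarrow> x + y \<in> F \<Longrightarrow> x \<in> F"
proof -
  have FS: "F \<subseteq> \<sigma>" and Fc: "convex F" using F by (auto simp: face_of_def)
  have scale: "c *\<^sub>R x \<in> F" if x: "x \<in> F" and c: "0 \<le> c" for x c
  proof (cases "c \<le> 1")
    case True
    then have "(1 - c) *\<^sub>R 0 + c *\<^sub>R x \<in> F" using Fc F(2) x c by (intro convexD_alt) auto
    then show ?thesis by simp
  next
    case False
    show ?thesis
    proof (cases "x = 0")
      case False
      have "x = (1 - 1 / c) *\<^sub>R 0 + (1 / c) *\<^sub>R (c *\<^sub>R x)" using \<open>\<not> c \<le> 1\<close> by simp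
      moreover have "0 \<noteq> c *\<^sub>R x" using False \<open>\<not> c \<le> 1\<close> by simp
      ultimately have "x \<in> open_segment 0 (c *\<^sub>R x)"
        unfolding in_segment using \<open>\<not> c \<le> 1\<close> by (intro conjI exI[of _ "1 / c"]) auto
      moreover have "c *\<^sub>R x \<in> \<sigma>" using x FS c sigma_scale by blast
      ultimately show ?thesis using face_ofD[OF F(1)] sigma_zero x by blast
    qed (use F in simp)
  qed
  show "x \<in> F \<Longrightarrow> 0 \<le> c \<Longrightarrow> c *\<^sub>R x \<in> F" by (rule scale)
  show "x + y \<in> F" if "x \<in> F" "y \<in> F"
  proof -
    have "(1 - 1/2) *\<^sub>R x + (1/2) *\<^sub>R y \<in> F" using Fc that by (intro convexD_alt) auto
    then have "2 *\<^sub>R ((1 - 1/2) *\<^sub>R x + (1/2) *\<^sub>R y) \<in> F" by (intro scale) auto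
    moreover have "2 *\<^sub>R ((1 - 1/2) *\<^sub>R x + (1/2) *\<^sub>R y) = x + y" by (simp add: scaleR_right_distrib)
    ultimately show ?thesis by simp
  qed
  show "x \<in> F" if "x \<in> \<sigma>" "y \<in> \<sigma>" "x + y \<in> F"
  proof (cases "x = y")
    case True
    have "(1/2) *\<^sub>R (x + y) \<in> F" using that by (intro scale) auto
    moreover have "(1/2) *\<^sub>R (x + y) = x" using True by (simp add: scaleR_2[symmetric])
    ultimately show ?thesis by simp
  next
    case False
    have "(1/2) *\<^sub>R (x + y) \<in> F" using that by (intro scale) auto
    moreover have "(1/2) *\<^sub>R (x + y) \<in> open_segment x y"
      unfolding in_segment using False by (intro conjI exI[of _ "1/2"]) (auto simp: scaleR_right_distrib)
    ultimately show ?thesis using face_ofD[OF F(1)] that by blast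
  qed
qed

lemma zero_face: "{0} face_of \<sigma>"
  unfolding face_of_def
proof (intro conjI ballI impI)
  fix a b x assume ab: "a \<in> \<sigma>" "b \<in> \<sigma>" and x: "x \<in> {0}" "x \<in> open_segment a b"
  then obtain u where u: "0 < u" "u < 1" "0 = (1 - u) *\<^sub>R a + u *\<^sub>R b" by (auto simp: in_segment)
  have m: "(1 - u) *\<^sub>R a \<in> \<sigma>" "u *\<^sub>R b \<in> \<sigma>" using ab u by (auto intro: sigma_scale)
  have "- ((1 - u) *\<^sub>R a) = u *\<^sub>R b" using u(3) by (metis add_eq_0_iff)
  then have "(1 - u) *\<^sub>R a = 0" using sigma_no_line m by metis
  then have "a = 0" using u by simp
  then show "a \<in> {0}" "b \<in> {0}" using u by auto
qed auto

text \<open>Expand \<open>x\<close> in the lattice generators of the cone. All summands lie in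
  \<open>F\<close> by \<open>face_cone\<close>; if every lattice point of \<open>F\<close> were in
  \<open>G\<close>, then so would be \<open>x\<close>.\<close>

lemma face_lattice_point:
  assumes "F face_of \<sigma>" "0 \<in> F" "G face_of \<sigma>" "0 \<in> G" "x \<in> F" "x \<notin> G"
  shows "\<exists>q\<in>S. q \<in> F \<and> q \<notin> G"
proof (rule ccontr)
  assume no: "\<not> ?thesis"
  have "x \<in> convex_cone hull W" using assms(1,5) sigma_W by (auto simp: face_of_def)
  then obtain c where c: "x = (\<Sum>w\<in>W. c w *\<^sub>R w)" "\<forall>w\<in>W. 0 \<le> c w"
    unfolding convex_cone_hull_finite[OF finite_W] by blast
  have part: "c w *\<^sub>R w \<in> F" if "w \<in> W" for w
  proof -
    have "x = c w *\<^sub>R w + (\<Sum>w\<in>W - {w}. c w *\<^sub>R w)"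
      unfolding c(1) using finite_W that by (rule sum.remove)
    moreover have "(\<Sum>w\<in>W - {w}. c w *\<^sub>R w) \<in> convex_cone hull W"
    proof -
      have "(\<Sum>w\<in>W - {w}. c w *\<^sub>R w) = (\<Sum>v\<in>W. (if v = w then 0 else c v) *\<^sub>R v)"
        using finite_W by (intro sum.mono_neutral_cong_left) auto
      then show ?thesis unfolding convex_cone_hull_finite[OF finite_W]
        using c(2) by (intro CollectI exI[of _ "\<lambda>v. if v = w then 0 else c v"]) auto
    qed
    ultimately show ?thesis
      using face_cone(3)[OF assms(1,2)] assms(5) sigma_W c(2) that W_S S_sigma sigma_scale
      by (metis subsetD)
  qed
  have "c w *\<^sub>R w \<in> G" if "w \<in> W" for w
  proof (cases "c w = 0")
    case False
    then have "w \<in> F" using face_cone(1)[OF assms(1,2) part[OF that], of "1 / c w"] c(2) that by simp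
    then have "w \<in> G" using no W_S that by blast
    then show ?thesis using face_cone(1)[OF assms(3,4)] c(2) that by blast
  qed (use assms(4) in simp)
  note inG = this
  have "(\<Sum>w\<in>V. c w *\<^sub>R w) \<in> G" if "V \<subseteq> W" for V
    using finite_subset[OF that finite_W] that
  proof (induction V rule: finite_induct)
    case (insert v V)
    then have "c v *\<^sub>R v \<in> G" "(\<Sum>w\<in>V. c w *\<^sub>R w) \<in> G" using inG by auto
    then show ?case using insert.hyps face_cone(2)[OF assms(3,4)] by simp
  qed (use assms(4) in simp)
  then show False using assms(6) c(1) by blast
qed

text \<open>In positive dimension \<open>{0}\<close> is a proper face, so it lies in a facet, and
  passing to a facet lowers the dimension by exactly one.\<close>

lemma face_chain:
  assumes "F face_of \<sigma>" "0 \<in> F" "aff_dim F = int k"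
  shows "\<exists>G. G k = F \<and> (\<forall>i\<le>k. G i face_of \<sigma> \<and> 0 \<in> G i) \<and> (\<forall>i<k. G i \<subset> G (Suc i))"
  using assms
proof (induction k arbitrary: F)
  case 0
  then show ?case by (intro exI[of _ "\<lambda>i. F"]) auto
next
  case (Suc k)
  have P: "polyhedron F" using face_of_polyhedron_polyhedron[OF polyhedron_sigma Suc.prems(1)] .
  have "{0} face_of F"
    by (rule face_of_subset[OF zero_face _ face_of_imp_subset[OF Suc.prems(1)]]) (use Suc.prems(2) in simp)
  moreover have "{0} \<noteq> F"
  proof
    assume eq: "{0} = F"
    have "aff_dim {0 :: real ^ 'd} = 0" by (rule aff_dim_sing)
    then show False using Suc.prems(3) eq by simp
  qed
  ultimately obtain F' where F': "F' facet_of F" "{0} \<subseteq> F'"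
    using face_of_polyhedron_subset_facet[OF P] by blast
  have f: "F' face_of \<sigma>" using F' Suc.prems(1) facet_of_imp_face_of face_of_trans by blast
  have d: "aff_dim F' = int k" using F' Suc.prems(3) by (simp add: facet_of_def)
  obtain G where G: "G k = F'" "\<forall>i\<le>k. G i face_of \<sigma> \<and> 0 \<in> G i" "\<forall>i<k. G i \<subset> G (Suc i)"
    using Suc.IH[OF f _ d] F'(2) by auto
  have "F' \<noteq> F" using d Suc.prems(3) by auto
  then have sub: "F' \<subset> F" using facet_of_imp_subset[OF F'(1)] by blast
  let ?G = "\<lambda>i. if i = Suc k then F else G i"
  have "?G i face_of \<sigma> \<and> 0 \<in> ?G i" if "i \<le> Suc k" for i
    using that Suc.prems(1,2) G(2) by (cases "i = Suc k") auto
  moreover have "?G i \<subset> ?G (Suc i)" if "i < Suc k" for i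
    using that G(1,3) sub by (cases "i = k") auto
  ultimately show ?case by (intro exI[of _ ?G]) simp
qed

end

section \<open>Primes of \<open>A\<close> from faces, and the dimension of \<open>A\<close>\<close>

context cone_ring
begin

text \<open>A sum of exponents lies in \<open>F\<close> exactly if all summands do. If both
  numerators have exponents in \<open>F\<close>, an extremal pair of those produces a term of the
  product in \<open>F\<close> that cannot cancel.\<close>

lemma primeideal_face:
  assumes F: "F face_of \<sigma>" "0 \<in> F"
  shows "primeideal (ext (S - F)) A"
proof -
  have sid: "sideal (S - F)"
    unfolding sideal_def using face_cone(3)[OF F] S_add S_sigma by blast
  show ?thesis
  proof (rule primeidealI[OF ideal_ext[OF sid] A.is_cring])
    have "fr 1 1 \<notin> ext (S - F)"
      using fr_in_ext[OF sid, of 1 1] F(2) by (auto simp: mon_one) (auto simp: mon_def)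
    then show "carrier A \<noteq> ext (S - F)" using fr_carrier[of 1 1] by (auto simp: mon_one)
    fix x y assume x: "x \<in> carrier A" and y: "y \<in> carrier A" and xy: "x \<otimes>\<^bsub>A\<^esub> y \<in> ext (S - F)"
    obtain a s where a: "x = fr a s" "a \<in> mon S" "s \<in> D" using x by (blast elim: carrier_AE)
    obtain b t where b: "y = fr b t" "b \<in> mon S" "t \<in> D" using y by (blast elim: carrier_AE)
    have ab: "a * b \<in> mon (S - F)"
      using xy a b fr_in_ext[OF sid mon_S_mult'[OF a(2) b(2)] D_mult[OF a(3) b(3)]] by (simp add: A_mult)
    have "a \<in> mon (S - F) \<or> b \<in> mon (S - F)"
    proof (rule ccontr)
      assume "\<not> ?thesis"
      then have ne: "keys a \<inter> F \<noteq> {}" "keys b \<inter> F \<noteq> {}" using a b by (auto simp: mon_def)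
      obtain p q where pq: "p \<in> keys a \<inter> F" "q \<in> keys b \<inter> F"
        "\<And>l m. l \<in> keys a \<inter> F \<Longrightarrow> m \<in> keys b \<inter> F \<Longrightarrow> l + m = p + q \<Longrightarrow> l = p \<and> m = q"
        using extremal_pair[of "keys a \<inter> F" "keys b \<inter> F"] ne by auto
      have pqF: "p + q \<in> F" using face_cone(2)[OF F] pq by blast
      have "lookup (a * b) (p + q) = lookup a p * lookup b q"
      proof (rule lookup_mult_unique)
        fix l m assume lm: "l \<in> keys a" "m \<in> keys b" "l + m = p + q"
        then have "l \<in> \<sigma>" "m \<in> \<sigma>" using a b S_sigma by (auto simp: mon_def)
        then have "l \<in> F" "m \<in> F" using face_cone(3)[OF F, of l m] face_cone(3)[OF F, of m l] pqF lm(3)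
          by (auto simp: add.commute)
        then show "l = p \<and> m = q" using pq(3) lm by blast
      qed
      then have "p + q \<in> keys (a * b)" using pq by (simp add: in_keys_iff)
      then show False using ab pqF by (auto simp: mon_def)
    qed
    then show "x \<in> ext (S - F) \<or> y \<in> ext (S - F)" using a b by (auto simp: ext_def)
  qed
qed

text \<open>From above, a longer chain of primes would contain \<open>CARD('d) + 1\<close>
  algebraically independent elements of the semigroup ring. From below, faces of all dimensions give
  a chain of primes.\<close>

lemma krull_dim_A: "krull_dim A = enat CARD('d)"
proof (rule antisym)
  show "krull_dim A \<le> enat CARD('d)"
    unfolding krull_dim_def
  proof (rule Sup_least, clarify)
    fix n P
    assume P: "\<forall>i\<le>n. primeideal (P i) A" "\<forall>i<n. P i \<subset> P (Suc i)"
    show "enat n \<le> enat CARD('d)"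
    proof (rule ccontr)
      assume "\<not> enat n \<le> enat CARD('d)"
      then have nd: "Suc CARD('d) \<le> n" by simp
      \<comment> \<open>Contractions to the semigroup ring; \<open>min i n\<close> prolongs the
        finite chain to all indices, as \<open>prime_chain_independent\<close> expects.\<close>
      define p where "p i = {f \<in> mon S. fr f 1 \<in> P (min i n)}" for i
      have I: "ideal (P (min i n)) A" and Pr: "primeideal (P (min i n)) A" for i
        using P(1)[rule_format, of "min i n"] primeideal.axioms(1) by auto
      \<comment> \<open>Denominators are units, so a witness of strict inclusion in \<open>A\<close>
        may be replaced by its numerator.\<close>
      have "\<exists>f. f \<in> p (Suc i) - p i" if i: "i < n" for i
      proof -
        obtain x where x: "x \<in> P (Suc i)" "x \<notin> P i" using P(2) i by blast
        have "x \<in> carrier A" using x(1) I[of "Suc i"] i by (simp add: ideal.Icarr min_def)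
        then obtain a s where as: "x = fr a s" "a \<in> mon S" "s \<in> D" by (blast elim: carrier_AE)
        have 1: "fr s 1 \<otimes>\<^bsub>A\<^esub> x = fr a 1"
          using as D_S by (simp add: A_mult fr_eq_iff mon_S_mult' mult.commute)
        have "fr a 1 \<in> P (Suc i)"
          unfolding 1[symmetric] using x(1) I[of "Suc i"] i as D_S
          by (intro ideal.I_l_closed) (auto simp: min_def)
        moreover have "fr a 1 \<notin> P i"
        proof
          assume "fr a 1 \<in> P i"
          then have "fr 1 s \<otimes>\<^bsub>A\<^esub> fr a 1 \<in> P i"
            using I[of i] i as by (intro ideal.I_l_closed) (auto simp: min_def mon_one)
          then show False using x as by (simp add: A_mult mon_one)
        qed
        ultimately show ?thesis using as i by (auto simp: p_def min_def)
      qed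
      then obtain x where x: "\<And>i. i < n \<Longrightarrow> x i \<in> p (Suc i) - p i" by metis
      define xs where "xs = map x [0..<Suc CARD('d)]"
      have len: "length xs = Suc CARD('d)" by (simp add: xs_def)
      have xi: "xs ! i \<in> p (0 + i + 1) - p (0 + i)" if "i < length xs" for i
        using x[of i] that nd len unfolding xs_def by (simp del: upt_Suc)
      have "k $ i \<in> \<int>" if "f \<in> set xs" "k \<in> keys f" for f k i
      proof -
        obtain j where j: "j < length xs" "f = xs ! j" using \<open>f \<in> set xs\<close> by (metis in_set_conv_nth)
        then have "f \<in> mon S" using xi[of j] by (simp add: p_def)
        then show ?thesis using that by (auto simp: mon_def lattice_points_def)
      qed
      then obtain U c where U: "finite U" "\<forall>u\<in>U. length u = length xs" "\<exists>u\<in>U. c u \<noteq> 0"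
        "(\<Sum>u\<in>U. Poly_Mapping.single 0 (c u) * mpow xs u) = 0"
        using algebraic_dependence[OF len] by blast
      have "c u = 0" if u: "u \<in> U" for u
      proof (rule prime_chain_independent[where p = p and C = "mon S" and U = U and xs = xs and j = 0 and u = u])
        show "f + g \<in> p i" if "f \<in> p i" "g \<in> p i" for i f g
        proof -
          have fg: "f \<in> mon S" "g \<in> mon S" using that by (auto simp: p_def)
          have "fr f 1 \<oplus>\<^bsub>A\<^esub> fr g 1 \<in> P (min i n)"
            using that I[of i] by (auto simp: p_def intro: additive_subgroup.a_closed ideal.axioms(1))
          then show ?thesis using fg by (simp add: A_add p_def mon_add)
        qed
        show "g * f \<in> p i" if "f \<in> p i" "g \<in> mon S" for i f g
        proof -
          have f: "f \<in> mon S" using that by (auto simp: p_def)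
          have "fr g 1 \<otimes>\<^bsub>A\<^esub> fr f 1 \<in> P (min i n)"
            using that I[of i] by (intro ideal.I_l_closed) (auto simp: p_def)
          then show ?thesis using f that by (simp add: A_mult p_def mon_S_mult')
        qed
        show "f \<in> p i \<or> g \<in> p i" if "f \<in> mon S" "g \<in> mon S" "f * g \<in> p i" for i f g
        proof -
          have "fr f 1 \<otimes>\<^bsub>A\<^esub> fr g 1 \<in> P (min i n)" using that by (simp add: A_mult p_def)
          then have "fr f 1 \<in> P (min i n) \<or> fr g 1 \<in> P (min i n)"
            using that by (intro primeideal.I_prime[OF Pr]) auto
          then show ?thesis using that by (auto simp: p_def)
        qed
        show "Poly_Mapping.single 0 c \<notin> p i" if "c \<noteq> 0" for i and c :: 'k
        proof
          assume "Poly_Mapping.single 0 c \<in> p i"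
          then have "fr (Poly_Mapping.single 0 (1 / c)) 1 \<otimes>\<^bsub>A\<^esub> fr (Poly_Mapping.single 0 c) 1 \<in> P (min i n)"
            using I[of i] by (intro ideal.I_l_closed) (auto simp: p_def intro!: fr_carrier mon_single)
          then have "\<one>\<^bsub>A\<^esub> \<in> P (min i n)" using that by (simp add: A_mult mon_single mult_single A_one)
          then show False
            using ideal.one_imp_carrier[OF I] primeideal.I_notcarr[OF Pr] by blast
        qed
        show "p i \<subseteq> p (Suc i)" for i
        proof (cases "i < n")
          case True
          then have "P (min i n) \<subseteq> P (min (Suc i) n)" using P(2) by (auto simp: min_def)
          then show ?thesis unfolding p_def by blast
        qed (auto simp: p_def min_def)
        show "p i \<subseteq> mon S" for i by (auto simp: p_def)
        show "0 \<in> p i" for i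
          using additive_subgroup.zero_closed[OF ideal.axioms(1)[OF I[of i]]] by (simp add: p_def A_zero)
        show "f + g \<in> mon S" "f * g \<in> mon S" if "f \<in> mon S" "g \<in> mon S" for f g :: "_ \<Rightarrow>\<^sub>0 'k"
          using that by (auto intro: mon_add mon_S_mult')
        show "(\<Sum>u\<in>U. Poly_Mapping.single 0 (c u) * mpow xs u) \<in> p 0"
          unfolding U(4) using additive_subgroup.zero_closed[OF ideal.axioms(1)[OF I[of 0]]] by (simp add: p_def A_zero)
      qed (use U u xi in \<open>auto intro: mon_single\<close>)
      then show False using U(3) by blast
    qed
  qed
  show "enat CARD('d) \<le> krull_dim A"
  proof -
    let ?d = "CARD('d)"
    have "\<sigma> face_of \<sigma>" using face_of_refl[OF sigma_convex] .
    then obtain G where G: "G ?d = \<sigma>" "\<forall>i\<le>?d. G i face_of \<sigma> \<and> 0 \<in> G i" "\<forall>i<?d. G i \<subset> G (Suc i)"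
      using face_chain[OF _ sigma_zero full] by blast
    \<comment> \<open>Larger faces give smaller primes, so the chain of faces is run
      backwards.\<close>
    define P where "P i = ext (S - G (?d - i))" for i
    have 1: "\<forall>i\<le>?d. primeideal (P i) A" unfolding P_def using G(2) primeideal_face by simp
    have 2: "P i \<subset> P (Suc i)" if "i < ?d" for i
    proof -
      let ?j = "?d - Suc i"
      have j: "?d - i = Suc ?j" "?j < ?d" using that by auto
      have f: "G ?j face_of \<sigma>" "0 \<in> G ?j" "G (Suc ?j) face_of \<sigma>" "0 \<in> G (Suc ?j)"
        using G(2)[rule_format, of ?j] G(2)[rule_format, of "Suc ?j"] j(2) by auto
      have sub: "G ?j \<subset> G (Suc ?j)" using G(3) j(2) by blast
      have sid: "sideal (S - H)" if "H face_of \<sigma>" "0 \<in> H" for H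
        unfolding sideal_def using face_cone(3)[OF that] S_add S_sigma by blast
      have "ext (S - G (Suc ?j)) \<subseteq> ext (S - G ?j)"
        unfolding ext_def using mon_mono[of "S - G (Suc ?j)" "S - G ?j"] sub by blast
      moreover have "ext (S - G (Suc ?j)) \<noteq> ext (S - G ?j)"
      proof
        assume eq: "ext (S - G (Suc ?j)) = ext (S - G ?j)"
        have "S - G (Suc ?j) = S - G ?j" by (rule ext_inj[OF sid[OF f(3,4)] sid[OF f(1,2)] eq])
        moreover obtain x where "x \<in> G (Suc ?j)" "x \<notin> G ?j" using sub by blast
        ultimately show False using face_lattice_point[OF f(3,4,1,2)] by blast
      qed
      ultimately show ?thesis unfolding P_def j(1) by blast
    qed
    show ?thesis unfolding krull_dim_def
      by (rule Sup_upper) (use 1 2 in blast)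
  qed
qed

end

section \<open>Length of the torsion in an associated graded piece\<close>

context pointed_cone
begin

declare pw.simps(2) [simp del]

text \<open>The exponents of the monomials of \<open>I\<^sup>n\<close> whose class in \<open>I\<^sup>n / I\<^sup>n\<^sup>+\<^sup>1\<close> is killed by a power
  of the maximal ideal; \<open>E\<close> is the exponent set of \<open>I\<close>.\<close>

definition tors where
  "tors E n = {q \<in> pw E n. \<exists>t. \<forall>s\<in>pw (S - {0}) t. q + s \<in> pw E (Suc n)}"

lemma sideal_pw_nonzero: "sideal (pw (S - {0}) t)"
  by (rule sideal_pw) auto

lemma pw_Suc_subset:
  assumes "sideal E"
  shows "pw E (Suc n) \<subseteq> pw E n"
proof
  fix x assume "x \<in> pw E (Suc n)"
  then obtain a b where ab: "x = a + b" "a \<in> pw E n" "b \<in> E" unfolding pw.simps by blast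
  have "sideal (pw E n)" using assms by (intro sideal_pw) (simp add: sideal_def)
  then show "x \<in> pw E n" using ab sidealD sideal_S[OF assms] by blast
qed

lemma pw_antimono:
  assumes "sideal E" "m \<le> n"
  shows "pw E n \<subseteq> pw E m"
  using assms(2) by (induction rule: dec_induct) (use pw_Suc_subset[OF assms(1)] in blast)+

lemma sideal_tors:
  assumes "sideal E"
  shows "sideal (tors E n)"
  unfolding sideal_def
proof (intro conjI ballI subsetI)
  have ES: "E \<subseteq> S" using assms by (simp add: sideal_def)
  note p = sideal_pw[OF ES]
  fix q assume q: "q \<in> tors E n"
  then obtain t where t: "q \<in> pw E n" "\<And>s. s \<in> pw (S - {0}) t \<Longrightarrow> q + s \<in> pw E (Suc n)"
    unfolding tors_def by blast
  show "q \<in> S" using t(1) sideal_S[OF p] by blast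
  fix r assume r: "r \<in> S"
  have "q + r \<in> pw E n" using sidealD[OF p t(1) r] .
  moreover have "q + r + s \<in> pw E (Suc n)" if "s \<in> pw (S - {0}) t" for s
  proof -
    have "q + s + r \<in> pw E (Suc n)" using sidealD[OF p t(2)[OF that] r] .
    then show ?thesis by (simp add: add_ac)
  qed
  ultimately show "q + r \<in> tors E n" unfolding tors_def by blast
qed

lemma pw_subset_tors:
  assumes "sideal E"
  shows "pw E (Suc n) \<subseteq> tors E n"
proof
  fix q assume q: "q \<in> pw E (Suc n)"
  have "sideal (pw E (Suc n))" using assms by (intro sideal_pw) (simp add: sideal_def)
  then have "\<forall>s\<in>pw (S - {0}) 0. q + s \<in> pw E (Suc n)" using q sidealD[of "pw E (Suc n)" q] by (simp only: pw.simps(1)) blast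
  then show "q \<in> tors E n" using q pw_Suc_subset[OF assms] unfolding tors_def by blast
qed

end

section \<open>Submodules of the torsion module of one graded piece\<close>

locale graded_step = cone_ring \<sigma> field_type for \<sigma> :: "(real ^ 'd) set" and field_type :: "'k::field itself" +
  fixes E :: "(real ^ 'd) set" and n :: nat
  assumes E: "sideal E"
begin

lemma sid_J: "sideal (pw E n)" and sid_K: "sideal (pw E (Suc n))" and sid_T: "sideal (tors E n)"
  using E sideal_pw[of E] sideal_tors[OF E] by (auto simp: sideal_def)

abbreviation J where "J \<equiv> ext (pw E n)"
abbreviation K where "K \<equiv> ext (pw E (Suc n))"
abbreviation Q where "Q \<equiv> quotient_module (ideal_module A J) K"
abbreviation H where "H \<equiv> H0 A (local_max_ideal A) Q"
definition T where "T = tors E n - pw E (Suc n)"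
definition cs where "cs x = K +>\<^bsub>A\<^esub> x"

sublocale K: ideal K A
  by (rule ideal_ext[OF sid_K])

lemma ext_mono: "E1 \<subseteq> E2 \<Longrightarrow> ext E1 \<subseteq> ext E2"
  unfolding ext_def using mon_mono by blast

lemma cs_eq_iff:
  assumes "x \<in> carrier A" "y \<in> carrier A"
  shows "cs x = cs y \<longleftrightarrow> x \<ominus>\<^bsub>A\<^esub> y \<in> K"
proof
  assume "cs x = cs y"
  then have "x \<in> K +>\<^bsub>A\<^esub> y" using K.a_rcos_self[OF assms(1)] by (simp add: cs_def)
  then show "x \<ominus>\<^bsub>A\<^esub> y \<in> K" using K.a_rcos_module[OF assms(2,1)] by (simp add: a_minus_def)
next
  assume "x \<ominus>\<^bsub>A\<^esub> y \<in> K"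
  then have "x \<in> K +>\<^bsub>A\<^esub> y" using K.a_rcos_module[OF assms(2,1)] by (simp add: a_minus_def)
  then show "cs x = cs y"
    unfolding cs_def using A.a_repr_independence[OF _ assms(2) K.a_subgroup] by simp
qed

lemma cs_zero_iff:
  assumes "x \<in> carrier A"
  shows "cs x = K \<longleftrightarrow> x \<in> K"
proof -
  have "cs \<zero>\<^bsub>A\<^esub> = K" unfolding cs_def by (rule K.a_rcos_const[OF K.zero_closed])
  then have "cs x = K \<longleftrightarrow> x \<ominus>\<^bsub>A\<^esub> \<zero>\<^bsub>A\<^esub> \<in> K" using cs_eq_iff[OF assms A.zero_closed] by simp
  also have "x \<ominus>\<^bsub>A\<^esub> \<zero>\<^bsub>A\<^esub> = x" using assms by (simp add: a_minus_def)
  finally show ?thesis .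
qed

lemma carrier_Q: "carrier Q = cs ` J"
  unfolding quotient_module_def ideal_module_def A_RCOSETS_def RCOSETS_def cs_def a_r_coset_def r_coset_def
  by auto

lemma Q_zero: "\<zero>\<^bsub>Q\<^esub> = K"
  by (simp add: quotient_module_def)

lemma Q_add:
  assumes "x \<in> carrier A" "y \<in> carrier A"
  shows "cs x \<oplus>\<^bsub>Q\<^esub> cs y = cs (x \<oplus>\<^bsub>A\<^esub> y)"
proof -
  have "cs x \<oplus>\<^bsub>Q\<^esub> cs y = cs x <+>\<^bsub>A\<^esub> cs y"
    by (simp add: quotient_module_def set_add_def set_mult_def ideal_module_def)
  then show ?thesis using K.a_rcos_sum[OF assms] by (simp add: cs_def)
qed

text \<open>Scalar multiplication in the quotient is a union over representatives; two of them
  differ by an element of the ideal \<open>K\<close>, and this persists after multiplication by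
  \<open>a\<close>.\<close>

lemma Q_smult:
  assumes "a \<in> carrier A" "x \<in> carrier A"
  shows "a \<odot>\<^bsub>Q\<^esub> cs x = cs (a \<otimes>\<^bsub>A\<^esub> x)"
proof -
  have 1: "a \<odot>\<^bsub>Q\<^esub> cs x = (\<Union>y\<in>cs x. cs (a \<otimes>\<^bsub>A\<^esub> y))"
    by (simp add: quotient_module_def ideal_module_def cs_def a_r_coset_def r_coset_def)
  have 2: "cs (a \<otimes>\<^bsub>A\<^esub> y) = cs (a \<otimes>\<^bsub>A\<^esub> x)" if y: "y \<in> cs x" for y
  proof -
    have yA: "y \<in> carrier A"
      using y K.a_rcosets_carrier assms(2) A.a_r_coset_subset_G[OF K.a_subset assms(2)] by (auto simp: cs_def)
    have "y \<oplus>\<^bsub>A\<^esub> \<ominus>\<^bsub>A\<^esub> x \<in> K" using y K.a_rcos_module[OF assms(2) yA] by (simp add: cs_def)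
    then have "a \<otimes>\<^bsub>A\<^esub> (y \<oplus>\<^bsub>A\<^esub> \<ominus>\<^bsub>A\<^esub> x) \<in> K" using assms(1) by (rule K.I_l_closed)
    moreover have "a \<otimes>\<^bsub>A\<^esub> (y \<oplus>\<^bsub>A\<^esub> \<ominus>\<^bsub>A\<^esub> x) = a \<otimes>\<^bsub>A\<^esub> y \<ominus>\<^bsub>A\<^esub> a \<otimes>\<^bsub>A\<^esub> x"
      using assms yA by (simp add: A.r_distr A.r_minus a_minus_def)
    ultimately show ?thesis using cs_eq_iff assms yA by simp
  qed
  have 3: "x \<in> cs x" unfolding cs_def by (rule K.a_rcos_self[OF assms(2)])
  show ?thesis unfolding 1 using 2 3 by blast
qed

text \<open>Multiplying by single monomials of the maximal ideal shifts the exponents of a numerator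
  without cancellation, so each exponent is torsion on its own. Conversely, finitely many exponents
  share one power of the maximal ideal.\<close>

lemma carrier_H: "carrier H = cs ` ext (tors E n)"
proof -
  have crit: "(\<exists>t. \<forall>a\<in>ideal_power A (local_max_ideal A) t. a \<odot>\<^bsub>Q\<^esub> cs x = \<zero>\<^bsub>Q\<^esub>) \<longleftrightarrow> x \<in> ext (tors E n)"
    if x: "x \<in> J" for x
  proof -
    obtain f s where fs: "x = fr f s" "f \<in> mon (pw E n)" "s \<in> D" using x unfolding ext_def by blast
    have fS: "f \<in> mon S" using sideal_mon_S[OF sid_J fs(2)] .
    have pwS: "pw (S - {0}) t \<subseteq> S" for t using sideal_pw_nonzero[of t] by (simp add: sideal_def)
    have step: "a \<odot>\<^bsub>Q\<^esub> cs x = \<zero>\<^bsub>Q\<^esub> \<longleftrightarrow> g * f \<in> mon (pw E (Suc n))"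
      if "a = fr g r" "g \<in> mon S" "r \<in> D" for a g r
    proof -
      have "a \<odot>\<^bsub>Q\<^esub> cs x = cs (fr (g * f) (r * s))"
        using that fs fS by (simp add: Q_smult A_mult fr_carrier)
      moreover have "fr (g * f) (r * s) \<in> carrier A" using that fs fS D_mult mon_S_mult' by blast
      ultimately have "a \<odot>\<^bsub>Q\<^esub> cs x = \<zero>\<^bsub>Q\<^esub> \<longleftrightarrow> fr (g * f) (r * s) \<in> K"
        unfolding Q_zero using cs_zero_iff by simp
      also have "\<dots> \<longleftrightarrow> g * f \<in> mon (pw E (Suc n))"
        using fr_in_ext[OF sid_K mon_S_mult'[OF that(2) fS] D_mult[OF that(3) fs(3)]] .
      finally show ?thesis .
    qed
    have pow: "ideal_power A (local_max_ideal A) t = ext (pw (S - {0}) t)" for t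
      unfolding local_max_ideal_eq by (rule ideal_power_ext[OF sideal_nonzero])
    show ?thesis
    proof
      assume "\<exists>t. \<forall>a\<in>ideal_power A (local_max_ideal A) t. a \<odot>\<^bsub>Q\<^esub> cs x = \<zero>\<^bsub>Q\<^esub>"
      then obtain t where t: "\<And>a. a \<in> ext (pw (S - {0}) t) \<Longrightarrow> a \<odot>\<^bsub>Q\<^esub> cs x = \<zero>\<^bsub>Q\<^esub>"
        unfolding pow by blast
      have "f \<in> mon (tors E n)"
        unfolding mon_def
      proof (intro CollectI subsetI)
        fix k assume k: "k \<in> keys f"
        have "k + p \<in> pw E (Suc n)" if p: "p \<in> pw (S - {0}) t" for p
        proof -
          have m: "monom p \<in> (mon (pw (S - {0}) t) :: (_ \<Rightarrow>\<^sub>0 'k) set)" using p by (rule mon_single)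
          then have mS: "monom p \<in> (mon S :: (_ \<Rightarrow>\<^sub>0 'k) set)" using mon_mono[OF pwS] by blast
          have "fr (monom p) 1 \<in> ext (pw (S - {0}) t)" unfolding ext_def using m D_one by blast
          then have "fr (monom p) 1 \<odot>\<^bsub>Q\<^esub> cs x = \<zero>\<^bsub>Q\<^esub>" by (rule t)
          then have "monom p * f \<in> mon (pw E (Suc n))" using step[OF refl mS D_one] by blast
          moreover have "lookup (monom p * f) (p + k) = lookup (monom p) p * lookup f k"
            by (rule lookup_mult_unique) auto
          then have "p + k \<in> keys (monom p * f)" using k by (simp add: in_keys_iff)
          ultimately show ?thesis unfolding mon_def by (auto simp: add.commute)
        qed
        moreover have "k \<in> pw E n" using k fs(2) by (auto simp: mon_def)
        ultimately show "k \<in> tors E n" unfolding tors_def by blast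
      qed
      then show "x \<in> ext (tors E n)" unfolding ext_def using fs by blast
    next
      assume "x \<in> ext (tors E n)"
      then have f: "f \<in> mon (tors E n)" using fr_in_ext[OF sid_T fS fs(3)] fs(1) by simp
      have "\<forall>k\<in>keys f. \<exists>t. \<forall>s\<in>pw (S - {0}) t. k + s \<in> pw E (Suc n)"
        using f unfolding mon_def tors_def by blast
      then obtain t where t: "\<And>k s. k \<in> keys f \<Longrightarrow> s \<in> pw (S - {0}) (t k) \<Longrightarrow> k + s \<in> pw E (Suc n)"
        by metis
      define t0 where "t0 = Max (insert 0 (t ` keys f))"
      have t0: "k + s \<in> pw E (Suc n)" if "k \<in> keys f" "s \<in> pw (S - {0}) t0" for k s
      proof -
        have "t k \<le> t0" unfolding t0_def using that(1) by (intro Max_ge) auto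
        then show ?thesis using pw_antimono[OF sideal_nonzero] that t by blast
      qed
      have "a \<odot>\<^bsub>Q\<^esub> cs x = \<zero>\<^bsub>Q\<^esub>" if a: "a \<in> ext (pw (S - {0}) t0)" for a
      proof -
        obtain g r where g: "a = fr g r" "g \<in> mon (pw (S - {0}) t0)" "r \<in> D"
          using a unfolding ext_def by blast
        have "f \<in> mon (keys f)" by (simp add: mon_def)
        then have "f * g \<in> mon (pw E (Suc n))" using mon_mult[OF _ g(2)] t0 by blast
        then show ?thesis using step[OF g(1) _ g(3)] g(2) mon_mono[OF pwS] by (simp only: mult.commute) blast
      qed
      then show "\<exists>t. \<forall>a\<in>ideal_power A (local_max_ideal A) t. a \<odot>\<^bsub>Q\<^esub> cs x = \<zero>\<^bsub>Q\<^esub>"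
        unfolding pow by blast
    qed
  qed
  have "ext (tors E n) \<subseteq> J" by (rule ext_mono) (auto simp: tors_def)
  then show ?thesis unfolding H0_def using crit by (auto simp: carrier_Q)
qed

lemma H_ops: "x \<oplus>\<^bsub>H\<^esub> y = x \<oplus>\<^bsub>Q\<^esub> y" "a \<odot>\<^bsub>H\<^esub> x = a \<odot>\<^bsub>Q\<^esub> x" "\<zero>\<^bsub>H\<^esub> = \<zero>\<^bsub>Q\<^esub>"
  by (simp_all add: H0_def)

lemma T_carrier: "x \<in> ext (tors E n) \<Longrightarrow> x \<in> carrier A"
  using ext_carrier[OF sid_T] by blast

text \<open>Multiplying by the unit \<open>s\<close> shows that a submodule is determined by the numerators it
  contains.\<close>

lemma submodule_numerator:
  assumes N: "submodule N A H" and f: "f \<in> mon (tors E n)" and s: "s \<in> D"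
  shows "cs (fr f s) \<in> N \<longleftrightarrow> cs (fr f 1) \<in> N"
proof -
  have fS: "f \<in> mon S" using sideal_mon_S[OF sid_T f] .
  have sm: "cs (a \<otimes>\<^bsub>A\<^esub> x) \<in> N" if "a \<in> carrier A" "x \<in> carrier A" "cs x \<in> N" for a x
    using submodule.smult_closed[OF N that(1,3)] Q_smult[OF that(1,2)] by (simp add: H_ops)
  have "fr s 1 \<otimes>\<^bsub>A\<^esub> fr f s = fr f 1"
    using fS s D_S by (simp add: A_mult fr_eq_iff mon_S_mult' mult.commute)
  moreover have "fr 1 s \<otimes>\<^bsub>A\<^esub> fr f 1 = fr f s" using fS s by (simp add: A_mult mon_one)
  moreover have "fr s 1 \<in> carrier A" "fr 1 s \<in> carrier A" "fr f s \<in> carrier A" "fr f 1 \<in> carrier A"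
    using fS s D_S by (auto intro!: fr_carrier mon_one)
  ultimately show ?thesis using sm by metis
qed

lemma submodule_add:
  assumes "submodule N A H" "x \<in> carrier A" "y \<in> carrier A" "cs x \<in> N" "cs y \<in> N"
  shows "cs (x \<oplus>\<^bsub>A\<^esub> y) \<in> N"
proof -
  have "subgroup N (add_monoid H)" using assms(1) by (rule submodule.axioms(1))
  then have "cs x \<oplus>\<^bsub>H\<^esub> cs y \<in> N" using subgroup.m_closed[of N "add_monoid H" "cs x" "cs y"] assms(4,5) by simp
  then show ?thesis using Q_add[OF assms(2,3)] by (simp add: H_ops)
qed

lemma submodule_lincomb:
  assumes N: "submodule N A H" and f: "f \<in> mon (tors E n)" "cs (fr f 1) \<in> N"
    and g: "g \<in> mon (tors E n)" "cs (fr g 1) \<in> N"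
  shows "cs (fr (f + Poly_Mapping.single 0 c * g) 1) \<in> N"
proof -
  have fg: "f \<in> mon S" "g \<in> mon S" using sideal_mon_S[OF sid_T] f g by blast+
  have c: "Poly_Mapping.single 0 c \<in> (mon S :: (_ \<Rightarrow>\<^sub>0 'k) set)" by (rule mon_single) simp
  have cA: "fr (Poly_Mapping.single 0 c) 1 \<in> carrier A" "fr g 1 \<in> carrier A" "fr f 1 \<in> carrier A"
    using fg c by auto
  have "cs (fr (Poly_Mapping.single 0 c) 1 \<otimes>\<^bsub>A\<^esub> fr g 1) \<in> N"
    using submodule.smult_closed[OF N cA(1) g(2)] Q_smult[OF cA(1,2)] by (simp add: H_ops)
  then have "cs (fr f 1 \<oplus>\<^bsub>A\<^esub> (fr (Poly_Mapping.single 0 c) 1 \<otimes>\<^bsub>A\<^esub> fr g 1)) \<in> N"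
    using submodule_add[OF N cA(3)] f(2) cA by blast
  moreover have "fr f 1 \<oplus>\<^bsub>A\<^esub> (fr (Poly_Mapping.single 0 c) 1 \<otimes>\<^bsub>A\<^esub> fr g 1) = fr (f + Poly_Mapping.single 0 c * g) 1"
    using fg c by (simp add: A_mult A_add mon_S_mult')
  ultimately show ?thesis by simp
qed

text \<open>The analogue of an initial ideal. Leading means least in \<open>\<rho>\<close>, and only
  exponents in \<open>T\<close> compete, because the others vanish in the quotient.\<close>

definition leads :: "(real ^ 'd \<Rightarrow> real) \<Rightarrow> _ \<Rightarrow> (real ^ 'd) set" where
  "leads \<rho> N = {q \<in> T. \<exists>f \<in> mon (tors E n). cs (fr f 1) \<in> N \<and> q \<in> keys f \<and>
     (\<forall>k\<in>keys f \<inter> T. k \<noteq> q \<longrightarrow> \<rho> q < \<rho> k)}"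

text \<open>An element of \<open>N\<^sub>2 - N\<^sub>1\<close> whose leading exponent is as late as possible has a leading
  exponent that does not occur in \<open>N\<^sub>1\<close>: otherwise subtract a multiple of an element of \<open>N\<^sub>1\<close>.\<close>

lemma leads_strict_mono:
  assumes fin: "finite T" and \<rho>: "inj_on \<rho> T"
    and N1: "submodule N1 A H" and N2: "submodule N2 A H" and sub: "N1 \<subset> N2"
  shows "leads \<rho> N1 \<subset> leads \<rho> N2"
proof
  show "leads \<rho> N1 \<subseteq> leads \<rho> N2" unfolding leads_def using sub by blast
  have zero: "cs (fr f 1) \<in> N1" if "f \<in> mon S" "keys f \<subseteq> pw E (Suc n)" for f
  proof -
    have "f \<in> mon (pw E (Suc n))" using that by (simp add: mon_def)
    then have "fr f 1 \<in> K" unfolding ext_def using D_one by blast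
    then have "cs (fr f 1) = \<zero>\<^bsub>H\<^esub>" using cs_zero_iff that by (auto simp: H_ops Q_zero)
    then show ?thesis
      using subgroup.one_closed[OF submodule.axioms(1)[OF N1]] by simp
  qed
  define X where "X = {f \<in> mon (tors E n). cs (fr f 1) \<in> N2 \<and> cs (fr f 1) \<notin> N1}"
  have ne: "X \<noteq> {}"
  proof -
    obtain y where y: "y \<in> N2" "y \<notin> N1" using sub by blast
    have "y \<in> carrier H"
      using y(1) subgroup.subset[OF submodule.axioms(1)[OF N2]] by auto
    then obtain f s where fs: "y = cs (fr f s)" "f \<in> mon (tors E n)" "s \<in> D"
      unfolding carrier_H by (auto simp: ext_def)
    then have "f \<in> X"
      using y submodule_numerator[OF N1 fs(2,3)] submodule_numerator[OF N2 fs(2,3)] unfolding X_def by blast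
    then show ?thesis by blast
  qed
  define ld where "ld f = arg_min_on \<rho> (keys f \<inter> T)" for f :: "_ \<Rightarrow>\<^sub>0 'k"
  have ldX: "ld f \<in> keys f \<inter> T" "\<And>k. k \<in> keys f \<inter> T \<Longrightarrow> k \<noteq> ld f \<Longrightarrow> \<rho> (ld f) < \<rho> k" if f: "f \<in> X" for f
  proof -
    have "keys f \<inter> T \<noteq> {}"
    proof
      assume "keys f \<inter> T = {}"
      moreover have "keys f \<subseteq> tors E n" using f by (auto simp: X_def mon_def)
      ultimately have "keys f \<subseteq> pw E (Suc n)" unfolding T_def by blast
      then show False using zero[of f] sideal_mon_S[OF sid_T] f by (auto simp: X_def)
    qed
    then show 1: "ld f \<in> keys f \<inter> T" unfolding ld_def using fin by (intro arg_min_if_finite(1)) auto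
    fix k assume k: "k \<in> keys f \<inter> T" "k \<noteq> ld f"
    have "\<rho> (ld f) \<le> \<rho> k" unfolding ld_def using fin k by (intro arg_min_least) auto
    moreover have "\<rho> (ld f) \<noteq> \<rho> k" using \<rho> k 1 unfolding inj_on_def by blast
    ultimately show "\<rho> (ld f) < \<rho> k" by simp
  qed
  have "finite ((\<lambda>f. \<rho> (ld f)) ` X)"
    by (rule finite_subset[OF _ finite_imageI[OF fin, of \<rho>]]) (use ldX(1) in blast)
  then have "Max ((\<lambda>f. \<rho> (ld f)) ` X) \<in> (\<lambda>f. \<rho> (ld f)) ` X" using ne by (intro Max_in) auto
  then obtain f where f: "f \<in> X" "Max ((\<lambda>f. \<rho> (ld f)) ` X) = \<rho> (ld f)" by auto
  have max: "\<rho> (ld g) \<le> \<rho> (ld f)" if "g \<in> X" for g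
    unfolding f(2)[symmetric] using \<open>finite ((\<lambda>f. \<rho> (ld f)) ` X)\<close> that by (intro Max_ge) auto
  have fm: "f \<in> mon (tors E n)" "cs (fr f 1) \<in> N2" "cs (fr f 1) \<notin> N1" using f by (auto simp: X_def)
  have "ld f \<in> leads \<rho> N2" unfolding leads_def using fm ldX[OF f(1)] by auto
  moreover have "ld f \<notin> leads \<rho> N1"
  proof
    assume "ld f \<in> leads \<rho> N1"
    then obtain g where g: "g \<in> mon (tors E n)" "cs (fr g 1) \<in> N1" "ld f \<in> keys g"
      "\<And>k. k \<in> keys g \<inter> T \<Longrightarrow> k \<noteq> ld f \<Longrightarrow> \<rho> (ld f) < \<rho> k"
      unfolding leads_def by blast
    \<comment> \<open>Cancels the leading coefficient of \<open>f\<close>.\<close>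
    define c where "c = - lookup f (ld f) / lookup g (ld f)"
    define h where "h = f + Poly_Mapping.single 0 c * g"
    have lk: "lookup (Poly_Mapping.single 0 c * g) l = c * lookup g l" for c :: 'k and l
      using lookup_mult_unique[of "Poly_Mapping.single 0 c" g 0 l] by (cases "c = 0") auto
    have hl: "lookup h l = lookup f l + c * lookup g l" for l by (simp add: h_def lookup_add lk)
    have "g * Poly_Mapping.single 0 c \<in> mon (tors E n)"
      by (rule mon_S_mult[OF g(1) mon_single[OF S_zero] sid_T])
    then have hm: "h \<in> mon (tors E n)"
      unfolding h_def using fm(1) by (intro mon_add) (simp_all add: mult.commute)
    have "cs (fr h 1) \<in> N2" unfolding h_def using submodule_lincomb[OF N2 fm(1,2) g(1)] g(2) sub by blast
    moreover have "cs (fr h 1) \<notin> N1"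
    proof
      assume h: "cs (fr h 1) \<in> N1"
      have "cs (fr (h + Poly_Mapping.single 0 (- c) * g) 1) \<in> N1" using submodule_lincomb[OF N1 hm h g(1,2)] .
      moreover have "h + Poly_Mapping.single 0 (- c) * g = f"
        by (rule poly_mapping_eqI) (simp add: lookup_add lk hl)
      ultimately show False using fm(3) by simp
    qed
    ultimately have hX: "h \<in> X" using hm by (simp add: X_def)
    have k: "ld h \<in> keys h \<inter> T" using ldX(1)[OF hX] .
    have "lookup h (ld f) = 0" using g(3) by (simp add: hl c_def in_keys_iff)
    then have kn: "ld h \<noteq> ld f" using k by (auto simp: in_keys_iff)
    have "ld h \<in> keys f \<or> ld h \<in> keys g" using k hl by (auto simp: in_keys_iff)
    then have "\<rho> (ld f) < \<rho> (ld h)" using ldX(2)[OF f(1)] g(4) kn k by blast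
    then show False using max[OF hX] by simp
  qed
  ultimately show "leads \<rho> N1 \<noteq> leads \<rho> N2" by blast
qed

text \<open>Supplies the terms of the explicit chain that bounds the length from below.\<close>

lemma submodule_ext:
  assumes F: "sideal F" "pw E (Suc n) \<subseteq> F" "F \<subseteq> tors E n"
  shows "submodule (cs ` ext F) A H"
proof (intro submodule.intro subgroup.intro)
  have FA: "x \<in> carrier A" if "x \<in> ext F" for x using ext_carrier[OF F(1)] that by blast
  interpret F: ideal "ext F" A by (rule ideal_ext[OF F(1)])
  show 1: "cs ` ext F \<subseteq> carrier (add_monoid H)"
    using ext_mono[OF F(3)] by (auto simp: carrier_H)
  show "x \<otimes>\<^bsub>add_monoid H\<^esub> y \<in> cs ` ext F" if x: "x \<in> cs ` ext F" and y: "y \<in> cs ` ext F" for x y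
    using x y FA F.a_closed by (auto simp: H_ops Q_add)
  have K0: "cs \<zero>\<^bsub>A\<^esub> = K" using cs_zero_iff[of "\<zero>\<^bsub>A\<^esub>"] by simp
  show "\<one>\<^bsub>add_monoid H\<^esub> \<in> cs ` ext F" 
    using imageI[OF F.zero_closed, of cs] unfolding K0 by (simp add: H_ops Q_zero)
  show "inv\<^bsub>add_monoid H\<^esub> x \<in> cs ` ext F" if x: "x \<in> cs ` ext F" for x
  proof -
    obtain y where y: "x = cs y" "y \<in> ext F" using x by blast
    have yA: "y \<in> carrier A" using FA y by blast
    have y': "\<ominus>\<^bsub>A\<^esub> y \<in> ext F" using F.a_inv_closed y(2) by blast
    \<comment> \<open>The inverse in the group of \<open>H\<close> is a definite description, so
      existence and uniqueness are verified by hand.\<close>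
    have "inv\<^bsub>add_monoid H\<^esub> x = cs (\<ominus>\<^bsub>A\<^esub> y)"
      unfolding m_inv_def
    proof (rule the_equality, intro conjI)
      show "cs (\<ominus>\<^bsub>A\<^esub> y) \<in> carrier (add_monoid H)" using 1 y' by blast
      show "x \<otimes>\<^bsub>add_monoid H\<^esub> cs (\<ominus>\<^bsub>A\<^esub> y) = \<one>\<^bsub>add_monoid H\<^esub>"
        "cs (\<ominus>\<^bsub>A\<^esub> y) \<otimes>\<^bsub>add_monoid H\<^esub> x = \<one>\<^bsub>add_monoid H\<^esub>"
        using yA y(1) by (simp_all add: K0 H_ops Q_add Q_zero A.r_neg A.l_neg)
      fix z assume z: "z \<in> carrier (add_monoid H) \<and> x \<otimes>\<^bsub>add_monoid H\<^esub> z = \<one>\<^bsub>add_monoid H\<^esub> \<and>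
        z \<otimes>\<^bsub>add_monoid H\<^esub> x = \<one>\<^bsub>add_monoid H\<^esub>"
      then obtain u where u: "z = cs u" "u \<in> ext (tors E n)" by (auto simp: carrier_H)
      have uA: "u \<in> carrier A" using T_carrier u by blast
      have "cs (u \<oplus>\<^bsub>A\<^esub> y) = K" using z u(1) y(1) uA yA by (simp add: H_ops Q_add Q_zero)
      then have "u \<oplus>\<^bsub>A\<^esub> y \<in> K" using cs_zero_iff uA yA by simp
      then have "u \<ominus>\<^bsub>A\<^esub> (\<ominus>\<^bsub>A\<^esub> y) \<in> K" using yA by (simp add: a_minus_def)
      then show "z = cs (\<ominus>\<^bsub>A\<^esub> y)" using cs_eq_iff[OF uA] u(1) yA by simp
    qed
    then show ?thesis using y' by blast
  qed
  show "submodule_axioms (cs ` ext F) A H"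
  proof (rule submodule_axioms.intro)
    fix a x assume a: "a \<in> carrier A" and "x \<in> cs ` ext F"
    then obtain y where y: "x = cs y" "y \<in> ext F" by blast
    then have "a \<odot>\<^bsub>H\<^esub> x = cs (a \<otimes>\<^bsub>A\<^esub> y)" using Q_smult[OF a FA] by (simp add: H_ops)
    then show "a \<odot>\<^bsub>H\<^esub> x \<in> cs ` ext F" using F.I_l_closed[OF y(2) a] by blast
  qed
qed

text \<open>The leading sets along a chain of submodules grow strictly inside \<open>T\<close>,
  which bounds the length from above. Adjoining the elements of \<open>T\<close> one by one gives a
  chain of monomial ideals of that length.\<close>

lemma length_H:
  assumes fin: "finite T"
  shows "module_length A H = enat (card T)"
proof (rule antisym)
  obtain a where a: "inj_on (\<lambda>x. a \<bullet> x) T" using generic_functional[OF fin] by blast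
  show "module_length A H \<le> enat (card T)"
    unfolding module_length_def
  proof (rule Sup_least, clarify)
    fix m N assume N: "\<forall>i\<le>m. submodule (N i) A H" "\<forall>i<m. N i \<subset> N (Suc i)"
    let ?L = "\<lambda>i. leads (\<lambda>x. a \<bullet> x) (N i)"
    have LT: "?L i \<subseteq> T" for i unfolding leads_def by blast
    have "i \<le> card (?L i)" if "i \<le> m" for i
      using that
    proof (induction i)
      case (Suc i)
      have "?L i \<subset> ?L (Suc i)" using leads_strict_mono[OF fin a] N Suc.prems by simp
      then have "card (?L i) < card (?L (Suc i))" using finite_subset[OF LT fin] by (intro psubset_card_mono) auto
      then show ?case using Suc by simp
    qed simp
    then have "m \<le> card (?L m)" by simp
    also have "\<dots> \<le> card T" by (rule card_mono[OF fin LT])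
    finally show "enat m \<le> enat (card T)" by simp
  qed
  show "enat (card T) \<le> module_length A H"
  proof -
    obtain ys where ys: "set ys = T" "distinct ys" using finite_distinct_list[OF fin] by blast
    \<comment> \<open>Heaviest first: adding a nonzero element of \<open>S\<close> raises the
      weight, so the translates of a newly adjoined element are already present.\<close>
    define xs where "xs = sort_key (\<lambda>q. - (weight \<bullet> q)) ys"
    have xs: "set xs = T" "distinct xs" "length xs = card T"
      using ys distinct_card[of xs] by (auto simp: xs_def distinct_card)
    have sorted: "weight \<bullet> (xs ! j) \<le> weight \<bullet> (xs ! i)" if "i \<le> j" "j < length xs" for i j
    proof -
      have "sorted (map (\<lambda>q. - (weight \<bullet> q)) xs)" unfolding xs_def by (rule sorted_sort_key)
      then have "map (\<lambda>q. - (weight \<bullet> q)) xs ! i \<le> map (\<lambda>q. - (weight \<bullet> q)) xs ! j"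
        using that by (intro sorted_nth_mono) auto
      then show ?thesis using that by simp
    qed
    define F where "F i = pw E (Suc n) \<union> set (take i xs)" for i
    have Tsub: "set (take i xs) \<subseteq> T" for i using set_take_subset[of i xs] xs(1) by simp
    have Ftors: "F i \<subseteq> tors E n" for i
      unfolding F_def using Tsub[of i] pw_subset_tors[OF E] by (auto simp: T_def)
    have sidF: "sideal (F i)" for i
      unfolding sideal_def
    proof (intro conjI ballI)
      show "F i \<subseteq> S" using Ftors sid_T unfolding sideal_def by blast
      fix q s assume q: "q \<in> F i" and s: "s \<in> S"
      show "q + s \<in> F i"
      proof (cases "q \<in> pw E (Suc n)")
        case True
        then show ?thesis using sidealD[OF sid_K _ s] by (simp add: F_def)
      next
        case False
        then obtain j where j: "j < i" "j < length xs" "q = xs ! j"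
          using q unfolding F_def by (auto simp: in_set_conv_nth)
        have qs: "q + s \<in> tors E n" using sidealD[OF sid_T _ s] q Ftors by blast
        show ?thesis
        proof (cases "q + s \<in> pw E (Suc n)")
          case False
          then have "q + s \<in> set xs" using qs xs(1) by (simp add: T_def)
          then obtain l where l: "l < length xs" "q + s = xs ! l" by (metis in_set_conv_nth)
          show ?thesis
          proof (cases "s = 0")
            case True
            then show ?thesis using q by simp
          next
            case False
            then have "weight \<bullet> q < weight \<bullet> (q + s)"
              using weight_pos[OF S_sigma[OF s]] by (simp add: inner_add_right)
            then have "l < j" using sorted[of j l] l j by (metis not_le)
            then have "q + s \<in> set (take i xs)" using l j by (auto simp: in_set_conv_nth intro!: exI[of _ l])
            then show ?thesis by (simp add: F_def)
          qed
        qed (simp add: F_def)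
      qed
    qed
    have sm: "submodule (cs ` ext (F i)) A H" for i
      by (rule submodule_ext[OF sidF _ Ftors]) (simp add: F_def)
    have strict: "cs ` ext (F i) \<subset> cs ` ext (F (Suc i))" if i: "i < card T" for i
    proof -
      have FF: "F i \<subseteq> F (Suc i)" unfolding F_def using set_take_subset_set_take[of i "Suc i" xs] by auto
      define q where "q = xs ! i"
      have iq: "i < length xs" using i xs by simp
      have qF: "q \<in> F (Suc i)"
        unfolding F_def q_def using iq by (simp add: take_Suc_conv_app_nth)
      have "q \<notin> set (take i xs)" using iq xs(2) unfolding q_def
        by (auto simp: in_set_conv_nth nth_eq_iff_index_eq)
      moreover have "q \<in> T" unfolding q_def using iq xs(1) nth_mem by blast
      ultimately have qn: "q \<notin> F i" unfolding F_def T_def by blast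
      have qS: "monom q \<in> (mon S :: (_ \<Rightarrow>\<^sub>0 'k) set)" using qF sideal_S[OF sidF] by (intro mon_single) blast
      have in1: "fr (monom q) 1 \<in> ext (F (Suc i))"
        unfolding ext_def using mon_single[OF qF, of 1] D_one by blast
      have "cs (fr (monom q) 1) \<notin> cs ` ext (F i)"
      proof
        assume "cs (fr (monom q) 1) \<in> cs ` ext (F i)"
        then obtain y where y: "cs (fr (monom q) 1) = cs y" "y \<in> ext (F i)" by blast
        have yA: "y \<in> carrier A" using ext_carrier[OF sidF] y by blast
        have qA: "fr (monom q) 1 \<in> carrier A" by (rule fr_carrier[OF qS D_one])
        have "fr (monom q) 1 \<ominus>\<^bsub>A\<^esub> y \<in> K" using cs_eq_iff[OF qA yA] y by simp
        moreover have "K \<subseteq> ext (F i)" by (rule ext_mono) (simp add: F_def)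
        ultimately have "(fr (monom q) 1 \<ominus>\<^bsub>A\<^esub> y) \<oplus>\<^bsub>A\<^esub> y \<in> ext (F i)"
          using y(2) additive_subgroup.a_closed[OF ideal.axioms(1)[OF ideal_ext[OF sidF]]] by blast
        moreover have "(fr (monom q) 1 \<ominus>\<^bsub>A\<^esub> y) \<oplus>\<^bsub>A\<^esub> y = fr (monom q) 1"
          using qA yA by (simp add: a_minus_def A.a_assoc A.l_neg)
        ultimately have "monom q \<in> (mon (F i) :: (_ \<Rightarrow>\<^sub>0 'k) set)"
          using fr_in_ext[OF sidF qS D_one] by simp
        then show False using qn by (simp add: mon_def)
      qed
      then show ?thesis using in1 ext_mono[OF FF] by blast
    qed
    show ?thesis unfolding module_length_def
    proof (rule Sup_upper, intro CollectI exI conjI)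
      show "enat (card T) = enat (card T)" ..
      show "\<forall>i\<le>card T. submodule (cs ` ext (F i)) A H" using sm by blast
      show "\<forall>i<card T. cs ` ext (F i) \<subset> cs ` ext (F (Suc i))" using strict by blast
    qed
  qed
qed

end

section \<open>The torsion exponents\<close>

lemma comb_Nil: "comb a [] = 0"
  by (simp add: comb_def)

lemma comb_Cons: "comb (n # a) (g # gs) = real n *\<^sub>R g + comb a gs"
  unfolding comb_def by (simp add: sum.lessThan_Suc_shift del: sum.lessThan_Suc)

lemma comb_append:
  "length a = length gs \<Longrightarrow> comb (a @ u) (gs @ vs) = comb a gs + comb u vs"
  by (induction a gs rule: list_induct2) (simp_all add: comb_Cons comb_Nil add.assoc)

lemma comb_filter_nonzero:
  "length a = length gs \<Longrightarrow>
    \<exists>b. length b = length (filter (\<lambda>g. g \<noteq> 0) gs) \<and> comb a gs = comb b (filter (\<lambda>g. g \<noteq> 0) gs)"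
proof (induction a gs rule: list_induct2)
  case (Cons n a g gs)
  then obtain b where b: "length b = length (filter (\<lambda>g. g \<noteq> 0) gs)" "comb a gs = comb b (filter (\<lambda>g. g \<noteq> 0) gs)"
    by blast
  show ?case
  proof (cases "g = 0")
    case True
    then show ?thesis using b by (intro exI[of _ b]) (simp add: comb_Cons)
  next
    case False
    then show ?thesis using b by (intro exI[of _ "n # b"]) (simp add: comb_Cons)
  qed
qed (simp add: comb_Nil)

lemma sum_list_map2_add:
  "length a = length b \<Longrightarrow> sum_list (map2 (+) a b) = sum_list a + (sum_list b :: nat)"
  by (induction a b rule: list_induct2) simp_all

definition unit_list :: "nat \<Rightarrow> nat \<Rightarrow> nat list" where
  "unit_list r i = map (\<lambda>j. if j = i then 1 else 0) [0..<r]"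

lemma length_unit_list [simp]: "length (unit_list r i) = r"
  by (simp add: unit_list_def)

lemma comb_unit_list:
  assumes "i < length vs"
  shows "comb (unit_list (length vs) i) vs = vs ! i"
proof -
  have "comb (unit_list (length vs) i) vs = (\<Sum>j<length vs. if j = i then vs ! j else 0)"
    unfolding comb_def unit_list_def by (intro sum.cong) auto
  then show ?thesis using assms by simp
qed

lemma sum_unit_list: "i < r \<Longrightarrow> sum_list (unit_list r i) = 1"
  unfolding unit_list_def by (simp add: interv_sum_list_conv_sum_set_nat)

text \<open>Singles out one representation of each exponent; by \<open>lexl_add\<close> the
  representations that are not least form an upward closed set.\<close>

fun lexl :: "nat list \<Rightarrow> nat list \<Rightarrow> bool" where
  "lexl (x # xs) (y # ys) = (x < y \<or> x = y \<and> lexl xs ys)"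
| "lexl _ _ = False"

lemma lexl_total: "length u = length v \<Longrightarrow> lexl u v \<or> u = v \<or> lexl v u"
  by (induction u v rule: list_induct2) auto

lemma lexl_add:
  "lexl u v \<Longrightarrow> length u = length v \<Longrightarrow> length w = length v \<Longrightarrow> lexl (map2 (+) u w) (map2 (+) v w)"
proof (induction u v arbitrary: w rule: lexl.induct)
  case (1 x xs y ys)
  then show ?case by (cases w) auto
qed auto

text \<open>Minimise the head, then the tail among lists with that head.\<close>

lemma lexl_min:
  assumes "X \<noteq> {}" "\<And>x. x \<in> X \<Longrightarrow> length x = k"
  shows "\<exists>m\<in>X. \<forall>x\<in>X. \<not> lexl x m"
  using assms
proof (induction k arbitrary: X)
  case 0
  then have "X = {[]}" by auto
  then show ?case by simp
next
  case (Suc k)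
  obtain x0 where x0: "x0 \<in> X" using Suc.prems by blast
  define a where "a = (LEAST i. i \<in> hd ` X)"
  have a: "a \<in> hd ` X" unfolding a_def using x0 by (intro LeastI[of "\<lambda>i. i \<in> hd ` X" "hd x0"]) blast
  have amin: "a \<le> i" if "i \<in> hd ` X" for i unfolding a_def using that by (rule Least_le)
  let ?Y = "{t. a # t \<in> X}"
  obtain z where z: "z \<in> X" "hd z = a" using a by blast
  then have "z = a # tl z" using Suc.prems(2)[of z] by (cases z) auto
  then have "?Y \<noteq> {}" using z by (metis empty_iff mem_Collect_eq)
  moreover have "length t = k" if "t \<in> ?Y" for t using Suc.prems(2)[of "a # t"] that by simp
  ultimately obtain m where m: "m \<in> ?Y" "\<And>t. t \<in> ?Y \<Longrightarrow> \<not> lexl t m" using Suc.IH[of ?Y] by blast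
  have "\<not> lexl x (a # m)" if x: "x \<in> X" for x
  proof -
    obtain i t where it: "x = i # t" using Suc.prems(2)[OF x] by (cases x) auto
    have "a \<le> i" using amin[of i] x it by force
    then show ?thesis using m(2)[of t] x it by auto
  qed
  then show ?case using m(1) by blast
qed

lemma finite_lists_sum_le: "finite {a :: nat list. length a = k \<and> sum_list a \<le> L}"
proof -
  have "{a :: nat list. length a = k \<and> sum_list a \<le> L} = (\<Union>n\<le>L. {a. length a = k \<and> sum_list a = n})" by auto
  then show ?thesis using finite_lists_sum by simp
qed

context pointed_cone
begin

lemma pw_add:
  assumes "sideal E" "x \<in> pw E m" "y \<in> pw E n"
  shows "x + y \<in> pw E (m + n)"
  using assms(3)
proof (induction n arbitrary: y)
  case 0
  have "sideal (pw E m)" using assms(1) by (intro sideal_pw) (simp add: sideal_def)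
  then show ?case using sidealD assms(2) 0 by auto
next
  case (Suc n)
  then obtain a b where ab: "y = a + b" "a \<in> pw E n" "b \<in> E" unfolding pw.simps by blast
  have "x + a \<in> pw E (m + n)" using Suc.IH ab by blast
  then have "(x + a) + b \<in> pw E (Suc (m + n))" unfolding pw.simps using ab(3) by blast
  then show ?case using ab(1) by (simp add: add.assoc)
qed

lemma pw_scale:
  assumes "sideal E" "v \<in> E"
  shows "real n *\<^sub>R v \<in> pw E n"
proof (induction n)
  case (Suc n)
  have "real n *\<^sub>R v + v \<in> pw E (Suc n)" unfolding pw.simps using Suc assms by blast
  then show ?case by (simp add: scaleR_left_distrib add.commute)
qed simp

lemma comb_pw:
  assumes "sideal E" "set vs \<subseteq> E" "length u = length vs"
  shows "comb u vs \<in> pw E (sum_list u)"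
  using assms(3,2)
  by (induction u vs rule: list_induct2) (auto simp: comb_Cons comb_Nil intro!: pw_add pw_scale assms(1))

text \<open>With nonzero generators only, a combination of total multiplicity \<open>t\<close> lies
  in the \<open>t\<close>-th power of the maximal ideal.\<close>

definition gens0 where "gens0 = filter (\<lambda>g. g \<noteq> 0) gens"

lemma gens0_S: "set gens0 \<subseteq> S - {0}"
  using gens_S by (auto simp: gens0_def)

lemma gens0_comb: "q \<in> S \<Longrightarrow> \<exists>a. length a = length gens0 \<and> q = comb a gens0"
  using gens_comb comb_filter_nonzero unfolding gens0_def by metis

lemma comb_gens0_S: "comb a gens0 \<in> S"
  using comb_S[of gens0 a] gens0_S by blast

text \<open>The monomial basis of the torsion in the \<open>n\<close>-th graded piece; its
  cardinality is the length.\<close>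

definition tdeg where "tdeg E n = tors E n - pw E (Suc n)"

end

section \<open>The Rees algebra as a quotient of a polynomial ring\<close>

locale newton_data = pointed_cone \<sigma> for \<sigma> :: "(real ^ 'd) set" +
  fixes E :: "(real ^ 'd) set"
  assumes E: "sideal E"
begin

definition vs where "vs = (SOME vs. set vs = min_gens E \<and> distinct vs)"

lemma vs: "set vs = min_gens E" "distinct vs"
  using someI_ex[OF finite_distinct_list[OF finite_min_gens[OF E]]] unfolding vs_def by auto

lemma vs_E: "set vs \<subseteq> E"
  using vs by (auto simp: min_gens_def)

lemma E_vs: "e \<in> E \<Longrightarrow> \<exists>v\<in>set vs. \<exists>s\<in>S. e = v + s"
  using span_min_gens[OF E] unfolding vs(1) span_ideal_def by blast

lemma ES: "E \<subseteq> S" and sideal_pwE: "sideal (pw E n)"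
  using E sideal_pw[of E n] by (auto simp: sideal_def)

text \<open>In terms of the Rees algebra, monoid generators have degree \<open>0\<close> and ideal
  generators degree \<open>1\<close>; this is surjectivity of the presentation in degree
  \<open>n\<close>.\<close>

lemma pw_rep:
  assumes "q \<in> pw E n"
  shows "\<exists>a u. length a = length gens0 \<and> length u = length vs \<and> sum_list u = n \<and> q = comb a gens0 + comb u vs"
  using assms
proof (induction n arbitrary: q)
  case 0
  then obtain a where "length a = length gens0" "q = comb a gens0" using gens0_comb by auto
  moreover have "comb (replicate (length vs) 0) vs = 0" by (simp add: comb_def)
  ultimately show ?case by (intro exI[of _ a] exI[of _ "replicate (length vs) 0"]) (auto simp: sum_list_replicate)
next
  case (Suc n)
  then obtain x b where xb: "q = x + b" "x \<in> pw E n" "b \<in> E" unfolding pw.simps by blast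
  obtain a u where au: "length a = length gens0" "length u = length vs" "sum_list u = n" "x = comb a gens0 + comb u vs"
    using Suc.IH[OF xb(2)] by blast
  obtain v s where vs': "v \<in> set vs" "s \<in> S" "b = v + s" using E_vs[OF xb(3)] by blast
  obtain i where i: "i < length vs" "v = vs ! i" using vs'(1) by (metis in_set_conv_nth)
  obtain a' where a': "length a' = length gens0" "s = comb a' gens0" using gens0_comb[OF vs'(2)] by blast
  have "comb (map2 (+) a a') gens0 = comb a gens0 + comb a' gens0" using au a' by (intro comb_add) auto
  moreover have "comb (map2 (+) u (unit_list (length vs) i)) vs = comb u vs + vs ! i"
    using comb_add[of u vs "unit_list (length vs) i"] comb_unit_list[OF i(1)] au(2) by simp
  ultimately have "q = comb (map2 (+) a a') gens0 + comb (map2 (+) u (unit_list (length vs) i)) vs"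
    using xb(1) au(4) vs'(3) i(2) a'(2) by (simp add: add_ac)
  moreover have "sum_list (map2 (+) u (unit_list (length vs) i)) = Suc n"
    using sum_list_map2_add[of u "unit_list (length vs) i"] sum_unit_list[OF i(1)] au by simp
  ultimately show ?case using au a'
    by (intro exI[of _ "map2 (+) a a'"] exI[of _ "map2 (+) u (unit_list (length vs) i)"]) simp
qed

text \<open>Exponents of \<open>k[S][y\<^sub>v : v \<in> V]\<close>: a list of multiplicities of the generators of the monoid
  followed by the multiplicities of the generators of the ideal; \<open>dg\<close> is the degree in the \<open>y\<^sub>v\<close>.\<close>

definition dim where "dim = length gens0 + length vs"
definition cz where "cz z = comb z (gens0 @ vs)"
definition dg where "dg z = sum_list (drop (length gens0) z)"

lemma cz_append: "length a = length gens0 \<Longrightarrow> cz (a @ u) = comb a gens0 + comb u vs"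
  unfolding cz_def by (rule comb_append)

lemma dg_append: "length a = length gens0 \<Longrightarrow> dg (a @ u) = sum_list u"
  unfolding dg_def by simp

lemma dim_split:
  assumes "length z = dim"
  obtains a u where "z = a @ u" "length a = length gens0" "length u = length vs"
proof (rule that[of "take (length gens0) z" "drop (length gens0) z"])
qed (use assms in \<open>auto simp: dim_def\<close>)

lemma cz_pw: "length z = dim \<Longrightarrow> cz z \<in> pw E (dg z)"
proof -
  assume "length z = dim"
  then obtain a u where au: "z = a @ u" "length a = length gens0" "length u = length vs" by (rule dim_split)
  have "comb u vs \<in> pw E (sum_list u)" using comb_pw[OF E vs_E au(3)] .
  then have "comb u vs + comb a gens0 \<in> pw E (sum_list u)" using sidealD[OF sideal_pwE _ comb_gens0_S] by blast
  then show ?thesis using au by (simp add: cz_append dg_append add.commute)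
qed

lemma pw_cz: "q \<in> pw E n \<Longrightarrow> \<exists>z. length z = dim \<and> dg z = n \<and> cz z = q"
  using pw_rep[of q n] cz_append dg_append unfolding dim_def by (metis length_append)

lemma cz_add:
  assumes "length z = dim" "length w = dim"
  shows "cz (map2 (+) z w) = cz z + cz w" and "dg (map2 (+) z w) = dg z + dg w"
proof -
  show "cz (map2 (+) z w) = cz z + cz w"
    unfolding cz_def using assms by (intro comb_add) (auto simp: dim_def)
  have "drop m (map2 (+) z w) = map2 (+) (drop m z) (drop m w)" for m
    by (simp add: drop_map drop_zip)
  then show "dg (map2 (+) z w) = dg z + dg w"
    unfolding dg_def using assms by (simp add: sum_list_map2_add)
qed

text \<open>A graded family of exponents stable under the powers of \<open>E\<close> is a monomial
  submodule over the Rees algebra, and pulls back to a monomial ideal of the polynomial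
  ring.\<close>

lemma upset_family:
  assumes "\<And>m n x y. x \<in> X m \<Longrightarrow> y \<in> pw E n \<Longrightarrow> x + y \<in> X (m + n)"
  shows "upset dim {z. length z = dim \<and> cz z \<in> X (dg z)}"
  unfolding upset_def
proof (intro conjI ballI allI impI)
  fix z y assume z: "z \<in> {z. length z = dim \<and> cz z \<in> X (dg z)}" and zy: "list_all2 (\<le>) z y"
  have len: "length z = dim" "length y = dim" using z zy by (auto simp: list_all2_lengthD)
  let ?w = "map2 (-) y z"
  have w: "length ?w = dim" using len by simp
  have y: "y = map2 (+) z ?w" by (rule list_le_add_diff[OF zy])
  have "cz z + cz ?w \<in> X (dg z + dg ?w)" using assms z cz_pw[OF w] by blast
  then show "y \<in> {z. length z = dim \<and> cz z \<in> X (dg z)}"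
    using cz_add[OF len(1) w] y len by simp
qed auto

text \<open>The exponents that the \<open>t\<close>-th power of the maximal ideal moves into the
  next power of \<open>E\<close> pull back to upward closed sets increasing with \<open>t\<close>.
  Stabilization yields one \<open>t0\<close> for all degrees \<open>n\<close> at once.\<close>

lemma uniform_torsion:
  "\<exists>t0. \<forall>n. \<forall>q\<in>tors E n. \<forall>s\<in>pw (S - {0}) t0. q + s \<in> pw E (Suc n)"
proof -
  define U where "U t = {z. length z = dim \<and> cz z \<in> {q. \<forall>s\<in>pw (S - {0}) t. q + s \<in> pw E (Suc (dg z))}}" for t
  have "\<exists>N. \<forall>t\<ge>N. U t = U N"
  proof (rule upset_chain_stabilizes)
    show "upset dim (U t)" for t
      unfolding U_def
    proof (rule upset_family[where X = "\<lambda>n. {q. \<forall>s\<in>pw (S - {0}) t. q + s \<in> pw E (Suc n)}"], clarify)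
      fix m n x y s
      assume x: "\<forall>s\<in>pw (S - {0}) t. x + s \<in> pw E (Suc m)" and y: "y \<in> pw E n" and s: "s \<in> pw (S - {0}) t"
      have "(x + s) + y \<in> pw E (Suc m + n)" using pw_add[OF E _ y] x s by blast
      then show "x + y + s \<in> pw E (Suc (m + n))" by (simp add: add_ac)
    qed
    show "U t \<subseteq> U t'" if "t \<le> t'" for t t'
      unfolding U_def using pw_antimono[OF sideal_nonzero that] by blast
  qed
  then obtain t0 where t0: "\<And>t. t \<ge> t0 \<Longrightarrow> U t = U t0" by blast
  have "q + s \<in> pw E (Suc n)" if q: "q \<in> tors E n" and s: "s \<in> pw (S - {0}) t0" for n q s
  proof -
    obtain t where t: "q \<in> pw E n" "\<And>s. s \<in> pw (S - {0}) t \<Longrightarrow> q + s \<in> pw E (Suc n)"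
      using q unfolding tors_def by blast
    obtain z where z: "length z = dim" "dg z = n" "cz z = q" using pw_cz[OF t(1)] by blast
    have "z \<in> U (max t t0)"
      unfolding U_def using t(2) z pw_antimono[OF sideal_nonzero, of t "max t t0"] by auto
    then have "z \<in> U t0" using t0[of "max t t0"] by simp
    then show ?thesis using z s unfolding U_def by auto
  qed
  then show ?thesis by blast
qed

lemma upset_tors: "upset dim {z. length z = dim \<and> cz z \<in> tors E (dg z)}"
proof (rule upset_family)
  fix m n x y assume x: "x \<in> tors E m" and y: "y \<in> pw E n"
  obtain t where t: "x \<in> pw E m" "\<And>s. s \<in> pw (S - {0}) t \<Longrightarrow> x + s \<in> pw E (Suc m)"
    using x unfolding tors_def by blast
  have "x + y + s \<in> pw E (Suc (m + n))" if "s \<in> pw (S - {0}) t" for s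
  proof -
    have "(x + s) + y \<in> pw E (Suc m + n)" using pw_add[OF E t(2)[OF that] y] .
    then show ?thesis by (simp add: add_ac)
  qed
  then show "x + y \<in> tors E (m + n)" unfolding tors_def using pw_add[OF E t(1) y] by blast
qed

text \<open>Dickson's lemma puts a torsion representation of degree at most \<open>M\<close> below
  \<open>a @ u\<close>. If \<open>a\<close> exceeds its monoid part by \<open>t0\<close> or more in
  total, the excess alone moves the point into the next power, so the point would not count.\<close>

lemma bounded_reps:
  "\<exists>L. \<forall>a u. length a = length gens0 \<longrightarrow> length u = length vs \<longrightarrow> cz (a @ u) \<in> tdeg E (sum_list u) \<longrightarrow> sum_list a \<le> L"
proof -
  let ?Z = "{z. length z = dim \<and> cz z \<in> tors E (dg z)}"
  obtain M where M: "\<And>z. z \<in> ?Z \<Longrightarrow> \<exists>b\<in>?Z. list_all2 (\<le>) b z \<and> sum_list b \<le> M"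
    using upset_bounded_basis[OF upset_tors] by blast
  obtain t0 where t0: "\<And>n q s. q \<in> tors E n \<Longrightarrow> s \<in> pw (S - {0}) t0 \<Longrightarrow> q + s \<in> pw E (Suc n)"
    using uniform_torsion by blast
  have "sum_list a \<le> M + t0"
    if len: "length a = length gens0" "length u = length vs" and T: "cz (a @ u) \<in> tdeg E (sum_list u)" for a u
  proof (rule ccontr)
    assume big: "\<not> sum_list a \<le> M + t0"
    have "a @ u \<in> ?Z" using len T by (simp add: dim_def dg_append tdeg_def)
    then obtain b where b: "b \<in> ?Z" "list_all2 (\<le>) b (a @ u)" "sum_list b \<le> M" using M by blast
    obtain a0 u0 where b0: "b = a0 @ u0" "length a0 = length gens0" "length u0 = length vs"
      using b(1) dim_split[of b] by blast
    have le: "list_all2 (\<le>) a0 a" "list_all2 (\<le>) u0 u" using b(2) b0 len by (auto simp: list_all2_append)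
    \<comment> \<open>Only the ideal part is raised to \<open>u\<close>, so that the comparison with
      \<open>a @ u\<close> takes place in one degree.\<close>
    have "list_all2 (\<le>) (a0 @ u0) (a0 @ u)" using le(2) by (intro list_all2_appendI) (auto simp: list_all2_refl)
    then have "a0 @ u \<in> ?Z" using upset_tors b(1) b0(1) unfolding upset_def by blast
    then have z1: "cz (a0 @ u) \<in> tors E (sum_list u)" using b0(2) by (simp add: dg_append)
    define c where "c = map2 (-) a a0"
    have lc: "length c = length gens0" "a = map2 (+) a0 c"
      using list_le_add_diff[OF le(1)] len(1) b0(2) by (auto simp: c_def)
    have sa: "sum_list a = sum_list a0 + sum_list c" using lc b0(2) sum_list_map2_add[of a0 c] by simp
    have "sum_list a0 \<le> M" using b(3) b0(1) by simp
    then have "t0 \<le> sum_list c" using sa big by simp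
    then have "comb c gens0 \<in> pw (S - {0}) t0"
      using comb_pw[OF sideal_nonzero gens0_S lc(1)] pw_antimono[OF sideal_nonzero] by blast
    then have "cz (a0 @ u) + comb c gens0 \<in> pw E (Suc (sum_list u))" using t0 z1 by blast
    moreover have "comb a gens0 = comb a0 gens0 + comb c gens0"
      using comb_add[of a0 gens0 c] lc b0(2) by simp
    ultimately have "cz (a @ u) \<in> pw E (Suc (sum_list u))"
      using cz_append[OF len(1), of u] cz_append[OF b0(2), of u] by (simp add: add_ac)
    then show False using T by (simp add: tdeg_def)
  qed
  then show ?thesis by blast
qed

definition L where "L = (SOME L. \<forall>a u. length a = length gens0 \<longrightarrow> length u = length vs \<longrightarrow>
   cz (a @ u) \<in> tdeg E (sum_list u) \<longrightarrow> sum_list a \<le> L)"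

lemma L: "length a = length gens0 \<Longrightarrow> length u = length vs \<Longrightarrow> cz (a @ u) \<in> tdeg E (sum_list u) \<Longrightarrow> sum_list a \<le> L"
  using someI_ex[OF bounded_reps] unfolding L_def by blast

lemma tdeg_pw: "q \<in> tdeg E n \<Longrightarrow> q \<in> pw E n"
  by (simp add: tdeg_def tors_def)

lemma tdeg_rep:
  assumes "q \<in> tdeg E n"
  obtains a u where "length a = length gens0" "length u = length vs" "sum_list u = n" "sum_list a \<le> L"
    "q = cz (a @ u)"
proof -
  obtain a u where au: "length a = length gens0" "length u = length vs" "sum_list u = n" "q = comb a gens0 + comb u vs"
    using pw_rep[OF tdeg_pw[OF assms]] by blast
  then have "q = cz (a @ u)" by (simp add: cz_append)
  moreover have "sum_list a \<le> L" using L[OF au(1,2)] calculation assms au(3) by simp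
  ultimately show ?thesis using that au by blast
qed

lemma finite_tdeg: "finite (tdeg E n)"
proof -
  let ?X = "{a :: nat list. length a = length gens0 \<and> sum_list a \<le> L} \<times> {u :: nat list. length u = length vs \<and> sum_list u = n}"
  have "tdeg E n \<subseteq> (\<lambda>(a, u). cz (a @ u)) ` ?X"
  proof
    fix q assume "q \<in> tdeg E n"
    then obtain a u where "length a = length gens0" "length u = length vs" "sum_list u = n" "sum_list a \<le> L"
      "q = cz (a @ u)" by (rule tdeg_rep)
    then show "q \<in> (\<lambda>(a, u). cz (a @ u)) ` ?X" by (intro image_eqI[of _ _ "(a, u)"]) auto
  qed
  moreover have "finite ?X" using finite_lists_sum_le finite_lists_sum by blast
  ultimately show ?thesis using finite_subset by blast
qed

lemma norm_comb_le:
  assumes "\<And>g. g \<in> set gs \<Longrightarrow> norm g \<le> B" "length a = length gs"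
  shows "norm (comb a gs) \<le> real (sum_list a) * B"
  using assms(2,1)
proof (induction a gs rule: list_induct2)
  case (Cons n a g gs)
  have "norm (comb (n # a) (g # gs)) \<le> norm (real n *\<^sub>R g) + norm (comb a gs)"
    unfolding comb_Cons by (rule norm_triangle_ineq)
  also have "\<dots> \<le> real n * B + real (sum_list a) * B"
    using Cons by (intro add_mono) (auto intro: mult_left_mono)
  finally show ?case by (simp add: distrib_right)
qed (simp add: comb_Nil)

text \<open>A representation uses at most \<open>L\<close> monoid generators and exactly
  \<open>n\<close> ideal generators, all of norm at most \<open>B\<close>.\<close>

lemma tdeg_norm_bound: "\<exists>C>0. \<forall>n. \<forall>q\<in>tdeg E n. norm q \<le> C * (real n + 1)"
proof -
  obtain B where B: "B > 0" "\<And>g. g \<in> set (gens0 @ vs) \<Longrightarrow> norm g \<le> B"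
    using finite_imp_bounded[of "set (gens0 @ vs)"] unfolding bounded_pos by auto
  have "norm q \<le> ((real L + 1) * B) * (real n + 1)" if q: "q \<in> tdeg E n" for n q
  proof -
    obtain a u where au: "length a = length gens0" "length u = length vs" "sum_list u = n" "sum_list a \<le> L"
      "q = cz (a @ u)" using q by (rule tdeg_rep)
    have "norm q \<le> real (sum_list (a @ u)) * B"
      unfolding au(5) cz_def by (rule norm_comb_le[OF B(2)]) (use au in auto)
    also have "\<dots> \<le> ((real L + 1) * (real n + 1)) * B"
    proof (intro mult_right_mono)
      have "real (sum_list (a @ u)) \<le> real L + real n" using au by simp
      also have "\<dots> \<le> (real L + 1) * (real n + 1)" by (simp add: algebra_simps)
      finally show "real (sum_list (a @ u)) \<le> (real L + 1) * (real n + 1)" .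
    qed (use B in simp)
    finally show ?thesis by (simp add: mult_ac)
  qed
  moreover have "(real L + 1) * B > 0" using B by simp
  ultimately show ?thesis by blast
qed

text \<open>Counting each point of \<open>tdeg E n\<close> by its lexicographically least representation turns the
  count into one over differences of upward closed sets.\<close>

lemma ev_mono_card_tdeg: "ev_mono (\<lambda>n. card (tdeg E n))"
proof -
  define Z where "Z = {z. length z = dim \<and> cz z \<in> tors E (dg z)}"
  define U1 where "U1 = {z. length z = dim \<and> cz z \<in> pw E (Suc (dg z))}"
  \<comment> \<open>Representations that are not lexicographically least for their exponent and
    degree.\<close>
  define U2 where "U2 = {z. length z = dim \<and> (\<exists>z'. length z' = dim \<and> dg z' = dg z \<and> cz z' = cz z \<and> lexl z' z)}"
  have upZ: "upset dim Z" unfolding Z_def by (rule upset_tors)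
  have upU1: "upset dim U1" unfolding U1_def
  proof (rule upset_family[where X = "\<lambda>n. pw E (Suc n)"])
    fix m n x y assume "x \<in> pw E (Suc m)" "y \<in> pw E n"
    then show "x + y \<in> pw E (Suc (m + n))" using pw_add[OF E, of x "Suc m" y n] by simp
  qed
  have upU2: "upset dim U2"
    unfolding upset_def
  proof (intro conjI ballI allI impI)
    fix z y assume z: "z \<in> U2" and zy: "list_all2 (\<le>) z y"
    have len: "length z = dim" "length y = dim" using z zy by (auto simp: U2_def list_all2_lengthD)
    obtain z' where z': "length z' = dim" "dg z' = dg z" "cz z' = cz z" "lexl z' z" using z unfolding U2_def by blast
    let ?w = "map2 (-) y z"
    have w: "length ?w = dim" using len by simp
    have y: "y = map2 (+) z ?w" by (rule list_le_add_diff[OF zy])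
    let ?y' = "map2 (+) z' ?w"
    have "lexl ?y' (map2 (+) z ?w)" using z'(4,1) len w by (intro lexl_add) auto
    then have "lexl ?y' y" using y by metis
    moreover have "dg ?y' = dg y" "cz ?y' = cz y"
      using cz_add[OF z'(1) w] cz_add[OF len(1) w] z'(2,3) y by metis+
    moreover have "length ?y' = dim" using z'(1) w by simp
    ultimately show "y \<in> U2" unfolding U2_def using len by blast
  qed (auto simp: U2_def)
  \<comment> \<open>Standard monomials, one for each element of \<open>tdeg E n\<close>.\<close>
  define Std where "Std n = {z \<in> Z - (U1 \<union> U2). dg z = n}" for n
  have bij: "bij_betw cz (Std n) (tdeg E n)" for n
  proof (rule bij_betwI')
    fix x y assume x: "x \<in> Std n" and y: "y \<in> Std n"
    have xy: "length x = dim" "length y = dim" "dg x = dg y" "x \<notin> U2" "y \<notin> U2"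
      using x y by (auto simp: Std_def Z_def)
    show "cz x = cz y \<longleftrightarrow> x = y"
    proof
      assume "cz x = cz y"
      then have "\<not> lexl x y" "\<not> lexl y x" using xy unfolding U2_def by auto
      then show "x = y" using lexl_total[of x y] xy by simp
    qed simp
    show "cz x \<in> tdeg E n" using x by (auto simp: Std_def Z_def U1_def tdeg_def)
  next
    fix q assume q: "q \<in> tdeg E n"
    let ?X = "{z. length z = dim \<and> dg z = n \<and> cz z = q}"
    have "?X \<noteq> {}" using pw_cz[OF tdeg_pw[OF q]] by blast
    then obtain m where m: "m \<in> ?X" "\<forall>x\<in>?X. \<not> lexl x m" using lexl_min[of ?X dim] by blast
    have "m \<in> Z" "m \<notin> U1" using m(1) q by (auto simp: Z_def U1_def tdeg_def)
    moreover have "m \<notin> U2" using m unfolding U2_def by auto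
    ultimately show "\<exists>x\<in>Std n. q = cz x" using m(1) by (intro bexI[of _ m]) (auto simp: Std_def)
  qed
  \<comment> \<open>The finitely many monoid parts that occur. For each of them the ideal parts form
    a difference of upward closed sets, to which \<open>ev_mono_card_upset_diff\<close>
    applies.\<close>
  define As where "As = {a :: nat list. length a = length gens0 \<and> sum_list a \<le> L}"
  define h where "h a n = {u \<in> {u. a @ u \<in> Z} - {u. a @ u \<in> U1 \<union> U2}. sum_list u = n}" for a n
  have split: "Std n = (\<Union>a\<in>As. (@) a ` h a n)" for n
  proof
    show "Std n \<subseteq> (\<Union>a\<in>As. (@) a ` h a n)"
    proof
      fix z assume z: "z \<in> Std n"
      then have "length z = dim" by (simp add: Std_def Z_def)
      then obtain a u where au: "z = a @ u" "length a = length gens0" "length u = length vs" by (rule dim_split)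
      have n: "sum_list u = n" using z au by (auto simp: Std_def dg_append)
      have "cz z \<in> tdeg E n" using bij_betwE[OF bij] z by blast
      then have "a \<in> As" using L[OF au(2,3)] au n by (simp add: As_def)
      moreover have "u \<in> h a n" using z au n by (auto simp: Std_def h_def)
      ultimately show "z \<in> (\<Union>a\<in>As. (@) a ` h a n)" using au by blast
    qed
    show "(\<Union>a\<in>As. (@) a ` h a n) \<subseteq> Std n"
    proof
      fix z assume "z \<in> (\<Union>a\<in>As. (@) a ` h a n)"
      then obtain a u where au: "a \<in> As" "u \<in> h a n" "z = a @ u" by blast
      then have "dg z = n" by (simp add: h_def As_def dg_append)
      then show "z \<in> Std n" using au by (simp add: Std_def h_def)
    qed
  qed
  have up: "upset (length vs) {u. a @ u \<in> Y}" if "upset dim Y" "a \<in> As" for Y a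
    unfolding upset_def
  proof (intro conjI ballI allI impI)
    show "{u. a @ u \<in> Y} \<subseteq> {u. length u = length vs}"
      using that by (auto simp: upset_def dim_def As_def)
    fix u v assume u: "u \<in> {u. a @ u \<in> Y}" and uv: "list_all2 (\<le>) u v"
    have "list_all2 (\<le>) (a @ u) (a @ v)" using uv by (intro list_all2_appendI) (auto simp: list_all2_refl)
    then show "v \<in> {u. a @ u \<in> Y}" using that(1) u unfolding upset_def by blast
  qed
  have upU: "upset dim (U1 \<union> U2)" using upU1 upU2 unfolding upset_def by blast
  have "ev_mono (\<lambda>n. \<Sum>a\<in>As. card (h a n))"
    unfolding h_def by (intro ev_mono_sum ev_mono_card_upset_diff[where k = "length vs"] up upZ upU)
  moreover have "(\<Sum>a\<in>As. card (h a n)) = card (tdeg E n)" for n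
  proof -
    have finh: "finite (h a n)" if "a \<in> As" for a
    proof (rule finite_subset[OF _ finite_lists_sum])
      show "h a n \<subseteq> {u. length u = length vs \<and> sum_list u = n}"
        using up[OF upZ that] by (auto simp: h_def upset_def)
    qed
    have "card (tdeg E n) = card (Std n)" using bij_betw_same_card[OF bij] by simp
    also have "\<dots> = (\<Sum>a\<in>As. card ((@) a ` h a n))"
      unfolding split
    proof (rule card_UN_disjoint)
      show "finite As" unfolding As_def by (rule finite_lists_sum_le)
      show "\<forall>a\<in>As. finite ((@) a ` h a n)" using finh by blast
      show "\<forall>a\<in>As. \<forall>b\<in>As. a \<noteq> b \<longrightarrow> (@) a ` h a n \<inter> (@) b ` h b n = {}" by (auto simp: As_def)
    qed
    also have "\<dots> = (\<Sum>a\<in>As. card (h a n))" by (intro sum.cong refl card_image) (auto simp: inj_on_def)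
    finally show ?thesis by simp
  qed
  ultimately show ?thesis by simp
qed

end

section \<open>The Newton polyhedron\<close>

text \<open>Homogenization: points of \<open>V\<close> are lifted to height one and directions in
  \<open>W\<close> to height zero. The cone they generate is polyhedral, and the set in question is
  its slice at height one.\<close>

lemma polyhedron_hull_plus_cone:
  fixes V W :: "(real ^ 'n) set"
  assumes fV: "finite V" and fW: "finite W" and ne: "V \<noteq> {}"
  shows "polyhedron {x + y | x y. x \<in> convex hull V \<and> y \<in> convex_cone hull W}" (is "polyhedron ?P")
proof -
  let ?V = "(\<lambda>v. (v, 1 :: real)) ` V"
  let ?W = "(\<lambda>w. (w, 0 :: real)) ` W"
  have injV: "inj_on (\<lambda>v. (v, 1 :: real)) V" and injW: "inj_on (\<lambda>w. (w, 0 :: real)) W"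
    by (auto simp: inj_on_def)
  have mem: "(x, 1) \<in> convex_cone hull (?V \<union> ?W) \<longleftrightarrow> x \<in> ?P" for x
  proof
    assume "(x, 1) \<in> convex_cone hull (?V \<union> ?W)"
    then obtain a b where ab: "a \<in> convex_cone hull ?V" "b \<in> convex_cone hull ?W" "(x, 1) = a + b"
      unfolding convex_cone_hull_Un by blast
    obtain c where c: "\<forall>v\<in>?V. 0 \<le> c v" "a = (\<Sum>v\<in>?V. c v *\<^sub>R v)"
      using ab(1) fV unfolding convex_cone_hull_finite[OF finite_imageI[OF fV]] by blast
    obtain e where e: "\<forall>w\<in>?W. 0 \<le> e w" "b = (\<Sum>w\<in>?W. e w *\<^sub>R w)"
      using ab(2) fW unfolding convex_cone_hull_finite[OF finite_imageI[OF fW]] by blast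
    have a: "a = (\<Sum>v\<in>V. c (v, 1) *\<^sub>R v, \<Sum>v\<in>V. c (v, 1))"
      unfolding c(2) sum.reindex[OF injV] o_def by (simp add: sum_prod)
    have b: "b = (\<Sum>w\<in>W. e (w, 0) *\<^sub>R w, 0)"
      unfolding e(2) sum.reindex[OF injW] o_def by (simp add: sum_prod)
    have "(\<Sum>v\<in>V. c (v, 1)) = 1" "x = (\<Sum>v\<in>V. c (v, 1) *\<^sub>R v) + (\<Sum>w\<in>W. e (w, 0) *\<^sub>R w)"
      using ab(3) a b by auto
    moreover have "(\<Sum>v\<in>V. c (v, 1) *\<^sub>R v) \<in> convex hull V"
      unfolding convex_hull_finite[OF fV] using calculation(1) c(1)
      by (intro CollectI exI[of _ "\<lambda>v. c (v, 1)"]) auto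
    moreover have "(\<Sum>w\<in>W. e (w, 0) *\<^sub>R w) \<in> convex_cone hull W"
      unfolding convex_cone_hull_finite[OF fW] using e(1)
      by (intro CollectI exI[of _ "\<lambda>w. e (w, 0)"]) auto
    ultimately show "x \<in> ?P" by blast
  next
    assume "x \<in> ?P"
    then obtain y z where yz: "x = y + z" "y \<in> convex hull V" "z \<in> convex_cone hull W" by blast
    obtain c where c: "\<forall>v\<in>V. 0 \<le> c v" "sum c V = 1" "y = (\<Sum>v\<in>V. c v *\<^sub>R v)"
      using yz(2) unfolding convex_hull_finite[OF fV] by blast
    obtain e where e: "\<forall>w\<in>W. 0 \<le> e w" "z = (\<Sum>w\<in>W. e w *\<^sub>R w)"
      using yz(3) unfolding convex_cone_hull_finite[OF fW] by blast
    have "(y, 1) = (\<Sum>v\<in>?V. c (fst v) *\<^sub>R v)"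
      unfolding sum.reindex[OF injV] o_def using c by (simp add: sum_prod)
    then have 1: "(y, 1) \<in> convex_cone hull ?V"
      unfolding convex_cone_hull_finite[OF finite_imageI[OF fV]] using c(1)
      by (intro CollectI exI[of _ "\<lambda>v. c (fst v)"]) auto
    have "(z, 0) = (\<Sum>w\<in>?W. e (fst w) *\<^sub>R w)"
      unfolding sum.reindex[OF injW] o_def using e by (simp add: sum_prod)
    then have 2: "(z, 0) \<in> convex_cone hull ?W"
      unfolding convex_cone_hull_finite[OF finite_imageI[OF fW]] using e(1)
      by (intro CollectI exI[of _ "\<lambda>w. e (fst w)"]) auto
    have "(x, 1) = (y, 1) + (z, 0 :: real)" using yz(1) by simp
    then show "(x, 1) \<in> convex_cone hull (?V \<union> ?W)" unfolding convex_cone_hull_Un using 1 2 by blast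
  qed
  have "polyhedron (convex_cone hull (?V \<union> ?W))"
    by (rule polyhedron_convex_cone_hull) (use fV fW in simp)
  then obtain F a b where F: "finite F" "convex_cone hull (?V \<union> ?W) = \<Inter> F"
    "\<And>h. h \<in> F \<Longrightarrow> h = {x. a h \<bullet> x \<le> b h}"
    unfolding polyhedron_def by metis
  define hs where "hs h = {x. fst (a h) \<bullet> x \<le> b h - snd (a h)}" for h
  have P: "x \<in> ?P \<longleftrightarrow> (\<forall>h\<in>F. x \<in> hs h)" for x
  proof -
    have "x \<in> ?P \<longleftrightarrow> (\<forall>h\<in>F. (x, 1) \<in> h)" using mem F(2) by blast
    also have "\<dots> \<longleftrightarrow> (\<forall>h\<in>F. x \<in> hs h)"
    proof (rule ball_cong[OF refl])
      fix h assume "h \<in> F"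
      then have "(x, 1) \<in> h \<longleftrightarrow> a h \<bullet> (x, 1) \<le> b h" using F(3) by blast
      also have "\<dots> \<longleftrightarrow> x \<in> hs h" by (simp add: hs_def inner_prod_def le_diff_eq)
      finally show "(x, 1) \<in> h \<longleftrightarrow> x \<in> hs h" .
    qed
    finally show ?thesis .
  qed
  obtain v where "v \<in> V" using ne by blast
  then have "v \<in> convex hull V" by (rule hull_inc)
  then have "v + 0 \<in> ?P" using convex_cone_hull_contains_0 by blast
  then have triv: "hs h = UNIV" if "h \<in> F" "fst (a h) = 0" for h
    using that P[of "v + 0"] unfolding hs_def by auto
  have "?P = \<Inter> (hs ` {h \<in> F. fst (a h) \<noteq> 0})"
    using P triv by blast
  moreover have "finite (hs ` {h \<in> F. fst (a h) \<noteq> 0})" using F(1) by simp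
  ultimately show ?thesis unfolding polyhedron_def hs_def by blast
qed

section \<open>Facet functionals of the Newton polyhedron\<close>

context newton_data
begin

abbreviation V where "V \<equiv> min_gens E"

text \<open>The set \<open>newton_polyhedron\<close>, expressed by exponents without the
  ring.\<close>

definition PP where "PP = {x + y | x y. x \<in> convex hull V \<and> y \<in> \<sigma>}"

lemma finite_V: "finite V"
  by (rule finite_min_gens[OF E])

lemma V_E: "V \<subseteq> E"
  by (auto simp: min_gens_def)

lemma V_sigma: "V \<subseteq> \<sigma>"
  using V_E ES S_sigma by blast

lemma PP_sigma: "PP \<subseteq> \<sigma>"
proof -
  have "convex hull V \<subseteq> \<sigma>" using V_sigma sigma_convex by (rule hull_minimal)
  then show ?thesis unfolding PP_def using sigma_add by blast
qed

lemma PP_add: "x \<in> PP \<Longrightarrow> y \<in> \<sigma> \<Longrightarrow> x + y \<in> PP"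
proof -
  assume "x \<in> PP" and y: "y \<in> \<sigma>"
  then obtain u v where uv: "x = u + v" "u \<in> convex hull V" "v \<in> \<sigma>" unfolding PP_def by blast
  have "v + y \<in> \<sigma>" using sigma_add uv(3) y .
  moreover have "x + y = u + (v + y)" using uv(1) by simp
  ultimately show "x + y \<in> PP" unfolding PP_def using uv(2) by blast
qed

lemma E_PP: "E \<subseteq> PP"
proof
  fix e assume "e \<in> E"
  then obtain v s where vs: "v \<in> V" "s \<in> S" "e = v + s" using E_vs unfolding vs(1) by blast
  then have "v \<in> convex hull V" by (intro hull_inc)
  then show "e \<in> PP" unfolding PP_def using vs S_sigma by blast
qed

text \<open>Facets whose hyperplane misses the origin are normalised to
  \<open>l \<bullet> x = 1\<close>. The other facets lie in hyperplanes through the origin, and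
  their inequalities follow from \<open>x \<in> \<sigma>\<close>.\<close>

definition facet_system where
  "facet_system Ls \<longleftrightarrow> finite Ls \<and> (\<forall>l\<in>Ls. \<forall>x\<in>\<sigma>. 0 \<le> l \<bullet> x) \<and> PP = {x \<in> \<sigma>. \<forall>l\<in>Ls. 1 \<le> l \<bullet> x} \<and>
    (\<forall>l\<in>Ls. PP \<inter> {x. l \<bullet> x = 1} facet_of PP) \<and> finite {C. C facet_of PP} \<and>
    (\<forall>C. C facet_of PP \<longrightarrow> (\<exists>l\<in>Ls. C = PP \<inter> {x. l \<bullet> x = 1}) \<or> (\<exists>a. a \<noteq> 0 \<and> C \<subseteq> {x. a \<bullet> x = 0}))"

lemma facet_system_exists:
  assumes ne: "E \<noteq> {}"
  shows "\<exists>Ls. facet_system Ls"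
proof -
  obtain v0 where v0: "v0 \<in> V" using ne E_vs vs(1) by blast
  have "PP = {x + y | x y. x \<in> convex hull V \<and> y \<in> convex_cone hull W}"
    by (simp only: PP_def sigma_W[symmetric])
  then have "polyhedron PP" using polyhedron_hull_plus_cone[OF finite_V finite_W] v0 by auto
  \<comment> \<open>An irredundant description, so that each inequality defines a facet.\<close>
  then obtain F where F: "finite F" "PP = affine hull PP \<inter> \<Inter>F"
    "\<And>h. h \<in> F \<Longrightarrow> \<exists>a b. a \<noteq> 0 \<and> h = {x. a \<bullet> x \<le> b}"
    "\<And>F'. F' \<subset> F \<Longrightarrow> PP \<subset> affine hull PP \<inter> \<Inter>F'"
    unfolding polyhedron_Int_affine_minimal by metis
  then obtain a b where ab: "\<And>h. h \<in> F \<Longrightarrow> a h \<noteq> 0 \<and> h = {x. a h \<bullet> x \<le> b h}" by metis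
  have v0P: "v0 \<in> PP" using v0 V_E E_PP by blast
  have "(+) v0 ` \<sigma> \<subseteq> PP" using PP_add[OF v0P] by blast
  then have "aff_dim \<sigma> \<le> aff_dim PP" by (metis aff_dim_subset aff_dim_translation_eq)
  then have "aff_dim PP = int CARD('d)" using full aff_dim_le_DIM[of PP] by simp
  then have "affine hull PP = UNIV" using aff_dim_eq_full[of PP] by simp
  then have PF: "x \<in> PP \<longleftrightarrow> (\<forall>h\<in>F. a h \<bullet> x \<le> b h)" for x
    using F(2) ab by blast
  have fac: "C facet_of PP \<longleftrightarrow> (\<exists>h. h \<in> F \<and> C = PP \<inter> {x. a h \<bullet> x = b h})" for C
    by (rule facet_of_polyhedron_explicit[OF F(1,2) ab F(4)])
  \<comment> \<open>Otherwise a long translation of \<open>v0\<close> along \<open>s\<close> would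
    leave the polyhedron.\<close>
  have neg: "a h \<bullet> s \<le> 0" if h: "h \<in> F" and s: "s \<in> \<sigma>" for h s
  proof (rule ccontr)
    assume pos: "\<not> a h \<bullet> s \<le> 0"
    define t where "t = (\<bar>b h - a h \<bullet> v0\<bar> + 1) / (a h \<bullet> s)"
    have "t \<ge> 0" using pos by (simp add: t_def)
    then have "v0 + t *\<^sub>R s \<in> PP" using PP_add v0P s sigma_scale by blast
    then have "a h \<bullet> (v0 + t *\<^sub>R s) \<le> b h" using PF h by blast
    moreover have "t * (a h \<bullet> s) = \<bar>b h - a h \<bullet> v0\<bar> + 1" using pos by (simp add: t_def)
    ultimately show False by (simp add: inner_add_right)
  qed
  have ble: "b h \<le> 0" if h: "h \<in> F" for h
  proof -
    have "PP \<inter> {x. a h \<bullet> x = b h} facet_of PP" using fac h by blast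
    then obtain x where "x \<in> PP" "a h \<bullet> x = b h" by (auto simp: facet_of_def)
    then show ?thesis using neg[OF h, of x] PP_sigma by auto
  qed
  \<comment> \<open>Division by a negative \<open>b h\<close> turns
    \<open>a h \<bullet> x \<le> b h\<close> into \<open>1 \<le> l h \<bullet> x\<close>.\<close>
  define l where "l h = (1 / b h) *\<^sub>R a h" for h
  define Lo where "Lo = {h \<in> F. b h < 0}"
  have l1: "1 \<le> l h \<bullet> x \<longleftrightarrow> a h \<bullet> x \<le> b h" "l h \<bullet> x = 1 \<longleftrightarrow> a h \<bullet> x = b h" if "h \<in> Lo" for h x
    using that by (auto simp: l_def Lo_def field_simps)
  have r1: "PP = {x \<in> \<sigma>. \<forall>k\<in>l ` Lo. 1 \<le> k \<bullet> x}"
  proof (rule Set.set_eqI, rule iffI)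
    fix x assume x: "x \<in> PP"
    then have "1 \<le> l h \<bullet> x" if "h \<in> Lo" for h using PF l1(1)[OF that] that by (auto simp: Lo_def)
    then show "x \<in> {x \<in> \<sigma>. \<forall>k\<in>l ` Lo. 1 \<le> k \<bullet> x}" using x PP_sigma by blast
  next
    fix x assume x: "x \<in> {x \<in> \<sigma>. \<forall>k\<in>l ` Lo. 1 \<le> k \<bullet> x}"
    have "a h \<bullet> x \<le> b h" if h: "h \<in> F" for h
    proof (cases "h \<in> Lo")
      case True
      then show ?thesis using x l1(1) by blast
    next
      case False
      then have "b h = 0" using ble[OF h] h by (simp add: Lo_def)
      then show ?thesis using neg[OF h] x by simp
    qed
    then show "x \<in> PP" using PF by blast
  qed
  have r2: "0 \<le> k \<bullet> x" if k: "k \<in> l ` Lo" and x: "x \<in> \<sigma>" for k x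
  proof -
    obtain h where h: "h \<in> F" "b h < 0" "k = l h" using k by (auto simp: Lo_def)
    then show ?thesis using neg[OF h(1) x] by (simp add: l_def divide_nonpos_neg)
  qed
  have r3: "PP \<inter> {x. k \<bullet> x = 1} facet_of PP" if k: "k \<in> l ` Lo" for k
  proof -
    obtain h where h: "h \<in> Lo" "k = l h" using k by blast
    then have "PP \<inter> {x. k \<bullet> x = 1} = PP \<inter> {x. a h \<bullet> x = b h}" using l1(2) by auto
    then show ?thesis using fac h by (auto simp: Lo_def)
  qed
  have r4: "finite {C. C facet_of PP}"
    unfolding fac using F(1) by simp
  have r5: "(\<exists>k\<in>l ` Lo. C = PP \<inter> {x. k \<bullet> x = 1}) \<or> (\<exists>a. a \<noteq> 0 \<and> C \<subseteq> {x. a \<bullet> x = 0})"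
    if C: "C facet_of PP" for C
  proof -
    obtain h where h: "h \<in> F" "C = PP \<inter> {x. a h \<bullet> x = b h}" using C fac by blast
    show ?thesis
    proof (cases "h \<in> Lo")
      case True
      then have "C = PP \<inter> {x. l h \<bullet> x = 1}" using h(2) l1(2) by auto
      then show ?thesis using True by blast
    next
      case False
      then have "b h = 0" using ble[OF h(1)] h(1) by (simp add: Lo_def)
      then have "C \<subseteq> {x. a h \<bullet> x = 0}" "a h \<noteq> 0" using h ab by auto
      then show ?thesis by blast
    qed
  qed
  have r6: "finite (l ` Lo)" using F(1) by (simp add: Lo_def)
  show ?thesis unfolding facet_system_def
    by (rule exI[of _ "l ` Lo"], intro conjI ballI allI impI) (fact r6, erule (1) r2, rule r1, erule r3, rule r4, erule r5)
qed

definition Ls where "Ls = (SOME Ls. facet_system Ls)"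

end

locale newton_nonempty = newton_data \<sigma> E for \<sigma> :: "(real ^ 'd) set" and E +
  assumes ne: "E \<noteq> {}"
begin

lemma facet_system_Ls: "facet_system Ls"
  unfolding Ls_def by (rule someI_ex[OF facet_system_exists[OF ne]])

lemmas Ls_props = facet_system_Ls[unfolded facet_system_def]

lemma finite_Ls: "finite Ls"
  by (rule Ls_props[THEN conjunct1])

lemma Ls_nonneg: "l \<in> Ls \<Longrightarrow> x \<in> \<sigma> \<Longrightarrow> 0 \<le> l \<bullet> x"
  by (rule Ls_props[THEN conjunct2, THEN conjunct1, rule_format])

lemma PP_Ls: "PP = {x \<in> \<sigma>. \<forall>l\<in>Ls. 1 \<le> l \<bullet> x}"
  by (rule Ls_props[THEN conjunct2, THEN conjunct2, THEN conjunct1])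

lemma Ls_facet: "l \<in> Ls \<Longrightarrow> PP \<inter> {x. l \<bullet> x = 1} facet_of PP"
  by (rule Ls_props[THEN conjunct2, THEN conjunct2, THEN conjunct2, THEN conjunct1, rule_format])

lemma finite_facets: "finite {C. C facet_of PP}"
  by (rule Ls_props[THEN conjunct2, THEN conjunct2, THEN conjunct2, THEN conjunct2, THEN conjunct1])

lemma facet_cases:
  "C facet_of PP \<Longrightarrow> (\<exists>l\<in>Ls. C = PP \<inter> {x. l \<bullet> x = 1}) \<or> (\<exists>a. a \<noteq> 0 \<and> C \<subseteq> {x. a \<bullet> x = 0})"
  by (rule Ls_props[THEN conjunct2, THEN conjunct2, THEN conjunct2, THEN conjunct2, THEN conjunct2, rule_format])

definition Lb where "Lb = {l \<in> Ls. \<forall>x\<in>\<sigma>. x \<noteq> 0 \<longrightarrow> 0 < l \<bullet> x}"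

text \<open>If \<open>l\<close> vanishes at a nonzero \<open>s\<close> of the cone, the facet
  contains a half-line in direction \<open>s\<close>; otherwise \<open>sigma_coercive\<close> bounds
  it.\<close>

lemma bounded_facet_iff:
  assumes l: "l \<in> Ls"
  shows "bounded (PP \<inter> {x. l \<bullet> x = 1}) \<longleftrightarrow> l \<in> Lb"
proof
  assume bd: "bounded (PP \<inter> {x. l \<bullet> x = 1})"
  have "0 < l \<bullet> s" if s: "s \<in> \<sigma>" "s \<noteq> 0" for s
  proof (rule ccontr)
    assume "\<not> 0 < l \<bullet> s"
    then have ls: "l \<bullet> s = 0" using Ls_nonneg[OF l s(1)] by simp
    obtain x where x: "x \<in> PP" "l \<bullet> x = 1" using Ls_facet[OF l] by (auto simp: facet_of_def)
    obtain B where B: "\<And>y. y \<in> PP \<inter> {x. l \<bullet> x = 1} \<Longrightarrow> norm y \<le> B" using bd unfolding bounded_iff by blast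
    define t where "t = (\<bar>B\<bar> + norm x + 1) / norm s"
    have t: "t \<ge> 0" using s by (simp add: t_def)
    have "x + t *\<^sub>R s \<in> PP \<inter> {x. l \<bullet> x = 1}"
      using PP_add[OF x(1) sigma_scale[OF s(1) t]] x(2) ls by (simp add: inner_add_right)
    then have "norm (x + t *\<^sub>R s) \<le> B" by (rule B)
    moreover have "norm (t *\<^sub>R s) \<le> norm (x + t *\<^sub>R s) + norm x"
      using norm_triangle_ineq4[of "x + t *\<^sub>R s" x] by simp
    moreover have "norm (t *\<^sub>R s) = \<bar>B\<bar> + norm x + 1" using s t by (simp add: t_def)
    ultimately show False by linarith
  qed
  then show "l \<in> Lb" using l by (simp add: Lb_def)
next
  assume "l \<in> Lb"
  then obtain c where c: "c > 0" "\<And>x. x \<in> \<sigma> \<Longrightarrow> c * norm x \<le> l \<bullet> x"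
    using sigma_coercive[of l] by (auto simp: Lb_def)
  have "norm x \<le> 1 / c" if "x \<in> PP \<inter> {x. l \<bullet> x = 1}" for x
  proof -
    have "c * norm x \<le> 1" using c(2)[of x] that PP_sigma by auto
    then show ?thesis using c(1) by (simp add: field_simps)
  qed
  then show "bounded (PP \<inter> {x. l \<bullet> x = 1})" unfolding bounded_iff by blast
qed

text \<open>The union of the pyramids over bounded facets off the origin, by inequalities:
  \<open>l\<close> has the least value at \<open>x\<close> among all functionals, and this value is
  at most one.\<close>

definition Y where "Y = {x \<in> \<sigma>. \<exists>l\<in>Lb. l \<bullet> x \<le> 1 \<and> (\<forall>l'\<in>Ls. l \<bullet> x \<le> l' \<bullet> x)}"

text \<open>Dividing a nonzero \<open>x\<close> by \<open>l \<bullet> x\<close> puts it on the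
  facet, because no other functional is smaller than \<open>l\<close> there.\<close>

lemma pyr_facet:
  assumes l: "l \<in> Lb"
  shows "pyr (PP \<inter> {x. l \<bullet> x = 1}) = {x \<in> \<sigma>. l \<bullet> x \<le> 1 \<and> (\<forall>l'\<in>Ls. l \<bullet> x \<le> l' \<bullet> x)}" (is "pyr ?F = ?R")
proof
  have lL: "l \<in> Ls" using l by (simp add: Lb_def)
  have "convex PP"
  proof -
    have "PP = \<sigma> \<inter> (\<Inter>k\<in>Ls. {x. 1 \<le> k \<bullet> x})" using PP_Ls by auto
    then show ?thesis using sigma_convex convex_halfspace_ge by (auto intro!: convex_Int convex_INT)
  qed
  then have cF: "convex ?F" using convex_hyperplane by (intro convex_Int)
  have R: "?R = \<sigma> \<inter> {x. l \<bullet> x \<le> 1} \<inter> (\<Inter>k\<in>Ls. {x. (l - k) \<bullet> x \<le> 0})"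
    by (auto simp: inner_diff_left)
  have cR: "convex ?R"
    unfolding R using sigma_convex convex_halfspace_le by (intro convex_Int convex_INT) auto
  show "pyr ?F \<subseteq> ?R"
    unfolding pyr_def
  proof (rule hull_minimal)
    show "insert 0 ?F \<subseteq> ?R" using PP_Ls lL by auto
    show "convex ?R" by (rule cR)
  qed
  show "?R \<subseteq> pyr ?F"
  proof
    fix x assume x: "x \<in> ?R"
    have 0: "0 \<in> pyr ?F" unfolding pyr_def by (intro hull_inc) simp
    show "x \<in> pyr ?F"
    proof (cases "x = 0")
      case False
      then have pos: "0 < l \<bullet> x" using l x by (simp add: Lb_def)
      define y where "y = (1 / (l \<bullet> x)) *\<^sub>R x"
      have "1 \<le> k \<bullet> y" if "k \<in> Ls" for k using x that pos by (simp add: y_def pos_le_divide_eq)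
      moreover have "y \<in> \<sigma>" unfolding y_def using x pos by (intro sigma_scale) auto
      moreover have "l \<bullet> y = 1" using pos by (simp add: y_def)
      ultimately have "y \<in> ?F" using PP_Ls by blast
      then have "y \<in> pyr ?F" unfolding pyr_def by (intro hull_inc) simp
      then have "(1 - l \<bullet> x) *\<^sub>R 0 + (l \<bullet> x) *\<^sub>R y \<in> pyr ?F"
        using 0 x pos unfolding pyr_def by (intro convexD_alt[OF convex_convex_hull]) auto
      moreover have "(l \<bullet> x) *\<^sub>R y = x" using pos by (simp add: y_def)
      ultimately show ?thesis by simp
    qed (use 0 in simp)
  qed
qed

lemma bounded_Y: "bounded Y" and closed_Y: "closed Y"
proof -
  have Y: "Y = (\<Union>l\<in>Lb. {x \<in> \<sigma>. l \<bullet> x \<le> 1 \<and> (\<forall>l'\<in>Ls. l \<bullet> x \<le> l' \<bullet> x)})" by (auto simp: Y_def)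
  have fin: "finite Lb" using finite_Ls by (simp add: Lb_def)
  show "bounded Y"
    unfolding Y
  proof (intro bounded_UN ballI fin)
    fix l assume l: "l \<in> Lb"
    then have "bounded (PP \<inter> {x. l \<bullet> x = 1})" using bounded_facet_iff by (simp add: Lb_def)
    then have "bounded (pyr (PP \<inter> {x. l \<bullet> x = 1}))" unfolding pyr_def by (simp add: bounded_convex_hull)
    then show "bounded {x \<in> \<sigma>. l \<bullet> x \<le> 1 \<and> (\<forall>l'\<in>Ls. l \<bullet> x \<le> l' \<bullet> x)}" by (simp only: pyr_facet[OF l])
  qed
  have "closed {x \<in> \<sigma>. l \<bullet> x \<le> 1 \<and> (\<forall>l'\<in>Ls. l \<bullet> x \<le> l' \<bullet> x)}" for l
  proof -
    have "{x \<in> \<sigma>. l \<bullet> x \<le> 1 \<and> (\<forall>l'\<in>Ls. l \<bullet> x \<le> l' \<bullet> x)} = \<sigma> \<inter> {x. l \<bullet> x \<le> 1} \<inter> (\<Inter>k\<in>Ls. {x. (l - k) \<bullet> x \<le> 0})"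
      by (auto simp: inner_diff_left)
    then show ?thesis
      using sigma_closed closed_halfspace_le by (auto intro!: closed_Int closed_INT)
  qed
  then show "closed Y" unfolding Y using fin by (intro closed_UN) auto
qed

lemma Y_lmeasurable: "Y \<in> lmeasurable"
  using bounded_Y closed_Y by (simp add: compact_eq_bounded_closed lmeasurable_compact)

text \<open>A pyramid over a facet lying on a hyperplane through the origin is a null set.\<close>

lemma measure_pyr:
  "measure lebesgue (\<Union> {pyr F | F. F facet_of PP \<and> bounded F}) = measure lebesgue Y" (is "measure lebesgue ?U = _")
proof (rule measure_negligible_symdiff[OF Y_lmeasurable])
  have "Y \<subseteq> ?U"
  proof
    fix x assume "x \<in> Y"
    then obtain l where l: "l \<in> Lb" "x \<in> {x \<in> \<sigma>. l \<bullet> x \<le> 1 \<and> (\<forall>l'\<in>Ls. l \<bullet> x \<le> l' \<bullet> x)}"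
      by (auto simp: Y_def)
    then have "x \<in> pyr (PP \<inter> {x. l \<bullet> x = 1})" using pyr_facet by blast
    moreover have "l \<in> Ls" using l by (simp add: Lb_def)
    ultimately show "x \<in> ?U" using Ls_facet bounded_facet_iff l(1) by blast
  qed
  then have 1: "Y - ?U = {}" by blast
  let ?Ns = "{C. C facet_of PP \<and> (\<exists>a. a \<noteq> 0 \<and> C \<subseteq> {x. a \<bullet> x = 0})}"
  have "?U - Y \<subseteq> (\<Union>C\<in>?Ns. pyr C)"
  proof
    fix x assume x: "x \<in> ?U - Y"
    then obtain C where C: "C facet_of PP" "bounded C" "x \<in> pyr C" by blast
    have "\<not> (\<exists>l\<in>Ls. C = PP \<inter> {x. l \<bullet> x = 1})"
    proof
      assume "\<exists>l\<in>Ls. C = PP \<inter> {x. l \<bullet> x = 1}"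
      then obtain l where l: "l \<in> Ls" "C = PP \<inter> {x. l \<bullet> x = 1}" by blast
      then have "l \<in> Lb" using bounded_facet_iff C(2) by simp
      then show False using pyr_facet C(3) l(2) x by (auto simp: Y_def)
    qed
    then show "x \<in> (\<Union>C\<in>?Ns. pyr C)" using facet_cases[OF C(1)] C by blast
  qed
  moreover have "negligible (\<Union>C\<in>?Ns. pyr C)"
  proof (rule negligible_Union)
    show "finite (pyr ` ?Ns)" using finite_facets by (auto intro: finite_subset)
    fix T assume "T \<in> pyr ` ?Ns"
    then obtain C a where C: "T = pyr C" "a \<noteq> 0" "C \<subseteq> {x. a \<bullet> x = 0}" by blast
    have "pyr C \<subseteq> {x. a \<bullet> x = 0}"
      unfolding pyr_def using C(3) convex_hyperplane by (intro hull_minimal) auto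
    moreover have "negligible {x. a \<bullet> x = 0}" using C(2) by (intro negligible_hyperplane) simp
    ultimately show "negligible T" unfolding C(1) using negligible_subset by blast
  qed
  ultimately have "negligible (?U - Y)" using negligible_subset by blast
  then show "negligible (Y - ?U \<union> (?U - Y))" unfolding 1 by simp
qed

lemma pw_Ls:
  assumes "q \<in> pw E n" "l \<in> Ls"
  shows "real n \<le> l \<bullet> q"
  using assms(1)
proof (induction n arbitrary: q)
  case 0
  then show ?case using Ls_nonneg[OF assms(2)] S_sigma by simp
next
  case (Suc n)
  then obtain a b where ab: "q = a + b" "a \<in> pw E n" "b \<in> E" unfolding pw.simps by blast
  have "1 \<le> l \<bullet> b" using ab(3) E_PP PP_Ls assms(2) by blast
  then show ?case using Suc.IH[OF ab(2)] ab(1) by (simp add: inner_add_right)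
qed

text \<open>Rounding down the coefficients of a convex combination loses at most one generator for each
  vertex, so the integral closure of the powers is reached up to a bounded shift.\<close>

lemma pw_of_Ls:
  assumes q: "q \<in> S" and large: "\<And>l. l \<in> Ls \<Longrightarrow> real (n + card V) \<le> l \<bullet> q"
  shows "q \<in> pw E n"
proof (cases "n + card V = 0")
  case True
  then show ?thesis using q by simp
next
  case False
  define N where "N = real (n + card V)"
  have N: "N > 0" unfolding N_def of_nat_0_less_iff using False by simp
  have "(1 / N) *\<^sub>R q \<in> PP"
  proof -
    have "1 \<le> l \<bullet> ((1 / N) *\<^sub>R q)" if "l \<in> Ls" for l
      using large[OF that] N by (simp add: N_def pos_le_divide_eq)
    then show ?thesis using PP_Ls sigma_scale[OF S_sigma[OF q], of "1 / N"] N by simp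
  qed
  then obtain x y where xy: "(1 / N) *\<^sub>R q = x + y" "x \<in> convex hull V" "y \<in> \<sigma>" unfolding PP_def by blast
  obtain c where c: "\<forall>v\<in>V. 0 \<le> c v" "sum c V = 1" "x = (\<Sum>v\<in>V. c v *\<^sub>R v)"
    using xy(2) unfolding convex_hull_finite[OF finite_V] by blast
  have "q = N *\<^sub>R (x + y)" using xy(1)[symmetric] N by simp
  then have q1: "q = (\<Sum>v\<in>V. (N * c v) *\<^sub>R v) + N *\<^sub>R y"
    by (simp add: c(3) scaleR_add_right scaleR_sum_right)
  define m where "m v = nat \<lfloor>N * c v\<rfloor>" for v
  have m: "real (m v) \<le> N * c v" "N * c v - 1 \<le> real (m v)" if "v \<in> V" for v
    using c(1) that N by (simp_all add: m_def)
  define r where "r = (\<Sum>v\<in>V. (N * c v - real (m v)) *\<^sub>R v) + N *\<^sub>R y"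
  have q2: "q = (\<Sum>v\<in>V. real (m v) *\<^sub>R v) + r"
    unfolding q1 r_def by (simp add: scaleR_left_diff_distrib sum_subtractf)
  have mE: "(\<Sum>v\<in>T. real (m v) *\<^sub>R v) \<in> pw E (\<Sum>v\<in>T. m v)" if "T \<subseteq> V" for T
    using finite_subset[OF that finite_V] that
  proof (induction T rule: finite_induct)
    case (insert v T)
    have "real (m v) *\<^sub>R v \<in> pw E (m v)" using V_E insert.prems by (intro pw_scale[OF E]) auto
    moreover have "(\<Sum>v\<in>T. real (m v) *\<^sub>R v) \<in> pw E (\<Sum>v\<in>T. m v)" using insert by simp
    ultimately show ?case using insert.hyps pw_add[OF E] by simp
  qed simp
  have "(\<Sum>v\<in>V. (N * c v - real (m v)) *\<^sub>R v) \<in> \<sigma>"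
  proof -
    have "(\<Sum>v\<in>T. (N * c v - real (m v)) *\<^sub>R v) \<in> \<sigma>" if "T \<subseteq> V" for T
      using finite_subset[OF that finite_V] that
    proof (induction T rule: finite_induct)
      case (insert v T)
      then have "(N * c v - real (m v)) *\<^sub>R v \<in> \<sigma>" using m(1)[of v] V_sigma by (intro sigma_scale) auto
      moreover have "(\<Sum>v\<in>T. (N * c v - real (m v)) *\<^sub>R v) \<in> \<sigma>" using insert by simp
      ultimately show ?case using insert.hyps sigma_add by simp
    qed simp
    then show ?thesis by blast
  qed
  then have r\<sigma>: "r \<in> \<sigma>" unfolding r_def using sigma_scale[OF xy(3), of N] N by (intro sigma_add) auto
  have pS: "(\<Sum>v\<in>V. real (m v) *\<^sub>R v) \<in> S" using V_E ES by (intro S_sum S_scale) auto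
  moreover have "r = q - (\<Sum>v\<in>V. real (m v) *\<^sub>R v)" using q2 by simp
  ultimately have "\<forall>i. r $ i \<in> \<int>" using q unfolding lattice_points_def by auto
  then have rS: "r \<in> S" using r\<sigma> by (simp add: lattice_points_def)
  \<comment> \<open>Each rounding loses at most one, and the scaled coefficients add up to
    \<open>N = n + card V\<close>.\<close>
  have "(\<Sum>v\<in>V. N * c v - 1) \<le> (\<Sum>v\<in>V. real (m v))" by (intro sum_mono m(2))
  moreover have "(\<Sum>v\<in>V. N * c v - 1) = N - real (card V)"
    using c(2) by (simp add: sum_subtractf sum_distrib_left[symmetric])
  ultimately have "n \<le> (\<Sum>v\<in>V. m v)" by (simp add: N_def flip: of_nat_sum)
  then have "(\<Sum>v\<in>V. real (m v) *\<^sub>R v) \<in> pw E n" using mE[of V] pw_antimono[OF E] by blast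
  then show ?thesis unfolding q2 using sidealD[OF sideal_pwE _ rS] by blast
qed

text \<open>Since \<open>l\<close> is nonnegative on the generators of the cone, it vanishes on all
  those occurring in a point where it vanishes; one of them is a lattice direction.\<close>

lemma unbounded_direction:
  assumes "l \<in> Ls" "l \<notin> Lb"
  shows "\<exists>w\<in>S. w \<noteq> 0 \<and> l \<bullet> w = 0"
proof -
  obtain x where x: "x \<in> \<sigma>" "x \<noteq> 0" "l \<bullet> x = 0"
  proof -
    obtain x where "x \<in> \<sigma>" "x \<noteq> 0" "\<not> 0 < l \<bullet> x" using assms by (auto simp: Lb_def)
    then show ?thesis using that Ls_nonneg[OF assms(1), of x] by force
  qed
  have "x \<in> convex_cone hull W" using x(1) sigma_W by blast
  then obtain c where c: "\<forall>w\<in>W. 0 \<le> c w" "x = (\<Sum>w\<in>W. c w *\<^sub>R w)"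
    unfolding convex_cone_hull_finite[OF finite_W] by blast
  have nn: "0 \<le> l \<bullet> w" if "w \<in> W" for w using W_S S_sigma Ls_nonneg[OF assms(1)] that by blast
  have "(\<Sum>w\<in>W. c w * (l \<bullet> w)) = 0" using x(3) unfolding c(2) by (simp add: inner_sum_right)
  then have z: "c w * (l \<bullet> w) = 0" if "w \<in> W" for w
    using sum_nonneg_eq_0_iff[OF finite_W, of "\<lambda>w. c w * (l \<bullet> w)"] c(1) nn that by (metis mult_nonneg_nonneg)
  obtain w where w: "w \<in> W" "c w *\<^sub>R w \<noteq> 0"
    using x(2) unfolding c(2) by (meson sum.neutral)
  then have "l \<bullet> w = 0" "w \<noteq> 0" using z[OF w(1)] by auto
  then show ?thesis using w(1) W_S by blast
qed

lemma scale_pw_nonzero: "w \<in> S \<Longrightarrow> w \<noteq> 0 \<Longrightarrow> real k *\<^sub>R w \<in> pw (S - {0}) k"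
  by (rule pw_scale[OF sideal_nonzero]) simp

text \<open>Translation along a lattice direction on which \<open>l\<close> vanishes eventually
  reaches the next power without changing \<open>l\<close>.\<close>

lemma tdeg_Lu:
  assumes q: "q \<in> tdeg E n" and l: "l \<in> Ls" "l \<notin> Lb"
  shows "real (Suc n) \<le> l \<bullet> q"
proof -
  obtain t where t: "\<And>s. s \<in> pw (S - {0}) t \<Longrightarrow> q + s \<in> pw E (Suc n)"
    using q unfolding tdeg_def tors_def by blast
  obtain w where w: "w \<in> S" "w \<noteq> 0" "l \<bullet> w = 0" using unbounded_direction[OF l] by blast
  have "q + real t *\<^sub>R w \<in> pw E (Suc n)" using t scale_pw_nonzero[OF w(1,2)] by blast
  then have "real (Suc n) \<le> l \<bullet> (q + real t *\<^sub>R w)" using pw_Ls l(1) by blast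
  then show ?thesis using w(3) by (simp add: inner_add_right)
qed

lemma norm_lattice_ge_1: "q \<in> S \<Longrightarrow> q \<noteq> 0 \<Longrightarrow> 1 \<le> norm q"
proof -
  assume q: "q \<in> S" "q \<noteq> 0"
  then obtain i where i: "q $ i \<noteq> 0" by (auto simp: vec_eq_iff)
  have "q $ i \<in> \<int>" using q by (simp add: lattice_points_def)
  then have "1 \<le> \<bar>q $ i\<bar>" using i Ints_nonzero_abs_ge1 by blast
  also have "\<dots> \<le> norm q" by (rule component_le_norm_cart)
  finally show ?thesis .
qed

lemma Lb_pw_nonzero:
  assumes "l \<in> Lb"
  shows "\<exists>c>0. \<forall>t. \<forall>s\<in>pw (S - {0}) t. c * real t \<le> l \<bullet> s"
proof -
  obtain c where c: "c > 0" "\<And>x. x \<in> \<sigma> \<Longrightarrow> c * norm x \<le> l \<bullet> x"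
    using sigma_coercive[of l] assms by (auto simp: Lb_def)
  have "c * real t \<le> l \<bullet> s" if "s \<in> pw (S - {0}) t" for t s
    using that
  proof (induction t arbitrary: s)
    case 0
    then have "c * norm s \<le> l \<bullet> s" using c(2) S_sigma by simp
    moreover have "0 \<le> c * norm s" using c(1) by simp
    ultimately show ?case by simp
  next
    case (Suc t)
    then obtain a b where ab: "s = a + b" "a \<in> pw (S - {0}) t" "b \<in> S - {0}" unfolding pw.simps by blast
    have "c * 1 \<le> c * norm b" using c(1) norm_lattice_ge_1 ab(3) by (intro mult_left_mono) auto
    also have "\<dots> \<le> l \<bullet> b" using c(2) ab(3) S_sigma by blast
    finally have "c \<le> l \<bullet> b" by simp
    then show ?case using Suc.IH[OF ab(2)] ab(1) by (simp add: inner_add_right distrib_left)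
  qed
  then show ?thesis using c(1) by blast
qed

text \<open>Far inside the cone the functionals of bounded facets exceed any bound, and those of
  unbounded facets are large by assumption; so \<open>pw_of_Ls\<close> applies to every
  translate.\<close>

lemma tdegI:
  assumes q: "q \<in> pw E n" "q \<notin> pw E (Suc n)"
    and large: "\<And>l. l \<in> Ls \<Longrightarrow> l \<notin> Lb \<Longrightarrow> real (Suc n + card V) \<le> l \<bullet> q"
  shows "q \<in> tdeg E n"
proof -
  obtain c where c: "\<And>l. l \<in> Lb \<Longrightarrow> c l > 0"
    "\<And>l t s. l \<in> Lb \<Longrightarrow> s \<in> pw (S - {0}) t \<Longrightarrow> c l * real t \<le> l \<bullet> s"
    using Lb_pw_nonzero by metis
  \<comment> \<open>The sum is a common upper bound for the finitely many quotients.\<close>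
  define t where "t = nat \<lceil>\<Sum>l\<in>Lb. real (Suc n + card V) / c l\<rceil>"
  have finLb: "finite Lb" using finite_Ls by (simp add: Lb_def)
  have qS: "q \<in> S" using sideal_S[OF sideal_pwE q(1)] .
  have "q + s \<in> pw E (Suc n)" if s: "s \<in> pw (S - {0}) t" for s
  proof -
    have sS: "s \<in> S" using sideal_S[OF sideal_pw s] by blast
    show ?thesis
    proof (rule pw_of_Ls[OF S_add[OF qS sS]])
      fix l assume l: "l \<in> Ls"
      show "real (Suc n + card V) \<le> l \<bullet> (q + s)"
      proof (cases "l \<in> Lb")
        case False
        then show ?thesis
          using large[OF l] Ls_nonneg[OF l S_sigma[OF sS]] by (simp add: inner_add_right)
      next
        case True
        have "real (Suc n + card V) / c l \<le> (\<Sum>l\<in>Lb. real (Suc n + card V) / c l)"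
          using c(1) True finLb by (intro member_le_sum) (auto intro: less_imp_le)
        also have "\<dots> \<le> real t" unfolding t_def by linarith
        finally have "real (Suc n + card V) \<le> c l * real t"
          using c(1)[OF True] by (simp add: pos_divide_le_eq mult.commute)
        also have "\<dots> \<le> l \<bullet> s" using c(2) True s by blast
        finally show ?thesis using Ls_nonneg[OF l S_sigma[OF qS]] by (simp add: inner_add_right)
      qed
    qed
  qed
  then show ?thesis using q unfolding tdeg_def tors_def by blast
qed

end

section \<open>Counting lattice points\<close>

text \<open>Maps \<open>x\<close> to the lattice point whose cell of side \<open>1 / n\<close>
  contains it; preimages convert cardinalities into volumes.\<close>

definition grid_floor :: "nat \<Rightarrow> real ^ 'n \<Rightarrow> real ^ 'n" where
  "grid_floor n x = (\<chi> i. of_int \<lfloor>real n * x $ i\<rfloor>)"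

lemma grid_floor_integral: "grid_floor n x $ i \<in> \<int>"
  by (simp add: grid_floor_def)

lemma norm_grid_floor_diff: "norm (real n *\<^sub>R x - grid_floor n x) \<le> real CARD('n)"
  for x :: "real ^ 'n"
proof -
  have "norm (real n *\<^sub>R x - grid_floor n x) \<le> (\<Sum>i\<in>UNIV. \<bar>(real n *\<^sub>R x - grid_floor n x) $ i\<bar>)"
    by (rule norm_le_l1_cart)
  also have "\<dots> \<le> (\<Sum>i\<in>(UNIV :: 'n set). 1)"
  proof (rule sum_mono)
    fix i :: 'n
    show "\<bar>(real n *\<^sub>R x - grid_floor n x) $ i\<bar> \<le> 1" unfolding grid_floor_def by simp linarith
  qed
  finally show ?thesis by simp
qed

lemma inner_grid_floor: "\<bar>l \<bullet> grid_floor n x - real n * (l \<bullet> x)\<bar> \<le> norm l * real CARD('n)"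
  for x :: "real ^ 'n"
proof -
  have "\<bar>l \<bullet> (real n *\<^sub>R x - grid_floor n x)\<bar> \<le> norm l * norm (real n *\<^sub>R x - grid_floor n x)"
    by (rule Cauchy_Schwarz_ineq2)
  also have "\<dots> \<le> norm l * real CARD('n)" by (intro mult_left_mono norm_grid_floor_diff) auto
  finally show ?thesis by (simp add: inner_diff_right abs_minus_commute)
qed

lemma dist_grid_floor:
  fixes x :: "real ^ 'n"
  assumes "n > 0"
  shows "dist x ((1 / real n) *\<^sub>R grid_floor n x) \<le> real CARD('n) / real n"
proof -
  have "x - (1 / real n) *\<^sub>R grid_floor n x = (1 / real n) *\<^sub>R (real n *\<^sub>R x - grid_floor n x)"
    using assms by (simp add: scaleR_diff_right)
  then have "dist x ((1 / real n) *\<^sub>R grid_floor n x) = norm (real n *\<^sub>R x - grid_floor n x) / real n"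
    using assms by (simp add: dist_norm)
  also have "\<dots> \<le> real CARD('n) / real n" by (intro divide_right_mono norm_grid_floor_diff) simp
  finally show ?thesis .
qed

lemma measure_grid_cell:
  fixes q :: "real ^ 'n"
  assumes n: "n > 0" and q: "\<And>i. q $ i \<in> \<int>"
  shows "{x. grid_floor n x = q} \<in> lmeasurable"
    and "measure lebesgue {x. grid_floor n x = q} = 1 / real n ^ CARD('n)"
proof -
  let ?X = "{x. grid_floor n x = q}"
  define b :: "real ^ 'n" where "b = (\<chi> i. (q $ i + 1) / real n)"
  define a where "a = (1 / real n) *\<^sub>R q"
  have "\<exists>k. q $ i = real_of_int k" for i using q[of i] by (auto elim: Ints_cases)
  then obtain f where f: "\<And>i. q $ i = real_of_int (f i)" by metis
  have X: "x \<in> ?X \<longleftrightarrow> (\<forall>i. a $ i \<le> x $ i \<and> x $ i < b $ i)" for x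
  proof -
    have "x \<in> ?X \<longleftrightarrow> (\<forall>i. \<lfloor>real n * x $ i\<rfloor> = f i)"
      by (simp add: grid_floor_def vec_eq_iff f)
    also have "\<dots> \<longleftrightarrow> (\<forall>i. a $ i \<le> x $ i \<and> x $ i < b $ i)"
      using n by (simp add: floor_eq_iff a_def b_def f divide_le_eq less_divide_eq mult.commute)
    finally show ?thesis .
  qed
  have "?X \<subseteq> cbox a b"
  proof
    fix x assume "x \<in> ?X"
    then show "x \<in> cbox a b" using X[of x] by (simp add: mem_box_cart less_imp_le)
  qed
  moreover have "box a b \<subseteq> ?X"
  proof
    fix x assume "x \<in> box a b"
    then show "x \<in> ?X" using X[of x] by (simp add: mem_box_cart less_imp_le)
  qed
  \<comment> \<open>The cell is half-open and differs from the closed box only in the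
    boundary.\<close>
  ultimately have "cbox a b - ?X \<union> (?X - cbox a b) \<subseteq> cbox a b - box a b" by blast
  then have neg: "negligible (cbox a b - ?X \<union> (?X - cbox a b))"
    using negligible_subset[OF negligible_frontier_interval] by blast
  show "?X \<in> lmeasurable" by (rule lmeasurable_negligible_symdiff[OF _ neg]) simp
  have "measure lebesgue ?X = measure lebesgue (cbox a b)"
    by (rule measure_negligible_symdiff[OF _ neg]) simp
  also have "\<dots> = (\<Prod>i\<in>UNIV. b $ i - a $ i)"
  proof -
    have "a $ i \<le> b $ i" for i using n by (simp add: a_def b_def divide_right_mono)
    then have "cbox a b \<noteq> {}" by (simp add: interval_ne_empty_cart)
    then show ?thesis by (simp add: content_cbox_cart)
  qed
  also have "\<dots> = (\<Prod>i\<in>(UNIV :: 'n set). 1 / real n)"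
    by (intro prod.cong refl) (simp add: a_def b_def diff_divide_distrib[symmetric])
  finally show "measure lebesgue ?X = 1 / real n ^ CARD('n)" by (simp add: power_one_over)
qed

lemma measure_grid_cells:
  fixes X :: "(real ^ 'n) set"
  assumes n: "n > 0" and fin: "finite X" and int: "\<And>q i. q \<in> X \<Longrightarrow> q $ i \<in> \<int>"
  shows "{x. grid_floor n x \<in> X} \<in> lmeasurable \<and>
    measure lebesgue {x. grid_floor n x \<in> X} = real (card X) / real n ^ CARD('n)"
  using fin int
proof (induction X rule: finite_induct)
  case (insert q X)
  have eq: "{x. grid_floor n x \<in> insert q X} = {x. grid_floor n x = q} \<union> {x. grid_floor n x \<in> X}" by auto
  have d: "{x. grid_floor n x \<in> X} - {x. grid_floor n x = q} = {x. grid_floor n x \<in> X}"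
    using insert.hyps by auto
  have q: "{x. grid_floor n x = q} \<in> lmeasurable"
    "measure lebesgue {x. grid_floor n x = q} = 1 / real n ^ CARD('n)"
    using measure_grid_cell[OF n, of q] insert.prems by blast+
  have X: "{x. grid_floor n x \<in> X} \<in> lmeasurable"
    "measure lebesgue {x. grid_floor n x \<in> X} = real (card X) / real n ^ CARD('n)"
    using insert by blast+
  have "measure lebesgue ({x. grid_floor n x = q} \<union> {x. grid_floor n x \<in> X})
      = 1 / real n ^ CARD('n) + real (card X) / real n ^ CARD('n)"
    using measure_Un2[OF q(1) X(1)] q(2) X(2) unfolding d by simp
  then show ?case unfolding eq
    using fmeasurable.Un[OF q(1) X(1)] insert.hyps by (simp add: add_divide_distrib)
qed simp

lemma eventually_real_mult_ge:
  assumes "(a :: real) > 0"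
  shows "\<forall>\<^sub>F n in sequentially. b \<le> real n * a"
proof -
  have "\<forall>\<^sub>F n in sequentially. b / a \<le> real n"
    using filterlim_real_sequentially by (simp add: filterlim_at_top)
  then show ?thesis by eventually_elim (use assms in \<open>simp add: pos_divide_le_eq\<close>)
qed

lemma card_le_fibers:
  assumes "finite X" "\<And>y. y \<in> f ` X \<Longrightarrow> card {x \<in> X. f x = y} \<le> N"
  shows "card X \<le> N * card (f ` X)"
proof -
  have "X = (\<Union>y\<in>f ` X. {x \<in> X. f x = y})" by blast
  then have "card X = card (\<Union>y\<in>f ` X. {x \<in> X. f x = y})" by simp
  also have "\<dots> \<le> (\<Sum>y\<in>f ` X. card {x \<in> X. f x = y})" using assms(1) by (intro card_UN_le) simp
  also have "\<dots> \<le> (\<Sum>y\<in>f ` X. N)" by (rule sum_mono[OF assms(2)])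
  finally show ?thesis by (simp add: mult.commute)
qed

section \<open>Levels of lattice points and their asymptotic count\<close>

context newton_nonempty
begin

text \<open>A facet functional is at least \<open>m\<close> on \<open>pw E m\<close>, so a point
  cannot lie in all powers.\<close>

lemma level_exists:
  assumes "l \<in> Ls" "q \<in> S"
  shows "\<exists>m. q \<in> pw E m \<and> q \<notin> pw E (Suc m)"
proof (rule ccontr)
  assume no: "\<not> ?thesis"
  have "q \<in> pw E m" for m by (induction m) (use no assms in auto)
  then have "real m \<le> l \<bullet> q" for m using pw_Ls assms(1) by blast
  then show False using reals_Archimedean2 not_le by blast
qed

lemma level_unique:
  assumes "q \<in> tdeg E m" "q \<in> tdeg E m'"
  shows "m = m'"
proof -
  have "\<not> m < m'" if "q \<in> tdeg E m" "q \<in> tdeg E m'" for m m'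
  proof
    assume "m < m'"
    then have "q \<in> pw E (Suc m)" using pw_antimono[OF E, of "Suc m" m'] tdeg_pw[OF that(2)] by auto
    then show False using that(1) by (simp add: tdeg_def)
  qed
  then show ?thesis using assms by (metis nat_neq_iff)
qed

text \<open>\<open>Gd n\<close> contains the points of level below \<open>n\<close> that are far from all unbounded facets, which are
  the points of the \<open>n\<close>-fold dilated pyramids up to a bounded error; \<open>Bd l n\<close> contains those close to
  the unbounded facet given by \<open>l\<close>.\<close>

definition Gd where
  "Gd n = {q. \<exists>m<n. q \<in> tdeg E m \<and> (\<forall>l\<in>Ls - Lb. real (Suc m + card V) \<le> l \<bullet> q)}"

definition Bd where
  "Bd l n = {q. \<exists>m<n. q \<in> tdeg E m \<and> l \<bullet> q < real (Suc m + card V)}"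

lemma finite_UN_tdeg: "finite (\<Union>m<n. tdeg E m)"
  using finite_tdeg by simp

lemma finite_Gd: "finite (Gd n)" and finite_Bd: "finite (Bd l n)"
proof -
  have "Gd n \<subseteq> (\<Union>m<n. tdeg E m)" "Bd l n \<subseteq> (\<Union>m<n. tdeg E m)" by (auto simp: Gd_def Bd_def)
  then show "finite (Gd n)" "finite (Bd l n)" using finite_UN_tdeg finite_subset by blast+
qed

lemma tdeg_S: "q \<in> tdeg E m \<Longrightarrow> q \<in> S"
  using tdeg_pw sideal_S[OF sideal_pwE] by blast

lemma Gd_S: "q \<in> Gd n \<Longrightarrow> q \<in> S"
  by (auto simp: Gd_def dest: tdeg_S)

text \<open>All conditions are strict at \<open>x\<close>, so after dilation by \<open>n\<close>
  they hold with a margin proportional to \<open>n\<close>, which absorbs the rounding and the loss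
  of \<open>card V\<close>.\<close>

lemma eventually_in_Gd:
  assumes x: "x \<in> interior \<sigma>" and l: "l \<in> Lb" "l \<bullet> x < 1" "\<And>k. k \<in> Ls \<Longrightarrow> k \<noteq> l \<Longrightarrow> l \<bullet> x < k \<bullet> x"
  shows "\<forall>\<^sub>F n in sequentially. grid_floor n x \<in> Gd n"
proof -
  define b where "b k = norm k * real CARD('d)" for k :: "real ^ 'd"
  have gf: "\<bar>k \<bullet> grid_floor n x - real n * (k \<bullet> x)\<bar> \<le> b k" for k n
    unfolding b_def by (rule inner_grid_floor)
  have lL: "l \<in> Ls" using l(1) by (simp add: Lb_def)
  obtain e where e: "e > 0" "ball x e \<subseteq> \<sigma>" using x mem_interior by blast
  have "\<forall>\<^sub>F n in sequentially. real CARD('d) + 1 \<le> real n * e" by (rule eventually_real_mult_ge[OF e(1)])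
  moreover have "\<forall>\<^sub>F n in sequentially. b l + 1 \<le> real n * (1 - l \<bullet> x)"
    by (rule eventually_real_mult_ge) (use l in simp)
  \<comment> \<open>\<open>b l + b k\<close> pays for rounding, and \<open>1 + card V\<close> is the
    distance above the level that \<open>tdegI\<close> demands; the level is at most the value of
    \<open>l\<close>.\<close>
  moreover have "\<forall>\<^sub>F n in sequentially. \<forall>k\<in>Ls - {l}. b l + b k + 1 + real (card V) \<le> real n * (k \<bullet> x - l \<bullet> x)"
  proof (rule eventually_ball_finite)
    show "finite (Ls - {l})" using finite_Ls by simp
    show "\<forall>k\<in>Ls - {l}. \<forall>\<^sub>F n in sequentially. b l + b k + 1 + real (card V) \<le> real n * (k \<bullet> x - l \<bullet> x)"
    proof
      fix k assume "k \<in> Ls - {l}"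
      then have "0 < k \<bullet> x - l \<bullet> x" using l(3)[of k] by simp
      then show "\<forall>\<^sub>F n in sequentially. b l + b k + 1 + real (card V) \<le> real n * (k \<bullet> x - l \<bullet> x)"
        by (rule eventually_real_mult_ge)
    qed
  qed
  ultimately show ?thesis using eventually_gt_at_top[of 0]
  proof eventually_elim
    case (elim n)
    let ?q = "grid_floor n x"
    have "real CARD('d) / real n < e" using elim by (simp add: pos_divide_less_eq mult.commute)
    moreover have "dist x ((1 / real n) *\<^sub>R ?q) \<le> real CARD('d) / real n" by (rule dist_grid_floor[OF elim(4)])
    ultimately have "(1 / real n) *\<^sub>R ?q \<in> ball x e" unfolding mem_ball by linarith
    then have "(1 / real n) *\<^sub>R ?q \<in> \<sigma>" using e(2) by blast
    then have "real n *\<^sub>R ((1 / real n) *\<^sub>R ?q) \<in> \<sigma>" by (rule sigma_scale) simp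
    then have qS: "?q \<in> S" using elim(4) by (simp add: lattice_points_def grid_floor_integral)
    obtain m where m: "?q \<in> pw E m" "?q \<notin> pw E (Suc m)" using level_exists[OF lL qS] by blast
    have ml: "real m \<le> l \<bullet> ?q" by (rule pw_Ls[OF m(1) lL])
    have mn: "m < n"
    proof -
      have "l \<bullet> ?q \<le> real n * (l \<bullet> x) + b l" using gf[of l n] by linarith
      moreover have "b l + 1 \<le> real n - real n * (l \<bullet> x)" using elim(2) by (simp add: right_diff_distrib)
      ultimately show ?thesis using ml by linarith
    qed
    have large: "real (Suc m + card V) \<le> k \<bullet> ?q" if k: "k \<in> Ls" "k \<notin> Lb" for k
    proof -
      have "k \<noteq> l" using k l(1) by blast
      then have "b l + b k + 1 + real (card V) \<le> real n * (k \<bullet> x) - real n * (l \<bullet> x)"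
        using elim(3) k(1) by (simp add: right_diff_distrib)
      then show ?thesis using gf[of l n] gf[of k n] ml by simp
    qed
    have "?q \<in> tdeg E m" by (rule tdegI[OF m large])
    then show ?case unfolding Gd_def using mn large by blast
  qed
qed

text \<open>Off the cone closedness suffices. On it, a point of level \<open>m\<close> in
  \<open>Gd n\<close> fails the bound of \<open>pw_of_Ls\<close> for some \<open>l\<close>,
  necessarily one of a bounded facet. As \<open>x\<close> is not in \<open>Y\<close>, either
  \<open>l\<close> is too large for a level below \<open>n\<close> or some functional drops below
  the level.\<close>

lemma eventually_notin_Gd:
  assumes x: "x \<notin> Y"
  shows "\<forall>\<^sub>F n in sequentially. grid_floor n x \<notin> Gd n"
proof (cases "x \<in> \<sigma>")
  case False
  have "open (- \<sigma>)" using sigma_closed by (simp add: closed_def)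
  then obtain e where e: "e > 0" "ball x e \<subseteq> - \<sigma>" using False open_contains_ball by (metis ComplI)
  have "\<forall>\<^sub>F n in sequentially. real CARD('d) + 1 \<le> real n * e" by (rule eventually_real_mult_ge[OF e(1)])
  then show ?thesis using eventually_gt_at_top[of 0]
  proof eventually_elim
    case (elim n)
    let ?q = "grid_floor n x"
    have "real CARD('d) / real n < e" using elim by (simp add: pos_divide_less_eq mult.commute)
    moreover have "dist x ((1 / real n) *\<^sub>R ?q) \<le> real CARD('d) / real n" by (rule dist_grid_floor[OF elim(2)])
    ultimately have "(1 / real n) *\<^sub>R ?q \<in> ball x e" unfolding mem_ball by linarith
    then have "(1 / real n) *\<^sub>R ?q \<notin> \<sigma>" using e(2) by blast
    then have "?q \<notin> \<sigma>" using sigma_scale[of ?q "1 / real n"] by auto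
    then show ?case using Gd_S S_sigma by blast
  qed
next
  case True
  define b where "b k = norm k * real CARD('d)" for k :: "real ^ 'd"
  have gf: "\<bar>k \<bullet> grid_floor n x - real n * (k \<bullet> x)\<bar> \<le> b k" for k n
    unfolding b_def by (rule inner_grid_floor)
  let ?bad = "\<lambda>n l. real (card V) + b l + 1 \<le> real n * (l \<bullet> x - 1) \<or>
      (\<exists>k\<in>Ls. 1 + real (card V) + b l + b k \<le> real n * (l \<bullet> x - k \<bullet> x))"
  have "\<forall>\<^sub>F n in sequentially. \<forall>l\<in>Lb. ?bad n l"
  proof (rule eventually_ball_finite)
    show "finite Lb" using finite_Ls by (simp add: Lb_def)
    show "\<forall>l\<in>Lb. \<forall>\<^sub>F n in sequentially. ?bad n l"
    proof
      fix l assume l: "l \<in> Lb"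
      have "1 < l \<bullet> x \<or> (\<exists>k\<in>Ls. k \<bullet> x < l \<bullet> x)" using x True l unfolding Y_def by force
      then show "\<forall>\<^sub>F n in sequentially. ?bad n l"
      proof
        assume "1 < l \<bullet> x"
        then have "\<forall>\<^sub>F n in sequentially. real (card V) + b l + 1 \<le> real n * (l \<bullet> x - 1)"
          by (intro eventually_real_mult_ge) simp
        then show ?thesis by eventually_elim blast
      next
        assume "\<exists>k\<in>Ls. k \<bullet> x < l \<bullet> x"
        then obtain k where k: "k \<in> Ls" "k \<bullet> x < l \<bullet> x" by blast
        then have "\<forall>\<^sub>F n in sequentially. 1 + real (card V) + b l + b k \<le> real n * (l \<bullet> x - k \<bullet> x)"
          by (intro eventually_real_mult_ge) simp
        then show ?thesis by eventually_elim (use k(1) in blast)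
      qed
    qed
  qed
  then show ?thesis
  proof eventually_elim
    case (elim n)
    let ?q = "grid_floor n x"
    show ?case
    proof
      assume "?q \<in> Gd n"
      then obtain m where m: "m < n" "?q \<in> tdeg E m" "\<And>l. l \<in> Ls - Lb \<Longrightarrow> real (Suc m + card V) \<le> l \<bullet> ?q"
        unfolding Gd_def by blast
      have "?q \<notin> pw E (Suc m)" using m(2) by (simp add: tdeg_def)
      then obtain l where l: "l \<in> Ls" "\<not> real (Suc m + card V) \<le> l \<bullet> ?q"
        using pw_of_Ls[OF tdeg_S[OF m(2)], of "Suc m"] by blast
      then have lb: "l \<in> Lb" using m(3) by blast
      have lq: "l \<bullet> ?q < 1 + real m + real (card V)" using l(2) by simp
      from elim lb have "?bad n l" by blast
      then show False
      proof
        assume "real (card V) + b l + 1 \<le> real n * (l \<bullet> x - 1)"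
        then have "real (card V) + b l + 1 \<le> real n * (l \<bullet> x) - real n" by (simp add: right_diff_distrib)
        then show False using gf[of l n] lq m(1) by linarith
      next
        assume "\<exists>k\<in>Ls. 1 + real (card V) + b l + b k \<le> real n * (l \<bullet> x - k \<bullet> x)"
        then obtain k where k: "k \<in> Ls" "1 + real (card V) + b l + b k \<le> real n * (l \<bullet> x) - real n * (k \<bullet> x)"
          by (auto simp: right_diff_distrib)
        have "real m \<le> k \<bullet> ?q" by (rule pw_Ls[OF tdeg_pw[OF m(2)] k(1)])
        then show False using k(2) gf[of l n] gf[of k n] lq by linarith
      qed
    qed
  qed
qed

lemma AE_indicator_Gd_tendsto:
  "AE x in lebesgue. (\<lambda>n. indicator {x. grid_floor n x \<in> Gd n} x) \<longlonglongrightarrow> (indicator Y x :: real)"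
proof -
  \<comment> \<open>The boundary of the cone, the facet hyperplanes and the ties between two
    functionals; elsewhere a point of \<open>Y\<close> satisfies its inequalities strictly.\<close>
  define Z where "Z = frontier \<sigma> \<union> (\<Union>l\<in>Ls. {x. l \<bullet> x = 1}) \<union> (\<Union>l\<in>Ls. \<Union>k\<in>Ls - {l}. {x. (l - k) \<bullet> x = 0})"
  have "negligible Z"
    unfolding Z_def
    by (intro negligible_Un negligible_convex_frontier sigma_convex negligible_Union finite_imageI finite_Ls finite_Diff)
      (auto intro!: negligible_hyperplane negligible_Union finite_imageI finite_Ls finite_Diff)
  then have "AE x in lebesgue. x \<notin> Z"
    by (intro AE_not_in) (simp add: negligible_iff_null_sets)
  then show ?thesis
  proof (rule AE_mp, intro AE_I2 impI)
    fix x assume xZ: "x \<notin> Z"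
    show "(\<lambda>n. indicator {x. grid_floor n x \<in> Gd n} x) \<longlonglongrightarrow> (indicator Y x :: real)"
    proof (cases "x \<in> Y")
      case True
      then obtain l where l: "x \<in> \<sigma>" "l \<in> Lb" "l \<bullet> x \<le> 1" "\<And>k. k \<in> Ls \<Longrightarrow> l \<bullet> x \<le> k \<bullet> x" unfolding Y_def by blast
      have lL: "l \<in> Ls" using l(2) by (simp add: Lb_def)
      have "x \<in> interior \<sigma>" using xZ l(1) closure_subset[of \<sigma>] by (auto simp: Z_def frontier_def)
      moreover have "l \<bullet> x < 1"
      proof -
        have "l \<bullet> x \<noteq> 1" using xZ lL by (auto simp: Z_def)
        then show ?thesis using l(3) by simp
      qed
      moreover have "l \<bullet> x < k \<bullet> x" if k: "k \<in> Ls" "k \<noteq> l" for k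
      proof -
        have "(l - k) \<bullet> x \<noteq> 0" using xZ lL k by (auto simp: Z_def)
        then show ?thesis using l(4)[OF k(1)] by (simp add: inner_diff_left)
      qed
      ultimately have "\<forall>\<^sub>F n in sequentially. grid_floor n x \<in> Gd n" using eventually_in_Gd l(2) by blast
      then have "\<forall>\<^sub>F n in sequentially. indicator {x. grid_floor n x \<in> Gd n} x = (indicator Y x :: real)"
        by eventually_elim (simp add: True)
      then show ?thesis by (rule tendsto_eventually)
    next
      case False
      then have "\<forall>\<^sub>F n in sequentially. grid_floor n x \<notin> Gd n" by (rule eventually_notin_Gd)
      then have "\<forall>\<^sub>F n in sequentially. indicator {x. grid_floor n x \<in> Gd n} x = (indicator Y x :: real)"
        by eventually_elim (simp add: False)
      then show ?thesis by (rule tendsto_eventually)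
    qed
  qed
qed

text \<open>The normalised count is the volume of a union of cells. The cells stay in a fixed ball
  and their indicators converge almost everywhere, so dominated convergence applies.\<close>

lemma card_Gd_tendsto: "(\<lambda>n. real (card (Gd n)) / real n ^ CARD('d)) \<longlonglongrightarrow> measure lebesgue Y"
proof -
  obtain C where C: "C > 0" "\<And>m q. q \<in> tdeg E m \<Longrightarrow> norm q \<le> C * (real m + 1)"
    using tdeg_norm_bound by blast
  let ?R = "C + real CARD('d)"
  let ?X = "\<lambda>n. {x. grid_floor n x \<in> Gd n}"
  have int: "q $ i \<in> \<int>" if "q \<in> Gd n" for q i n using Gd_S[OF that] by (simp add: lattice_points_def)
  have cells: "?X n \<in> lmeasurable" "measure lebesgue (?X n) = real (card (Gd n)) / real n ^ CARD('d)" if "n > 0" for n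
    using measure_grid_cells[OF that finite_Gd[of n] int[of _ n]] by simp_all
  have dom: "?X n \<subseteq> cball 0 ?R" if n: "n > 0" for n
  proof
    fix x assume "x \<in> ?X n"
    then obtain m where m: "m < n" "grid_floor n x \<in> tdeg E m" unfolding Gd_def by blast
    have "norm (grid_floor n x) \<le> C * (real m + 1)" by (rule C(2)[OF m(2)])
    also have "\<dots> \<le> C * real n" using C(1) m(1) by (intro mult_left_mono) auto
    finally have "norm (real n *\<^sub>R x) \<le> C * real n + real CARD('d)"
      using norm_triangle_ineq[of "real n *\<^sub>R x - grid_floor n x" "grid_floor n x"] norm_grid_floor_diff[of n x] by simp
    also have "\<dots> \<le> ?R * real n" using n by (simp add: distrib_right)
    finally show "x \<in> cball 0 ?R" using n by (simp add: mult.commute)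
  qed
  \<comment> \<open>The index is shifted because cells need a positive \<open>n\<close>.\<close>
  have "(\<lambda>n. integral\<^sup>L lebesgue (indicator (?X (Suc n)) :: _ \<Rightarrow> real)) \<longlonglongrightarrow> integral\<^sup>L lebesgue (indicator Y)"
  proof (rule integral_dominated_convergence[where w = "indicator (cball 0 ?R)"])
    show "(indicator Y :: _ \<Rightarrow> real) \<in> borel_measurable lebesgue"
      using Y_lmeasurable by (intro borel_measurable_indicator) (simp add: fmeasurableD)
    show "(indicator (?X (Suc n)) :: _ \<Rightarrow> real) \<in> borel_measurable lebesgue" for n
      using cells(1)[of "Suc n"] by (intro borel_measurable_indicator) (simp add: fmeasurableD)
    show "integrable lebesgue (indicator (cball 0 ?R) :: real ^ 'd \<Rightarrow> real)"
    proof (rule integrable_real_indicator)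
      show "cball 0 ?R \<in> sets lebesgue" by simp
      have "cball (0 :: real ^ 'd) ?R \<in> lmeasurable" by simp
      then show "emeasure lebesgue (cball (0 :: real ^ 'd) ?R) < \<infinity>" by (simp only: fmeasurable_def mem_Collect_eq)
    qed
    show "AE x in lebesgue. (\<lambda>n. indicator (?X (Suc n)) x) \<longlonglongrightarrow> (indicator Y x :: real)"
      using AE_indicator_Gd_tendsto by eventually_elim (rule LIMSEQ_Suc)
    show "AE x in lebesgue. norm (indicator (?X (Suc n)) x :: real) \<le> indicator (cball 0 ?R) x" for n
      using dom[of "Suc n"] by (intro AE_I2) (auto simp: indicator_def)
  qed
  then have "(\<lambda>n. real (card (Gd (Suc n))) / real (Suc n) ^ CARD('d)) \<longlonglongrightarrow> measure lebesgue Y"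
    using cells(2) by (simp del: of_nat_Suc)
  then show ?thesis by (rule LIMSEQ_imp_Suc)
qed

text \<open>On a line in a direction \<open>w\<close> of the cone with \<open>l \<bullet> w = 0\<close> the points of \<open>Bd l n\<close> have distinct
  levels after thinning, and these levels differ by less than the number of generators; comparing with
  many translates of \<open>Bd l n\<close> makes its density arbitrarily small.\<close>

lemma card_Bd_tendsto:
  assumes l: "l \<in> Ls" "l \<notin> Lb"
  shows "(\<lambda>n. real (card (Bd l n)) / real n ^ CARD('d)) \<longlonglongrightarrow> 0"
proof -
  obtain C where C: "C > 0" "\<And>m q. q \<in> tdeg E m \<Longrightarrow> norm q \<le> C * (real m + 1)"
    using tdeg_norm_bound by blast
  obtain t0 where t0: "\<And>n q s. q \<in> tors E n \<Longrightarrow> s \<in> pw (S - {0}) t0 \<Longrightarrow> q + s \<in> pw E (Suc n)"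
    using uniform_torsion by blast
  obtain w where w: "w \<in> S" "w \<noteq> 0" "l \<bullet> w = 0" using unbounded_direction[OF l] by blast
  \<comment> \<open>Every positive multiple of \<open>u\<close> lies in the \<open>t0\<close>-th
    power of the maximal ideal, so translation by it raises the level of a torsion point.\<close>
  define u where "u = real (Suc t0) *\<^sub>R w"
  have uS: "u \<in> S" unfolding u_def by (rule S_scale[OF w(1)])
  have up: "q + real j *\<^sub>R u \<in> pw E (Suc m)" if q: "q \<in> tdeg E m" and j: "j > 0" for q m j
  proof -
    have "real j *\<^sub>R u = real (j * Suc t0) *\<^sub>R w" by (simp add: u_def distrib_left)
    then have "real j *\<^sub>R u \<in> pw (S - {0}) (j * Suc t0)" using scale_pw_nonzero[OF w(1,2)] by metis
    moreover have "t0 \<le> j * Suc t0" using j by (cases j) auto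
    ultimately have "real j *\<^sub>R u \<in> pw (S - {0}) t0" using pw_antimono[OF sideal_nonzero] by blast
    then show ?thesis using t0 q by (simp add: tdeg_def)
  qed
  define r where "r = card V"
  define h where "h = (\<lambda>(q, k). q + real k *\<^sub>R u)"
  \<comment> \<open>The \<open>K + 1\<close> translates of \<open>Bd l n\<close> along
    \<open>u\<close> lie in a box whose side is linear in \<open>n\<close>, and no point is covered
    more than \<open>r + 1\<close> times.\<close>
  have main: "(K + 1) * card (Bd l n) \<le> Suc r * (2 * nat \<lceil>C * real n + real K * norm u\<rceil> + 1) ^ CARD('d)" for K n
  proof -
    let ?X = "Bd l n \<times> {..K}"
    let ?M = "nat \<lceil>C * real n + real K * norm u\<rceil>"
    let ?I = "{x :: real ^ 'd. \<forall>i. x $ i \<in> \<int> \<and> \<bar>x $ i\<bar> \<le> real ?M}"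
    have fin: "finite ?X" using finite_Bd by simp
    have "card {z \<in> ?X. h z = y} \<le> Suc r" for y
    proof -
      define lev where "lev z = (THE m. fst z \<in> tdeg E m)" for z :: "(real ^ 'd) \<times> nat"
      have lev: "fst z \<in> tdeg E (lev z)" "l \<bullet> fst z < real (Suc (lev z) + card V)" if z: "z \<in> ?X" for z
      proof -
        obtain m where m: "fst z \<in> tdeg E m" "l \<bullet> fst z < real (Suc m + card V)" using z by (auto simp: Bd_def)
        have "lev z = m" unfolding lev_def using m(1) level_unique by blast
        then show "fst z \<in> tdeg E (lev z)" "l \<bullet> fst z < real (Suc (lev z) + card V)" using m by simp_all
      qed
      let ?F = "{z \<in> ?X. h z = y}"
      have ly: "l \<bullet> fst z = l \<bullet> y" if "z \<in> ?F" for z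
        using that w(3) by (auto simp: h_def u_def inner_add_right)
      have no: "\<not> snd z < snd z'" if z: "z \<in> ?F" "z' \<in> ?F" "lev z = lev z'" for z z'
      proof
        assume less: "snd z < snd z'"
        have eq: "fst z + real (snd z) *\<^sub>R u = fst z' + real (snd z') *\<^sub>R u"
          using z by (auto simp: h_def)
        have "fst z = (fst z' + real (snd z') *\<^sub>R u) - real (snd z) *\<^sub>R u"
          unfolding eq[symmetric] by simp
        also have "\<dots> = fst z' + real (snd z' - snd z) *\<^sub>R u"
          using less by (simp add: of_nat_diff scaleR_left_diff_distrib)
        finally have "fst z = fst z' + real (snd z' - snd z) *\<^sub>R u" .
        moreover have "fst z' \<in> tdeg E (lev z')" using lev(1)[of z'] z(2) by blast
        ultimately have "fst z \<in> pw E (Suc (lev z'))" using up[of "fst z'" "lev z'" "snd z' - snd z"] less by simp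
        moreover have "fst z \<in> tdeg E (lev z')" using lev(1)[of z] z(1,3) by simp
        ultimately show False by (simp add: tdeg_def)
      qed
      have inj: "inj_on lev ?F"
      proof (rule inj_onI)
        fix z z' assume z: "z \<in> ?F" "z' \<in> ?F" "lev z = lev z'"
        then have k: "snd z = snd z'" using no[OF z] no[OF z(2,1) z(3)[symmetric]] by simp
        then have "fst z = fst z'" using z by (auto simp: h_def)
        then show "z = z'" using k by (simp add: prod_eq_iff)
      qed
      \<comment> \<open>On a fibre \<open>l\<close> is constant. It exceeds every level there by
        \<open>tdeg_Lu\<close>, but by less than \<open>1 + card V\<close> by the definition of
        \<open>Bd\<close>.\<close>
      have close: "lev z' \<le> lev z + r" if z: "z \<in> ?F" "z' \<in> ?F" for z z'
      proof -
        have "real (Suc (lev z')) \<le> l \<bullet> fst z'" using lev(1)[of z'] z(2) tdeg_Lu l by blast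
        moreover have "l \<bullet> fst z < real (Suc (lev z) + card V)" using lev(2)[of z] z(1) by blast
        ultimately show ?thesis using ly[OF z(1)] ly[OF z(2)] by (simp add: r_def)
      qed
      show ?thesis
      proof (cases "?F = {}")
        case False
        have finF: "finite ?F" using fin by simp
        then have "Min (lev ` ?F) \<in> lev ` ?F" using False by (intro Min_in) auto
        then obtain z0 where z0: "z0 \<in> ?F" "lev z0 = Min (lev ` ?F)" by force
        have "lev ` ?F \<subseteq> {lev z0..lev z0 + r}" using close[OF z0(1)] finF unfolding z0(2) by auto
        then have "card (lev ` ?F) \<le> card {lev z0..lev z0 + r}" by (intro card_mono) auto
        then show ?thesis using card_image[OF inj] by simp
      qed (simp only: card.empty)
    qed
    then have c1: "card ?X \<le> Suc r * card (h ` ?X)" by (intro card_le_fibers fin)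
    have "card (h ` ?X) \<le> card ?I"
    proof (rule card_mono[OF finite_integral_points])
      show "h ` ?X \<subseteq> ?I"
      proof
        fix y assume "y \<in> h ` ?X"
        then obtain q k where qk: "q \<in> Bd l n" "k \<le> K" "y = q + real k *\<^sub>R u" by (auto simp: h_def)
        obtain m where m: "m < n" "q \<in> tdeg E m" using qk(1) by (auto simp: Bd_def)
        have "norm q \<le> C * (real m + 1)" by (rule C(2)[OF m(2)])
        also have "\<dots> \<le> C * real n" using C(1) m(1) by (intro mult_left_mono) auto
        finally have nq: "norm q \<le> C * real n" .
        have "norm y \<le> norm q + norm (real k *\<^sub>R u)" unfolding qk(3) by (rule norm_triangle_ineq)
        also have "norm (real k *\<^sub>R u) \<le> real K * norm u" using qk(2) by (simp add: mult_right_mono)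
        finally have ny: "norm y \<le> real ?M" using nq by linarith
        have "y \<in> S" unfolding qk(3) by (intro S_add tdeg_S[OF m(2)] S_scale uS)
        then show "y \<in> ?I" using ny component_le_norm_cart[of y] order_trans by (fastforce simp: lattice_points_def)
      qed
    qed
    also have "card ?I \<le> (2 * ?M + 1) ^ CARD('d)" by (rule card_integral_points_le)
    finally have "Suc r * card (h ` ?X) \<le> Suc r * (2 * ?M + 1) ^ CARD('d)" by (rule mult_le_mono2)
    with c1 have "card ?X \<le> Suc r * (2 * ?M + 1) ^ CARD('d)" by (rule le_trans)
    moreover have "card ?X = (K + 1) * card (Bd l n)" by (simp add: card_cartesian_product)
    ultimately show ?thesis by simp
  qed
  show ?thesis
  proof (rule LIMSEQ_I)
    fix e :: real assume e: "e > 0"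
    \<comment> \<open>For large \<open>n\<close> the density of \<open>Bd l n\<close> is at most
      \<open>Q / (K + 1)\<close>, and \<open>K\<close> is taken large enough to push this below
      \<open>e\<close>.\<close>
    define Q where "Q = real (Suc r) * (2 * C + 1) ^ CARD('d)"
    obtain K :: nat where K: "Q / e < real K" using reals_Archimedean2 by blast
    have Ke: "Q / real (K + 1) < e"
    proof -
      have "Q < real K * e" using K e by (simp add: pos_divide_less_eq)
      also have "\<dots> \<le> real (K + 1) * e" using e by (intro mult_right_mono) auto
      finally show ?thesis by (simp add: pos_divide_less_eq mult.commute)
    qed
    \<comment> \<open>From \<open>n0\<close> on the box has at most \<open>(2 * C + 1) * n\<close>
      integers along each side.\<close>
    obtain n0 :: nat where n0: "2 * (real K * norm u) + 3 \<le> real n0" using real_arch_simple by blast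
    have "norm (real (card (Bd l n)) / real n ^ CARD('d) - 0) < e" if n: "n \<ge> max n0 1" for n
    proof -
      let ?M = "nat \<lceil>C * real n + real K * norm u\<rceil>"
      have npos: "real n > 0" using n by simp
      have nn: "0 \<le> C * real n + real K * norm u" using C(1) by simp
      have "real ?M \<le> C * real n + real K * norm u + 1" using nn by linarith
      then have M: "real (2 * ?M + 1) \<le> (2 * C + 1) * real n"
        using n0 n by (simp add: distrib_right)
      have "real ((K + 1) * card (Bd l n)) \<le> real (Suc r * (2 * ?M + 1) ^ CARD('d))"
        using main[of K n] by (rule of_nat_mono)
      also have "\<dots> = real (Suc r) * real (2 * ?M + 1) ^ CARD('d)" by (simp only: of_nat_mult of_nat_power)
      also have "\<dots> \<le> real (Suc r) * ((2 * C + 1) * real n) ^ CARD('d)"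
        by (intro mult_left_mono power_mono M) auto
      also have "\<dots> = Q * real n ^ CARD('d)" by (simp only: Q_def power_mult_distrib mult.assoc)
      finally have "real (K + 1) * real (card (Bd l n)) \<le> Q * real n ^ CARD('d)" by (simp only: of_nat_mult)
      then have "real (card (Bd l n)) / real n ^ CARD('d) \<le> Q / real (K + 1)"
        using npos by (simp add: divide_le_eq le_divide_eq field_simps del: of_nat_Suc of_nat_add)
      then show ?thesis using Ke by simp
    qed
    then show "\<exists>no. \<forall>n\<ge>no. norm (real (card (Bd l n)) / real n ^ CARD('d) - 0) < e" by blast
  qed
qed

text \<open>Squeeze: every counted point is in \<open>Gd n\<close> or close to one of the finitely
  many unbounded facets, and the latter points are of lower order.\<close>

lemma sum_card_tdeg_tendsto:
  "(\<lambda>n. real (\<Sum>m<n. card (tdeg E m)) / real n ^ CARD('d)) \<longlonglongrightarrow> measure lebesgue Y"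
proof (rule tendsto_sandwich)
  have sum: "(\<Sum>m<n. card (tdeg E m)) = card (\<Union>m<n. tdeg E m)" for n
    using finite_tdeg level_unique by (intro card_UN_disjoint[symmetric]) auto
  have split: "(\<Union>m<n. tdeg E m) = Gd n \<union> (\<Union>l\<in>Ls - Lb. Bd l n)" for n
  proof
    show "(\<Union>m<n. tdeg E m) \<subseteq> Gd n \<union> (\<Union>l\<in>Ls - Lb. Bd l n)"
    proof
      fix q assume "q \<in> (\<Union>m<n. tdeg E m)"
      then obtain m where m: "m < n" "q \<in> tdeg E m" by blast
      show "q \<in> Gd n \<union> (\<Union>l\<in>Ls - Lb. Bd l n)"
      proof (cases "\<forall>l\<in>Ls - Lb. real (Suc m + card V) \<le> l \<bullet> q")
        case True
        then have "q \<in> Gd n" unfolding Gd_def using m by blast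
        then show ?thesis ..
      next
        case False
        then obtain l where "l \<in> Ls - Lb" "l \<bullet> q < real (Suc m + card V)" by force
        then have "q \<in> (\<Union>l\<in>Ls - Lb. Bd l n)" unfolding Bd_def using m by blast
        then show ?thesis ..
      qed
    qed
    show "Gd n \<union> (\<Union>l\<in>Ls - Lb. Bd l n) \<subseteq> (\<Union>m<n. tdeg E m)" unfolding Gd_def Bd_def by blast
  qed
  show "(\<lambda>n. real (card (Gd n)) / real n ^ CARD('d)) \<longlonglongrightarrow> measure lebesgue Y" by (rule card_Gd_tendsto)
  have "(\<lambda>n. real (card (Gd n)) / real n ^ CARD('d) + (\<Sum>l\<in>Ls - Lb. real (card (Bd l n)) / real n ^ CARD('d)))
      \<longlonglongrightarrow> measure lebesgue Y + (\<Sum>l\<in>Ls - Lb. 0)"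
    by (intro tendsto_add card_Gd_tendsto tendsto_sum card_Bd_tendsto) auto
  then show "(\<lambda>n. real (card (Gd n)) / real n ^ CARD('d) + (\<Sum>l\<in>Ls - Lb. real (card (Bd l n)) / real n ^ CARD('d)))
      \<longlonglongrightarrow> measure lebesgue Y" by simp
  show "\<forall>\<^sub>F n in sequentially. real (card (Gd n)) / real n ^ CARD('d) \<le> real (\<Sum>m<n. card (tdeg E m)) / real n ^ CARD('d)"
  proof (intro always_eventually allI divide_right_mono)
    fix n
    have "card (Gd n) \<le> card (\<Union>m<n. tdeg E m)" using split finite_UN_tdeg by (intro card_mono) auto
    then show "real (card (Gd n)) \<le> real (\<Sum>m<n. card (tdeg E m))" unfolding sum by (rule of_nat_mono)
  qed simp
  show "\<forall>\<^sub>F n in sequentially. real (\<Sum>m<n. card (tdeg E m)) / real n ^ CARD('d)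
      \<le> real (card (Gd n)) / real n ^ CARD('d) + (\<Sum>l\<in>Ls - Lb. real (card (Bd l n)) / real n ^ CARD('d))"
  proof (intro always_eventually allI)
    fix n
    have "card (\<Union>m<n. tdeg E m) \<le> card (Gd n) + card (\<Union>l\<in>Ls - Lb. Bd l n)"
      unfolding split by (rule card_Un_le)
    also have "card (\<Union>l\<in>Ls - Lb. Bd l n) \<le> (\<Sum>l\<in>Ls - Lb. card (Bd l n))"
      using finite_Ls by (intro card_UN_le) simp
    finally have "real (\<Sum>m<n. card (tdeg E m)) \<le> real (card (Gd n) + (\<Sum>l\<in>Ls - Lb. card (Bd l n)))"
      unfolding sum by (intro of_nat_mono) simp
    then have "real (\<Sum>m<n. card (tdeg E m)) / real n ^ CARD('d)
        \<le> real (card (Gd n) + (\<Sum>l\<in>Ls - Lb. card (Bd l n))) / real n ^ CARD('d)"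
      by (intro divide_right_mono) auto
    also have "\<dots> = real (card (Gd n)) / real n ^ CARD('d) + (\<Sum>l\<in>Ls - Lb. real (card (Bd l n)) / real n ^ CARD('d))"
      by (simp add: add_divide_distrib sum_divide_distrib)
    finally show "real (\<Sum>m<n. card (tdeg E m)) / real n ^ CARD('d)
      \<le> real (card (Gd n)) / real n ^ CARD('d) + (\<Sum>l\<in>Ls - Lb. real (card (Bd l n)) / real n ^ CARD('d))" .
  qed
qed

end

theorem theorem4p1:
  fixes \<sigma> :: "(real ^ 'd) set"
    and I :: "(((real ^ 'd) \<Rightarrow>\<^sub>0 'k::field) \<times> ((real ^ 'd) \<Rightarrow>\<^sub>0 'k)) set set"
  assumes "rational_cone \<sigma>"
    and "pointed \<sigma>"
    and "aff_dim \<sigma> = int CARD('d)"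
    and "monomial_ideal \<sigma> I"
  shows "convergent (j_sequence (local_semigroup_ring \<sigma>) I) \<and>
    j_multiplicity (local_semigroup_ring \<sigma>) I =
      ereal (fact CARD('d) * measure lebesgue (ideal_pyr \<sigma> I))"
proof -
  interpret cone_ring \<sigma> "TYPE('k)" by unfold_locales (rule assms)+
  obtain V where V: "V \<subseteq> S" "I = monomials_ideal \<sigma> V" using assms(4) unfolding monomial_ideal_def by blast
  define E where "E = span_ideal V"
  have E: "sideal E" unfolding E_def by (rule sideal_span_ideal[OF V(1)])
  have I: "I = ext E" unfolding V(2) E_def by (rule monomials_ideal_eq[OF V(1)])
  interpret N: newton_data \<sigma> E by unfold_locales (rule E)
  \<comment> \<open>Writing the dimension as a successor turns the exponent \<open>d - 1\<close> of
    the normalisation into \<open>e\<close>.\<close>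
  obtain e where e: "CARD('d) = Suc e" using zero_less_card_finite[where 'a = 'd] gr0_implies_Suc by blast
  have "min_gen_exponents \<sigma> I = min_gens E"
    unfolding V(2) E_def by (rule min_gen_exponents_eq[OF V(1)])
  then have np: "newton_polyhedron \<sigma> I = N.PP"
    by (simp only: newton_polyhedron_def N.PP_def)
  have seq: "j_sequence A I n = ereal (fact e * (real (card (tdeg E n)) / real n ^ e))" for n
  proof -
    interpret G: graded_step \<sigma> "TYPE('k)" E n by unfold_locales (rule E)
    have "module_length A G.H = enat (card G.T)"
      by (rule G.length_H) (use N.finite_tdeg in \<open>simp add: G.T_def tdeg_def\<close>)
    then have "module_length A (H0 A (local_max_ideal A)
        (quotient_module (ideal_module A (ideal_power A I n)) (ideal_power A I (Suc n)))) = enat (card (tdeg E n))"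
      unfolding I ideal_power_ext[OF E] by (simp only: G.T_def tdeg_def)
    then show ?thesis
      unfolding j_sequence_def krull_dim_A Let_def the_enat.simps e by simp
  qed
  have vol: "(\<lambda>n. real (card (tdeg E n)) / real n ^ e) \<longlonglongrightarrow> real CARD('d) * measure lebesgue (ideal_pyr \<sigma> I)"
  proof (cases "E = {}")
    case True
    \<comment> \<open>The zero ideal: its polyhedron is empty, and its positive powers are zero. The
      index \<open>0\<close> is skipped because \<open>pw E 0\<close> is all of
      \<open>S\<close>.\<close>
    have "N.PP = {}" unfolding N.PP_def using True by (simp add: min_gens_def)
    then have "ideal_pyr \<sigma> I = {}" unfolding ideal_pyr_def np by (auto simp: facet_of_def face_of_def)
    moreover have "tdeg E (Suc n) = {}" for n unfolding tdeg_def tors_def pw.simps(2) using True by blast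
    then have "(\<lambda>n. real (card (tdeg E (Suc n))) / real (Suc n) ^ e) \<longlonglongrightarrow> 0" by simp
    then have "(\<lambda>n. real (card (tdeg E n)) / real n ^ e) \<longlonglongrightarrow> 0" by (rule LIMSEQ_imp_Suc)
    ultimately show ?thesis by simp
  next
    case False
    then interpret NN: newton_nonempty \<sigma> E by unfold_locales
    have "(\<lambda>n. real (\<Sum>m<n. card (tdeg E m)) / real n ^ Suc e) \<longlonglongrightarrow> measure lebesgue NN.Y"
      using NN.sum_card_tdeg_tendsto unfolding e .
    then have "(\<lambda>n. real (card (tdeg E n)) / real n ^ e) \<longlonglongrightarrow> real (Suc e) * measure lebesgue NN.Y"
      by (rule increments_tendsto_of_partial_sums[OF N.ev_mono_card_tdeg])
    moreover have "measure lebesgue (ideal_pyr \<sigma> I) = measure lebesgue NN.Y"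
      unfolding ideal_pyr_def np by (rule NN.measure_pyr)
    ultimately show ?thesis unfolding e by simp
  qed
  have "(\<lambda>n. fact e * (real (card (tdeg E n)) / real n ^ e)) \<longlonglongrightarrow> fact e * (real CARD('d) * measure lebesgue (ideal_pyr \<sigma> I))"
    by (intro tendsto_mult tendsto_const vol)
  also have "fact e * (real CARD('d) * measure lebesgue (ideal_pyr \<sigma> I)) = fact CARD('d) * measure lebesgue (ideal_pyr \<sigma> I)"
    unfolding e by simp
  finally have "(\<lambda>n. ereal (fact e * (real (card (tdeg E n)) / real n ^ e))) \<longlonglongrightarrow> ereal (fact CARD('d) * measure lebesgue (ideal_pyr \<sigma> I))"
    by (simp only: lim_ereal)
  moreover have "j_sequence A I = (\<lambda>n. ereal (fact e * (real (card (tdeg E n)) / real n ^ e)))"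
    by (rule HOL.ext) (rule seq)
  ultimately have lim: "j_sequence A I \<longlonglongrightarrow> ereal (fact CARD('d) * measure lebesgue (ideal_pyr \<sigma> I))" by simp
  then show ?thesis unfolding j_multiplicity_def using convergentI limI by blast
qed

end
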